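(* Let $n\geq4$. For every solution $(u,b,p)$ obtained by the construction described in the context (these are nontrivial compactly supported bounded weak solutions of the ideal MHD equations on $\mathbb{R}^n_x\times\mathbb{R}_t$ with zero forces), there exists a sequence $\{(u_k,b_k,p_k,f_k,g_k)\}\subset C_0^\infty(\mathbb{R}^n_x\times\mathbb{R}_t)$ of solutions of the forced ideal MHD equations $$\partial_t u_k+\mathrm{div}(u_k\otimes u_k-b_k\otimes b_k)+\nabla p_k=f_k,\qquad \partial_t b_k+\mathrm{div}(b_k\otimes u_k-u_k\otimes b_k)=g_k,\qquad \mathrm{div}\,u_k=\mathrm{div}\,b_k=0$$ such that $\|(u_k,b_k,p_k)\|_{L^\infty}$ remains uniformly bounded and, for any $m\in[2,\infty)$, as $k\to\infty$, $$(u_k,b_k,p_k)\longrightarrow(u,b,p)\ \text{ in }L^m,\qquad (f_k,g_k)\longrightarrow(0,0)\ \text{ in }W^{-1,m}.$$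
   Context: Here $\mathrm{div}$, $\nabla$ act in $x\in\mathbb{R}^n$, $(v\otimes w)_{ij}=v_iw_j$, and the divergence of a matrix field is taken row by row. $L^m$ and $W^{-1,m}$ are taken over $\mathbb{R}^n_x\times\mathbb{R}_t\cong\mathbb{R}^{n+1}$, and $W^{-1,m}$ is the dual of $W^{1,m'}_0$, $m'=m/(m-1)$. Sets. $\mathscr{S}_0^n$ is the space of symmetric trace-free real $n\times n$ matrices and $\mathscr{S}_-^n$ the space of skew-symmetric ones. Let $$K=\{(u,b,M,Q)\in\mathbb{S}^{n-1}\times\mathbb{S}^{n-1}\times\mathscr{S}_0^n\times\mathscr{S}_-^n : M=u\otimes u-b\otimes b,\ Q=b\otimes u-u\otimes b\},$$ let $K^{c_0}$ be its convex hull, and let $\mathscr{U}=\mathrm{int}(K^{c_0}\times[-1,1])$, the interior in $\mathbb{R}^n\times\mathbb{R}^n\times\mathscr{S}_0^n\times\mathscr{S}_-^n\times\mathbb{R}$. Relaxed solutions. Fix a bounded domain $\Omega\subset\mathbb{R}^n_x\times\mathbb{R}_t$. $X_0$ is the set of smooth $z=(u,b,M,Q,q):\mathbb{R}^n_x\times\mathbb{R}_t\to\mathbb{R}^n\times\mathbb{R}^n\times\mathscr{S}_0^n\times\mathscr{S}_-^n\times\mathbb{R}$ with $\mathrm{supp}\,z\subset\Omega$, $z(x,t)\in\mathscr{U}$ for all $(x,t)$, and solving $$\partial_tu+\mathrm{div}M+\nabla q=0,\quad \partial_tb+\mathrm{div}Q=0,\quad \mathrm{div}\,u=\mathrm{div}\,b=0\quad\text{in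 }\mathbb{R}^n_x\times\mathbb{R}_t.$$ $X$ is the closure of $X_0$ in the weak* topology of $L^\infty$ (functions on $\mathbb{R}^n_x\times\mathbb{R}_t$ vanishing outside $\Omega$), endowed with a metric $d_\infty^*$ inducing this topology. For $m\ge2$, $I_m:(X,d_\infty^* )\to L^m(\mathbb{R}^n_x\times\mathbb{R}_t)$ is the identity map. Solutions obtained by the construction. $(u,b,p)$ is a solution obtained by the construction if, for some bounded domain $\Omega$, there is $z=(u,b,M,Q,q)\in X$ with $p=q$ such that, for some $m\ge 2$, one of the following holds. (a) $z$ is a continuity point of $I_m$. (b) $z$ is a weak* limit of a subsequence of a sequence $z_j=(u_j,b_j,M_j,Q_j,q_j)\in X_0$, $j\ge0$, with $z_0\equiv0$, for which there are a constant $\beta>0$ depending only on $n,m,|\Omega|$ and numbers $0<r_j<2^{-j}$ such that for all $j\ge1$ $$\|u_j\|_{L^m(\Omega)}^m+\|b_j\|_{L^m(\Omega)}^m\ge\|u_{j-1}\|_{L^m(\Omega)}^m+\|b_{j-1}\|_{L^m(\Omega)}^m+\tfrac{\beta}{2}\big(2|\Omega|-\|u_{j-1}\|_{L^m(\Omega)}^m-\|b_{j-1}\|_{L^m(\Omega)}^m\big)^m,$$ $$\|z_j-z_j*\rho_{r_j}\|_{L^m(\Omega)}<2^{-j},\qquad \|(z_j-z_{j-1})*\rho_{r_i}\|_{L^m(\Omega)}<2^{-j}\ \ (0\le i\le j-1),$$ where $\rho_r(y)=r^{-(n+1)}\rho(y/r)$ is a standard mollifier on $\mathbb{R}^{n+1}$.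 *)

theory Defs
  imports "HOL-Analysis.Analysis"
begin

section \<open>Smooth functions and differential operators in space-time\<close>

text \<open>Points of space-time are pairs \<open>(x, t)\<close>; a state is \<open>(u, b, M, Q, q)\<close>. The norms and inner
  products below are the Euclidean ones of the product types (Frobenius on matrices).\<close>

type_synonym 'n spacetime = "(real^'n) \<times> real"
type_synonym 'n state = "(real^'n) \<times> (real^'n) \<times> (real^'n^'n) \<times> (real^'n^'n) \<times> real"

primrec Ck :: "nat \<Rightarrow> ('a::real_normed_vector \<Rightarrow> 'b::real_normed_vector) \<Rightarrow> bool" where
  "Ck 0 f \<longleftrightarrow> continuous_on UNIV f"
| "Ck (Suc k) f \<longleftrightarrow>
     (\<forall>x. f differentiable (at x)) \<and> (\<forall>v. Ck k (\<lambda>x. frechet_derivative f (at x) v))"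

definition smooth :: "('a::real_normed_vector \<Rightarrow> 'b::real_normed_vector) \<Rightarrow> bool" where
  "smooth f \<longleftrightarrow> (\<forall>k. Ck k f)"

definition fun_supp :: "('a::topological_space \<Rightarrow> 'b::zero) \<Rightarrow> 'a set" where
  "fun_supp f = closure {y. f y \<noteq> 0}"

definition Cc_infty :: "('a::real_normed_vector \<Rightarrow> 'b::real_normed_vector) set" where
  "Cc_infty = {f. smooth f \<and> compact (fun_supp f)}"

definition dt :: "('n::finite spacetime \<Rightarrow> 'b::real_normed_vector) \<Rightarrow> 'n spacetime \<Rightarrow> 'b" where
  "dt f y = frechet_derivative f (at y) (0, 1)"

definition dx :: "'n::finite \<Rightarrow> ('n spacetime \<Rightarrow> 'b::real_normed_vector) \<Rightarrow> 'n spacetime \<Rightarrow> 'b" where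
  "dx j f y = frechet_derivative f (at y) (axis j 1, 0)"

definition grad_x :: "('n::finite spacetime \<Rightarrow> real) \<Rightarrow> 'n spacetime \<Rightarrow> real^'n" where
  "grad_x p y = (\<chi> i. dx i p y)"

definition div_x :: "('n::finite spacetime \<Rightarrow> real^'n) \<Rightarrow> 'n spacetime \<Rightarrow> real" where
  "div_x v y = (\<Sum>j\<in>UNIV. dx j (\<lambda>y. v y $ j) y)"

text \<open>The first index of a matrix of type \<open>real^'n^'n\<close> is the row index.\<close>

definition Div_x :: "('n::finite spacetime \<Rightarrow> real^'n^'n) \<Rightarrow> 'n spacetime \<Rightarrow> real^'n" where
  "Div_x A y = (\<chi> i. div_x (\<lambda>y. A y $ i) y)"

definition outer :: "real^'n \<Rightarrow> real^'n \<Rightarrow> real^'n^'n" where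
  "outer v w = (\<chi> i j. v $ i * w $ j)"


section \<open>Lebesgue norms, mollification, Sobolev spaces\<close>

text \<open>Elements of Lebesgue spaces are represented by functions; all notions below are invariant
  under changes on null sets. \<open>Lnorm\<close> is the usual norm for functions whose \<open>m\<close>-th power is
  integrable on \<open>S\<close>. It is applied only to such functions: bounded measurable ones with bounded
  support, or ones explicitly required to satisfy \<open>Lspace\<close>.\<close>

definition Lspace :: "real \<Rightarrow> ('a::euclidean_space \<Rightarrow> 'b::euclidean_space) set" where
  "Lspace m = {f. f \<in> borel_measurable lebesgue \<and> integrable lebesgue (\<lambda>y. norm (f y) powr m)}"

definition Lnorm :: "real \<Rightarrow> 'a::euclidean_space set \<Rightarrow> ('a \<Rightarrow> 'b::euclidean_space) \<Rightarrow> real" where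
  "Lnorm m S f = (LINT y:S|lebesgue. norm (f y) powr m) powr (1 / m)"

definition tendsto_Lm ::
    "real \<Rightarrow> (nat \<Rightarrow> 'a::euclidean_space \<Rightarrow> 'b::euclidean_space) \<Rightarrow> ('a \<Rightarrow> 'b) \<Rightarrow> bool" where
  "tendsto_Lm m F f \<longleftrightarrow> f \<in> Lspace m \<and> (\<forall>k. F k \<in> Lspace m) \<and>
     (\<lambda>k. Lnorm m UNIV (\<lambda>y. F k y - f y)) \<longlonglongrightarrow> 0"

definition mollifier :: "('a::euclidean_space \<Rightarrow> real) \<Rightarrow> bool" where
  "mollifier \<rho> \<longleftrightarrow> smooth \<rho> \<and> (\<forall>y. 0 \<le> \<rho> y) \<and> fun_supp \<rho> \<subseteq> cball 0 1 \<and>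
     integral\<^sup>L lebesgue \<rho> = 1"

definition mollify ::
    "('a::euclidean_space \<Rightarrow> real) \<Rightarrow> real \<Rightarrow> ('a \<Rightarrow> 'b::euclidean_space) \<Rightarrow> 'a \<Rightarrow> 'b" where
  "mollify \<rho> r f y = (LINT w|lebesgue. (\<rho> ((y - w) /\<^sub>R r) / r ^ DIM('a)) *\<^sub>R f w)"

definition weak_partial ::
    "'a::euclidean_space \<Rightarrow> ('a \<Rightarrow> 'b::euclidean_space) \<Rightarrow> ('a \<Rightarrow> 'b) \<Rightarrow> bool" where
  "weak_partial e \<phi> G \<longleftrightarrow> (\<forall>\<psi> :: 'a \<Rightarrow> real. \<psi> \<in> Cc_infty \<longrightarrow>
     (LINT y|lebesgue. frechet_derivative \<psi> (at y) e *\<^sub>R \<phi> y) = - (LINT y|lebesgue. \<psi> y *\<^sub>R G y))"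

text \<open>A Sobolev function \<open>\<phi>\<close> is carried together with its weak partial derivatives \<open>G e\<close> in the
  coordinate directions \<open>e\<close>.\<close>

definition sobolev1 ::
    "real \<Rightarrow> ('a::euclidean_space \<Rightarrow> 'b::euclidean_space) \<Rightarrow> ('a \<Rightarrow> 'a \<Rightarrow> 'b) \<Rightarrow> bool" where
  "sobolev1 s \<phi> G \<longleftrightarrow> \<phi> \<in> Lspace s \<and> (\<forall>e\<in>Basis. G e \<in> Lspace s \<and> weak_partial e \<phi> (G e))"

definition sobolev1_norm ::
    "real \<Rightarrow> ('a::euclidean_space \<Rightarrow> 'b::euclidean_space) \<Rightarrow> ('a \<Rightarrow> 'a \<Rightarrow> 'b) \<Rightarrow> real" where
  "sobolev1_norm s \<phi> G =
     (Lnorm s UNIV \<phi> powr s + (\<Sum>e\<in>Basis. Lnorm s UNIV (G e) powr s)) powr (1 / s)"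

text \<open>\<open>W\<^sub>0\<^sup>1\<^sup>,\<^sup>s\<close>: the closure of the test functions in \<open>W\<^sup>1\<^sup>,\<^sup>s\<close>.\<close>

definition sobolev1_0 ::
    "real \<Rightarrow> ('a::euclidean_space \<Rightarrow> 'b::euclidean_space) \<Rightarrow> ('a \<Rightarrow> 'a \<Rightarrow> 'b) \<Rightarrow> bool" where
  "sobolev1_0 s \<phi> G \<longleftrightarrow> sobolev1 s \<phi> G \<and>
     (\<exists>\<psi> :: nat \<Rightarrow> 'a \<Rightarrow> 'b. (\<forall>i. \<psi> i \<in> Cc_infty) \<and>
       (\<lambda>i. sobolev1_norm s (\<lambda>y. \<psi> i y - \<phi> y)
              (\<lambda>e y. frechet_derivative (\<psi> i) (at y) e - G e y)) \<longlonglongrightarrow> 0)"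

text \<open>The norm in \<open>W\<^sup>-\<^sup>1\<^sup>,\<^sup>m\<close>, the dual of \<open>W\<^sub>0\<^sup>1\<^sup>,\<^sup>s\<close> with \<open>s = m / (m - 1)\<close>, of the functional
  represented by a function \<open>h\<close>.\<close>

definition dual_norm :: "real \<Rightarrow> ('a::euclidean_space \<Rightarrow> 'b::euclidean_space) \<Rightarrow> ennreal" where
  "dual_norm m h =
     (SUP (\<phi>, G) \<in> {(\<phi>, G). sobolev1_0 (m / (m - 1)) \<phi> G \<and> sobolev1_norm (m / (m - 1)) \<phi> G \<le> 1}.
        ennreal \<bar>LINT y|lebesgue. h y \<bullet> \<phi> y\<bar>)"


section \<open>The constraint set and its relaxation\<close>

definition sym_tracefree :: "(real^'n^'n::finite) set" where
  "sym_tracefree = {M. transpose M = M \<and> trace M = 0}"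

definition skew :: "(real^'n^'n::finite) set" where
  "skew = {Q. transpose Q = - Q}"

definition state_space :: "('n::finite state) set" where
  "state_space = {(u, b, M, Q, q). M \<in> sym_tracefree \<and> Q \<in> skew}"

definition Kset :: "((real^'n) \<times> (real^'n) \<times> (real^'n^'n) \<times> (real^'n^'n::finite)) set" where
  "Kset = {(u, b, M, Q). u \<in> sphere 0 1 \<and> b \<in> sphere 0 1 \<and> M \<in> sym_tracefree \<and> Q \<in> skew \<and>
     M = outer u u - outer b b \<and> Q = outer b u - outer u b}"

definition Uset :: "('n::finite state) set" where
  "Uset = top_of_set state_space interior_of
     {(u, b, M, Q, q). (u, b, M, Q) \<in> convex hull Kset \<and> q \<in> {-1..1}}"


section \<open>Relaxed solutions\<close>

definition bounded_domain :: "'a::euclidean_space set \<Rightarrow> bool" where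
  "bounded_domain \<Omega> \<longleftrightarrow> open \<Omega> \<and> connected \<Omega> \<and> \<Omega> \<noteq> {} \<and> bounded \<Omega>"

definition relaxed_mhd :: "('n::finite spacetime \<Rightarrow> 'n state) \<Rightarrow> bool" where
  "relaxed_mhd z \<longleftrightarrow> (\<exists>u b M Q q. z = (\<lambda>y. (u y, b y, M y, Q y, q y)) \<and>
     (\<forall>y. dt u y + Div_x M y + grad_x q y = 0 \<and> dt b y + Div_x Q y = 0 \<and>
          div_x u y = 0 \<and> div_x b y = 0))"

definition X0 :: "'n::finite spacetime set \<Rightarrow> ('n spacetime \<Rightarrow> 'n state) set" where
  "X0 \<Omega> = {z. smooth z \<and> fun_supp z \<subseteq> \<Omega> \<and> (\<forall>y. z y \<in> Uset) \<and> relaxed_mhd z}"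

definition Linf :: "'n::finite spacetime set \<Rightarrow> ('n spacetime \<Rightarrow> 'n state) set" where
  "Linf \<Omega> = {z. z \<in> borel_measurable lebesgue \<and> (\<exists>C. AE y in lebesgue. norm (z y) \<le> C) \<and>
     (AE y in lebesgue. z y \<in> state_space) \<and> (AE y in lebesgue. y \<notin> \<Omega> \<longrightarrow> z y = 0)}"

definition weak_star :: "'n::finite spacetime set \<Rightarrow> ('n spacetime \<Rightarrow> 'n state) topology" where
  "weak_star \<Omega> = topology_generated_by
     {{z \<in> Linf \<Omega>. (LINT y|lebesgue. z y \<bullet> \<phi> y) \<in> A} | \<phi> A. integrable lebesgue \<phi> \<and> open A}"

definition X :: "'n::finite spacetime set \<Rightarrow> ('n spacetime \<Rightarrow> 'n state) set" where
  "X \<Omega> = weak_star \<Omega> closure_of X0 \<Omega>"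

text \<open>A metric on \<open>X \<Omega>\<close> (functions that agree almost everywhere being identified) which induces
  the weak* topology. Such metrics exist since \<open>X \<Omega>\<close> is bounded in \<open>L\<^sup>\<infinity>\<close> and \<open>L\<^sup>1\<close> is
  separable.\<close>

definition weak_star_metric ::
    "'n::finite spacetime set \<Rightarrow>
     (('n spacetime \<Rightarrow> 'n state) \<Rightarrow> ('n spacetime \<Rightarrow> 'n state) \<Rightarrow> real) \<Rightarrow> bool" where
  "weak_star_metric \<Omega> d \<longleftrightarrow>
     (\<forall>z\<in>X \<Omega>. \<forall>w\<in>X \<Omega>. 0 \<le> d z w \<and> d z w = d w z \<and>
        (d z w = 0 \<longleftrightarrow> (AE y in lebesgue. z y = w y))) \<and>
     (\<forall>z\<in>X \<Omega>. \<forall>w\<in>X \<Omega>. \<forall>v\<in>X \<Omega>. d z v \<le> d z w + d w v) \<and>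
     (\<forall>S. S \<subseteq> X \<Omega> \<longrightarrow>
        (openin (subtopology (weak_star \<Omega>) (X \<Omega>)) S \<longleftrightarrow>
         (\<forall>z\<in>S. \<exists>\<delta>>0. \<forall>w\<in>X \<Omega>. d z w < \<delta> \<longrightarrow> w \<in> S)))"

text \<open>Continuity at \<open>z\<close> of the identity from \<open>X \<Omega>\<close> with a metric as above to \<open>L\<^sup>m\<close>. All these
  metrics induce the same topology, so the choice of \<open>d\<close> is immaterial.\<close>

definition continuity_point ::
    "'n::finite spacetime set \<Rightarrow> real \<Rightarrow> ('n spacetime \<Rightarrow> 'n state) \<Rightarrow> bool" where
  "continuity_point \<Omega> m z \<longleftrightarrow> (\<exists>d. weak_star_metric \<Omega> d \<and>
     (\<forall>\<epsilon>>0. \<exists>\<delta>>0. \<forall>w\<in>X \<Omega>. d z w < \<delta> \<longrightarrow> Lnorm m UNIV (\<lambda>y. w y - z y) < \<epsilon>))"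


section \<open>Solutions obtained by the construction\<close>

definition energy ::
    "'n::finite spacetime set \<Rightarrow> real \<Rightarrow> ('n spacetime \<Rightarrow> 'n state) \<Rightarrow> real" where
  "energy \<Omega> m z = Lnorm m \<Omega> (\<lambda>y. fst (z y)) powr m + Lnorm m \<Omega> (\<lambda>y. fst (snd (z y))) powr m"

text \<open>The dependence of \<open>\<beta>\<close> on \<open>n\<close>, \<open>m\<close> and \<open>|\<Omega>|\<close> only means that \<open>\<beta>\<close> is a number chosen
  independently of \<open>j\<close>. The base of the last power is nonnegative since \<open>|u|, |b| \<le> 1\<close> on
  \<open>Uset\<close>.\<close>

definition iteration_limit ::
    "'n::finite spacetime set \<Rightarrow> real \<Rightarrow> ('n spacetime \<Rightarrow> 'n state) \<Rightarrow> bool" where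
  "iteration_limit \<Omega> m z \<longleftrightarrow>
     (\<exists>(zs :: nat \<Rightarrow> 'n spacetime \<Rightarrow> 'n state) (r :: nat \<Rightarrow> real) (\<beta> :: real) \<rho>.
        (\<forall>j. zs j \<in> X0 \<Omega>) \<and> zs 0 = (\<lambda>y. 0) \<and> \<beta> > 0 \<and> mollifier \<rho> \<and>
        (\<forall>j. 0 < r j \<and> r j < (1 / 2) ^ j) \<and>
        (\<forall>j\<ge>1.
           energy \<Omega> m (zs j) \<ge> energy \<Omega> m (zs (j - 1))
             + \<beta> / 2 * (2 * measure lebesgue \<Omega> - energy \<Omega> m (zs (j - 1))) powr m \<and>
           Lnorm m \<Omega> (\<lambda>y. zs j y - mollify \<rho> (r j) (zs j) y) < (1 / 2) ^ j \<and>
           (\<forall>i\<le>j - 1. Lnorm m \<Omega> (mollify \<rho> (r i) (\<lambda>y. zs j y - zs (j - 1) y)) < (1 / 2) ^ j)) \<and>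
        (\<exists>\<sigma>. strict_mono \<sigma> \<and> limitin (weak_star \<Omega>) (zs \<circ> \<sigma>) z sequentially))"

definition constructed ::
    "('n::finite spacetime \<Rightarrow> real^'n) \<Rightarrow> ('n spacetime \<Rightarrow> real^'n) \<Rightarrow> ('n spacetime \<Rightarrow> real) \<Rightarrow> bool"
  where
  "constructed u b p \<longleftrightarrow> (\<exists>\<Omega> M Q q. bounded_domain \<Omega> \<and> p = q \<and>
     (let z = (\<lambda>y. (u y, b y, M y, Q y, q y)) in
        z \<in> X \<Omega> \<and> (\<exists>m\<ge>2. continuity_point \<Omega> m z \<or> iteration_limit \<Omega> m z)))"

definition forced_mhd ::
    "('n::finite spacetime \<Rightarrow> real^'n) \<Rightarrow> ('n spacetime \<Rightarrow> real^'n) \<Rightarrow> ('n spacetime \<Rightarrow> real) \<Rightarrow>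
     ('n spacetime \<Rightarrow> real^'n) \<Rightarrow> ('n spacetime \<Rightarrow> real^'n) \<Rightarrow> bool" where
  "forced_mhd u b p f g \<longleftrightarrow> (\<forall>y.
     dt u y + Div_x (\<lambda>y. outer (u y) (u y) - outer (b y) (b y)) y + grad_x p y = f y \<and>
     dt b y + Div_x (\<lambda>y. outer (b y) (u y) - outer (u y) (b y)) y = g y \<and>
     div_x u y = 0 \<and> div_x b y = 0)"

end

theory Submission
  imports Defs
begin

text \<open>A constructed solution is the \<open>(u, b, q)\<close>-part of some \<open>z \<in> X \<Omega>\<close>. Two facts about such a \<open>z\<close> give the
theorem: it is a strong limit (in \<open>L\<^sup>1\<close>, hence in every \<open>L\<^sup>m\<close>, everything being bounded and supported in
the bounded set \<open>\<Omega>\<close>) of relaxed solutions \<open>z\<^sub>k \<in> X0 \<Omega>\<close>, and it is saturated, that is,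
\<open>|u| = |b| = 1\<close> almost everywhere in \<open>\<Omega>\<close>. A state of the convex hull of \<open>Kset\<close> with
\<open>|u| = |b| = 1\<close> lies in \<open>Kset\<close> itself (\<open>hull_Kset_extreme\<close>), so the relaxed fluxes of \<open>z\<close> are the true
ones. The required smooth solutions are simply the components \<open>u\<^sub>k, b\<^sub>k, q\<^sub>k\<close> of \<open>z\<^sub>k\<close>. Since \<open>z\<^sub>k\<close> solves the
linear system, the forces are divergences of the residuals \<open>u\<^sub>k \<otimes> u\<^sub>k - b\<^sub>k \<otimes> b\<^sub>k - M\<^sub>k\<close> and
\<open>b\<^sub>k \<otimes> u\<^sub>k - u\<^sub>k \<otimes> b\<^sub>k - Q\<^sub>k\<close>. These are bounded and tend to \<open>0\<close> almost everywhere, hence in \<open>L\<^sup>m\<close>, and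
a divergence is bounded in \<open>W\<^sup>-\<^sup>1\<^sup>,\<^sup>m\<close> by the \<open>L\<^sup>m\<close> norm of its argument
(\<open>dual_norm_Div_x\<close>, \<open>forced_solutions_of_strong_approximation\<close>).

For a limit of the iteration, the energy inequality drives the gap \<open>2|\<Omega>| - energy\<close> to \<open>0\<close>
(\<open>gap_iteration_tendsto_0\<close>), and the mollification conditions turn weak* into strong convergence:
\<open>z\<^sub>j\<close> is close to its mollification at scale \<open>r\<^sub>j\<close>, which is close to the mollification of \<open>z\<close> at that
scale, which is close to \<open>z\<close>. Strong convergence carries the full energy over to \<open>z\<close>
(\<open>iteration_limit_saturated\<close>).

At a continuity point, strong approximation is immediate, and saturation is a convex integration
argument (\<open>continuity_point_saturated\<close>): every relaxed solution close to \<open>z\<close> can be perturbed by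
arbitrarily little in the weak* topology and yet, in \<open>L\<^sup>1\<close>, by a fixed multiple of the volume of the set
where it is not nearly saturated (\<open>weak_star_perturbation\<close>); at a continuity point that volume must tend
to \<open>0\<close>. The perturbation has three ingredients. By Caratheodory's theorem a state of \<open>Uset\<close> that is
not nearly saturated is the centre of a segment in \<open>Uset\<close> parallel to a difference of two points of
\<open>Kset\<close>, of length bounded below (\<open>Uset_segment\<close>). Such a difference is the amplitude of a plane wave
solving the linear system, and these waves have compactly supported versions: in the formula that
defines a point of \<open>Kset\<close> one replaces the vectors \<open>u\<close> and \<open>b\<close> by commuting divergence-free first-order
operators, which gives a potential for solutions (\<open>wave_exists\<close>). The wave vector has to be orthogonal
to three vectors of \<open>\<real>\<^sup>n\<close>, and this is where \<open>n \<ge> 4\<close> enters. Finally the waves, cut off on balls and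
oscillating fast, are distributed by Vitali's covering theorem; by the Riemann-Lebesgue lemma they
are weakly small while their \<open>L\<^sup>1\<close> norm persists (\<open>local_wave\<close>).\<close>

section \<open>Calculus of smooth functions\<close>

abbreviation dd :: "'a::real_normed_vector \<Rightarrow> ('a \<Rightarrow> 'b::real_normed_vector) \<Rightarrow> 'a \<Rightarrow> 'b" where
  "dd v f \<equiv> (\<lambda>y. frechet_derivative f (at y) v)"

lemma dd_eq: "(f has_derivative f') (at y) \<Longrightarrow> dd v f y = f' v"
  by (metis frechet_derivative_at)

lemma Ck_SucD: "Ck (Suc k) f \<Longrightarrow> Ck k f"
proof (induction k arbitrary: f)
  case 0
  then have "f differentiable_on UNIV"
    by (auto simp: differentiable_on_def)
  then show ?case
    by (simp add: differentiable_imp_continuous_on)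
next
  case (Suc k)
  from Suc.prems have "\<forall>x. f differentiable (at x)" "\<And>v. Ck (Suc k) (dd v f)"
    by (auto simp only: Ck.simps)
  moreover from this(2) have "Ck k (dd v f)" for v by (rule Suc.IH)
  ultimately show ?case by (simp only: Ck.simps(2)) blast
qed

lemma Ck_has_derivative: "Ck (Suc k) f \<Longrightarrow> (f has_derivative (\<lambda>v. dd v f x)) (at x)"
  by (simp add: frechet_derivative_works)

lemma Ck_SucI:
  assumes "\<And>x. (f has_derivative f' x) (at x)" "\<And>v. Ck k (\<lambda>x. f' x v)"
  shows "Ck (Suc k) f"
proof -
  have "dd v f = (\<lambda>x. f' x v)" for v by (intro ext dd_eq assms)
  with assms show ?thesis by (auto intro: differentiableI)
qed

lemma Ck_continuous: "Ck k f \<Longrightarrow> continuous_on UNIV f"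
  by (induction k) (auto simp del: Ck.simps(2) dest: Ck_SucD)

lemma smooth_differentiable: "smooth f \<Longrightarrow> f differentiable (at x)"
  unfolding smooth_def by (metis Ck.simps(2))

lemma smooth_has_derivative: "smooth f \<Longrightarrow> (f has_derivative (\<lambda>v. dd v f x)) (at x)"
  using smooth_differentiable frechet_derivative_works by blast

lemma smooth_continuous: "smooth f \<Longrightarrow> continuous_on S f"
  unfolding smooth_def by (metis Ck_continuous continuous_on_subset subset_UNIV)

lemma smooth_dd: "smooth f \<Longrightarrow> smooth (dd v f)"
  unfolding smooth_def by (metis Ck.simps(2))

lemma dd_linear: "smooth f \<Longrightarrow> linear (\<lambda>v. dd v f x)"
  using smooth_has_derivative has_derivative_linear by blast

lemma Ck_const: "Ck k (\<lambda>x. c)"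
proof (induction k arbitrary: c)
  case (Suc k)
  have "dd v (\<lambda>x. c) = (\<lambda>x. 0)" for v :: 'a by (intro ext dd_eq) (auto intro: derivative_eq_intros)
  with Suc show ?case by simp
qed simp

lemma Ck_bounded_linear:
  assumes "bounded_linear L" shows "Ck k f \<Longrightarrow> Ck k (\<lambda>x. L (f x))"
proof (induction k arbitrary: f)
  case 0
  then show ?case using assms by (auto intro: linear_continuous_on continuous_on_compose2)
next
  case (Suc k)
  then have f: "(f has_derivative (\<lambda>v. dd v f x)) (at x)" for x
    by (auto intro: Ck_has_derivative)
  have L: "((\<lambda>x. L (f x)) has_derivative (\<lambda>v. L (dd v f x))) (at x)" for x
    by (rule bounded_linear.has_derivative[OF assms f])
  show ?case using Suc by (intro Ck_SucI[OF L]) auto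
qed

lemma Ck_add: "Ck k f \<Longrightarrow> Ck k g \<Longrightarrow> Ck k (\<lambda>x. f x + g x)"
proof (induction k arbitrary: f g)
  case 0
  then show ?case by (auto intro: continuous_intros)
next
  case (Suc k)
  then have f: "(f has_derivative (\<lambda>v. dd v f x)) (at x)" 
    and g: "(g has_derivative (\<lambda>v. dd v g x)) (at x)" for x
    by (auto intro: Ck_has_derivative)
  have L: "((\<lambda>x. f x + g x) has_derivative (\<lambda>v. dd v f x + dd v g x)) (at x)" for x
    by (rule has_derivative_add[OF f g])
  show ?case using Suc by (intro Ck_SucI[OF L]) auto
qed

lemma Ck_bounded_bilinear:
  assumes "bounded_bilinear B" shows "Ck k f \<Longrightarrow> Ck k g \<Longrightarrow> Ck k (\<lambda>x. B (f x) (g x))"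
proof (induction k arbitrary: f g)
  case 0
  then show ?case using assms by (auto intro: bounded_bilinear.continuous_on)
next
  case (Suc k)
  then have f: "(f has_derivative (\<lambda>v. dd v f x)) (at x)" 
    and g: "(g has_derivative (\<lambda>v. dd v g x)) (at x)" for x
    by (auto intro: Ck_has_derivative)
  have L: "((\<lambda>x. B (f x) (g x)) has_derivative (\<lambda>v. B (f x) (dd v g x) + B (dd v f x) (g x))) (at x)" for x
    by (rule bounded_bilinear.FDERIV[OF assms f g])
  have "Ck k (\<lambda>x. B (f x) (dd v g x) + B (dd v f x) (g x))" for v
    using Suc.prems by (intro Ck_add Suc.IH Ck_SucD[OF Suc.prems(1)] Ck_SucD[OF Suc.prems(2)]) auto
  then show ?case by (rule Ck_SucI[OF L])
qed

lemma Ck_compose_real: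
  fixes h :: "real \<Rightarrow> real" and g :: "'a::real_normed_vector \<Rightarrow> real"
  shows "Ck k h \<Longrightarrow> Ck k g \<Longrightarrow> Ck k (\<lambda>x. h (g x))"
proof (induction k arbitrary: h)
  case 0
  then show ?case by (auto intro: continuous_on_compose2)
next
  case (Suc k)
  then have f: "(h has_derivative (\<lambda>v. dd v h x)) (at x)" 
    and g: "(g has_derivative (\<lambda>v. dd v g y)) (at y)" for x y
    by (auto intro: Ck_has_derivative)
  have lin: "dd t h x = t * dd 1 h x" for t x
    using linear_scale[OF has_derivative_linear[OF f[of x]], of t 1] by simp
  have L: "((\<lambda>x. h (g x)) has_derivative (\<lambda>v. dd v g x * dd 1 h (g x))) (at x)" for x
    by (rule has_derivative_eq_rhs[OF has_derivative_compose[OF g f]]) (rule ext, rule lin)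
  have "Ck k (\<lambda>x. dd v g x * dd 1 h (g x))" for v
    using Suc.prems by (intro Ck_bounded_bilinear[OF bounded_bilinear_mult] Suc.IH[OF _ Ck_SucD[OF Suc.prems(2)]]) auto
  then show ?case by (rule Ck_SucI[OF L])
qed

lemma smooth_const [intro]: "smooth (\<lambda>x. c)" by (simp add: smooth_def Ck_const)
lemma smooth_add [intro]: "smooth f \<Longrightarrow> smooth g \<Longrightarrow> smooth (\<lambda>x. f x + g x)"
  by (simp add: smooth_def Ck_add)
lemma smooth_linear: "bounded_linear L \<Longrightarrow> smooth f \<Longrightarrow> smooth (\<lambda>x. L (f x))"
  by (simp add: smooth_def Ck_bounded_linear)
lemma smooth_bilinear:
  "bounded_bilinear B \<Longrightarrow> smooth f \<Longrightarrow> smooth g \<Longrightarrow> smooth (\<lambda>x. B (f x) (g x))"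
  by (simp add: smooth_def Ck_bounded_bilinear)
lemma smooth_compose_real:
  fixes h :: "real \<Rightarrow> real"
  shows "smooth h \<Longrightarrow> smooth g \<Longrightarrow> smooth (\<lambda>x. h (g x))"
  by (simp add: smooth_def Ck_compose_real)
lemma smooth_ident: "smooth (\<lambda>x. x)"
proof -
  have *: "dd v (\<lambda>x::'a. x) = (\<lambda>x. v)" for v by (intro ext dd_eq has_derivative_ident)
  have "Ck k (\<lambda>x::'a. x)" for k
    by (cases k) (auto simp: Ck_const *)
  then show ?thesis by (simp add: smooth_def)
qed
lemma smooth_scaleR: "smooth f \<Longrightarrow> smooth g \<Longrightarrow> smooth (\<lambda>x. f x *\<^sub>R g x)"
  by (rule smooth_bilinear[OF bounded_bilinear_scaleR])
lemma smooth_mult: "smooth f \<Longrightarrow> smooth g \<Longrightarrow> smooth (\<lambda>x. f x * g x :: real)"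
  by (rule smooth_bilinear[OF bounded_bilinear_mult])
lemma smooth_minus: "smooth f \<Longrightarrow> smooth (\<lambda>x. - f x)"
  by (rule smooth_linear[OF bounded_linear_minus[OF bounded_linear_ident]])
lemma smooth_diff: "smooth f \<Longrightarrow> smooth g \<Longrightarrow> smooth (\<lambda>x. f x - g x)"
  using smooth_add[OF _ smooth_minus] by fastforce
lemma smooth_sum: "(\<And>i. i \<in> I \<Longrightarrow> smooth (f i)) \<Longrightarrow> smooth (\<lambda>x. \<Sum>i\<in>I. f i x)"
  by (induction I rule: infinite_finite_induct) auto
lemma smooth_fst: "smooth f \<Longrightarrow> smooth (\<lambda>x. fst (f x))"
  by (rule smooth_linear[OF bounded_linear_fst])
lemma smooth_snd: "smooth f \<Longrightarrow> smooth (\<lambda>x. snd (f x))"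
  by (rule smooth_linear[OF bounded_linear_snd])
lemma smooth_nth: "smooth f \<Longrightarrow> smooth (\<lambda>x. f x $ i)"
  by (rule smooth_linear[OF bounded_linear_vec_nth])
lemma smooth_vec:
  fixes f :: "'i::finite \<Rightarrow> 'a::real_normed_vector \<Rightarrow> 'b::euclidean_space"
  assumes "\<And>i. smooth (f i)" shows "smooth (\<lambda>x. \<chi> i. f i x)"
proof -
  have bl: "bounded_linear (\<lambda>a::'b. axis i a)" for i :: 'i
    by (rule linear_conv_bounded_linear[THEN iffD1], rule linearI)
      (auto simp: vec_eq_iff axis_def)
  have "(\<lambda>x. \<chi> i. f i x) = (\<lambda>x. \<Sum>i\<in>UNIV. axis i (f i x))"
    by (auto simp: vec_eq_iff axis_def sum.delta')
  then show ?thesis using assms by (auto intro!: smooth_sum smooth_linear[OF bl])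
qed

lemma dd_add: "smooth f \<Longrightarrow> smooth g \<Longrightarrow> dd v (\<lambda>x. f x + g x) y = dd v f y + dd v g y"
  by (rule dd_eq, rule has_derivative_add) (auto intro: smooth_has_derivative)
lemma dd_diff: "smooth f \<Longrightarrow> smooth g \<Longrightarrow> dd v (\<lambda>x. f x - g x) y = dd v f y - dd v g y"
  by (rule dd_eq, rule has_derivative_diff) (auto intro: smooth_has_derivative)
lemma dd_const: "dd v (\<lambda>x. c) y = 0"
  by (rule dd_eq) (rule has_derivative_const)
lemma dd_linear_compose: "bounded_linear L \<Longrightarrow> smooth f \<Longrightarrow> dd v (\<lambda>x. L (f x)) y = L (dd v f y)"
  by (rule dd_eq, rule bounded_linear.has_derivative) (auto intro: smooth_has_derivative)
lemma dd_nth: "smooth f \<Longrightarrow> dd v (\<lambda>x. f x $ i) y = dd v f y $ i"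
  by (rule dd_linear_compose[OF bounded_linear_vec_nth])
lemma dd_scaleR_const: "smooth f \<Longrightarrow> dd v (\<lambda>x. f x *\<^sub>R c) y = dd v f y *\<^sub>R c"
  by (rule dd_linear_compose[of "\<lambda>a. a *\<^sub>R c"]) (auto intro: bounded_linear_scaleR_left)
lemma dd_sum: "(\<And>i. i \<in> I \<Longrightarrow> smooth (f i)) \<Longrightarrow> dd v (\<lambda>x. \<Sum>i\<in>I. f i x) y = (\<Sum>i\<in>I. dd v (f i) y)"
  by (rule dd_eq, rule has_derivative_sum) (auto intro: smooth_has_derivative)

lemma fun_supp_subset_iff: "closed K \<Longrightarrow> fun_supp f \<subseteq> K \<longleftrightarrow> (\<forall>y. y \<notin> K \<longrightarrow> f y = 0)"
  unfolding fun_supp_def using closure_minimal[of "{y. f y \<noteq> 0}" K] closure_subset[of "{y. f y \<noteq> 0}"]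
  by blast

lemma closed_fun_supp [simp]: "closed (fun_supp f)" by (simp add: fun_supp_def)

lemma not_fun_supp: "y \<notin> fun_supp f \<Longrightarrow> f y = 0"
  using fun_supp_subset_iff[OF closed_fun_supp, of f] by blast

lemma fun_supp_dd: "fun_supp (dd v f) \<subseteq> fun_supp f"
proof (subst fun_supp_subset_iff; intro closed_fun_supp allI impI)
  fix y assume y: "y \<notin> fun_supp f"
  have "((\<lambda>x. 0) has_derivative (\<lambda>v. 0)) (at y)" by (rule has_derivative_const)
  then have "(f has_derivative (\<lambda>v. 0)) (at y)"
    by (rule has_derivative_transform_within_open[of _ _ _ _ "- fun_supp f"])
       (use y not_fun_supp in auto)
  then show "dd v f y = 0" by (rule dd_eq)
qed

lemma Cc_inftyI: "smooth f \<Longrightarrow> compact K \<Longrightarrow> (\<And>y. y \<notin> K \<Longrightarrow> f y = 0) \<Longrightarrow> f \<in> Cc_infty"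
  unfolding Cc_infty_def using fun_supp_subset_iff[of K f] compact_imp_closed
  by (metis (mono_tags, lifting) CollectI closed_fun_supp compact_Int_closed inf.absorb_iff2)

lemma Cc_infty_dd: "f \<in> Cc_infty \<Longrightarrow> dd v f \<in> Cc_infty"
  by (rule Cc_inftyI[of _ "fun_supp f"])
    (auto simp: Cc_infty_def intro: smooth_dd not_fun_supp subsetD[OF fun_supp_dd])

lemma Cc_infty_linear:
  assumes L: "bounded_linear L" and f: "f \<in> Cc_infty" shows "(\<lambda>y. L (f y)) \<in> Cc_infty"
proof (rule Cc_inftyI[of _ "fun_supp f"])
  show "smooth (\<lambda>y. L (f y))" "compact (fun_supp f)" using f by (auto simp: Cc_infty_def intro: smooth_linear[OF L])
  show "L (f y) = 0" if "y \<notin> fun_supp f" for y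
    using not_fun_supp[OF that] linear_0[OF bounded_linear.linear[OF L]] by simp
qed

lemma Cc_infty_fst: "f \<in> Cc_infty \<Longrightarrow> (\<lambda>y. fst (f y)) \<in> Cc_infty"
  by (rule Cc_infty_linear[OF bounded_linear_fst])
lemma Cc_infty_snd: "f \<in> Cc_infty \<Longrightarrow> (\<lambda>y. snd (f y)) \<in> Cc_infty"
  by (rule Cc_infty_linear[OF bounded_linear_snd])

lemma compact_support_bounded:
  fixes f :: "'a::real_normed_vector \<Rightarrow> 'b::real_normed_vector"
  assumes "f \<in> Cc_infty" obtains C where "C > 0" "\<And>y. norm (f y) \<le> C"
proof -
  have "compact (f ` fun_supp f)"
    using assms by (auto simp: Cc_infty_def intro!: compact_continuous_image smooth_continuous)
  then obtain C where C: "C > 0" "\<forall>x\<in>f ` fun_supp f. norm x \<le> C"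
    using compact_imp_bounded bounded_pos by blast
  have "norm (f y) \<le> C" for y
    using C not_fun_supp[of y f] by (cases "y \<in> fun_supp f") auto
  with C that show ?thesis by blast
qed

lemma dd_along_line:
  assumes "smooth f"
  shows "((\<lambda>s. f (x + s *\<^sub>R a)) has_derivative (\<lambda>h. h *\<^sub>R dd a f (x + s *\<^sub>R a))) (at s)"
proof -
  have "((\<lambda>s. x + s *\<^sub>R a) has_derivative (\<lambda>h. h *\<^sub>R a)) (at s)"
    by (auto intro!: derivative_eq_intros)
  then have "((\<lambda>s. f (x + s *\<^sub>R a)) has_derivative (\<lambda>h. dd (h *\<^sub>R a) f (x + s *\<^sub>R a))) (at s)"
    by (rule has_derivative_compose) (rule smooth_has_derivative[OF assms])
  then show ?thesis by (simp add: linear_scale[OF dd_linear[OF assms]])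
qed

section \<open>Symmetry of second derivatives\<close>

text \<open>The mean value theorem, first in direction \<open>a\<close> and then in direction \<open>b\<close>. The left-hand side is symmetric
in \<open>a\<close> and \<open>b\<close>, so that exchanging them compares the two mixed derivatives at nearby points.\<close>

lemma second_difference_mvt:
  fixes f :: "'a::real_normed_vector \<Rightarrow> real"
  assumes f: "smooth f" and h: "h > 0"
  obtains s t where "0 < s" "s < h" "0 < t" "t < h"
    "f (x + h *\<^sub>R a + h *\<^sub>R b) - f (x + h *\<^sub>R a) - f (x + h *\<^sub>R b) + f x
      = h * h * dd b (dd a f) (x + s *\<^sub>R a + t *\<^sub>R b)"
proof -
  define g where "g s = f (x + h *\<^sub>R b + s *\<^sub>R a) - f (x + s *\<^sub>R a)" for s
  have "(g has_real_derivative (dd a f (x + h *\<^sub>R b + s *\<^sub>R a) - dd a f (x + s *\<^sub>R a))) (at s)" for s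
    unfolding g_def has_field_derivative_def
    by (rule has_derivative_eq_rhs[OF has_derivative_diff[OF dd_along_line[OF f] dd_along_line[OF f]]])
       (auto simp: algebra_simps)
  from MVT2[OF h this] obtain s where s: "0 < s" "s < h"
    "g h - g 0 = h * (dd a f (x + h *\<^sub>R b + s *\<^sub>R a) - dd a f (x + s *\<^sub>R a))" by auto
  define k where "k t = dd a f (x + s *\<^sub>R a + t *\<^sub>R b)" for t
  have "(k has_real_derivative (dd b (dd a f) (x + s *\<^sub>R a + t *\<^sub>R b))) (at t)" for t
    unfolding k_def has_field_derivative_def
    by (rule has_derivative_eq_rhs[OF dd_along_line[OF smooth_dd[OF f]]]) (auto simp: algebra_simps)
  from MVT2[OF h this] obtain t where t: "0 < t" "t < h"
    "k h - k 0 = h * dd b (dd a f) (x + s *\<^sub>R a + t *\<^sub>R b)" by auto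
  have "g h - g 0 = h * (k h - k 0)"
    using s(3) by (simp add: k_def add_ac)
  moreover have "g h - g 0 = f (x + h *\<^sub>R a + h *\<^sub>R b) - f (x + h *\<^sub>R a) - f (x + h *\<^sub>R b) + f x"
    by (simp add: g_def add_ac)
  ultimately show ?thesis using s t that[of s t] by (simp add: mult.assoc)
qed

lemma dd_commute_real:
  fixes f :: "'a::real_normed_vector \<Rightarrow> real"
  assumes f: "smooth f" shows "dd a (dd b f) x = dd b (dd a f) x"
proof -
  define h where "h n = 1 / real (Suc n)" for n
  have h: "h n > 0" for n by (simp add: h_def)
  have h0: "h \<longlonglongrightarrow> 0" unfolding h_def by (rule LIMSEQ_Suc, rule lim_1_over_n)
  have lim: "(\<lambda>n. F (x + s n *\<^sub>R c + t n *\<^sub>R d)) \<longlonglongrightarrow> F x" 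
    if "\<And>n. 0 < s n \<and> s n < h n \<and> 0 < t n \<and> t n < h n" "continuous_on UNIV F" 
    for s t :: "nat \<Rightarrow> real" and c d and F :: "'a \<Rightarrow> real"
  proof -
    have "s \<longlonglongrightarrow> 0" "t \<longlonglongrightarrow> 0"
      by (rule tendsto_sandwich[OF _ _ tendsto_const h0]; use that(1) in \<open>force intro!: always_eventually less_imp_le\<close>)+
    then have "(\<lambda>n. x + s n *\<^sub>R c + t n *\<^sub>R d) \<longlonglongrightarrow> x + 0 *\<^sub>R c + 0 *\<^sub>R d"
      by (intro tendsto_intros)
    moreover have "isCont F x" using that(2) by (simp add: continuous_on_eq_continuous_at)
    ultimately show ?thesis using isCont_tendsto_compose by fastforce
  qed
  have "\<exists>s t. \<forall>n. (0 < s n \<and> s n < h n \<and> 0 < t n \<and> t n < h n) \<and>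
    f (x + h n *\<^sub>R a + h n *\<^sub>R b) - f (x + h n *\<^sub>R a) - f (x + h n *\<^sub>R b) + f x
      = h n * h n * dd b (dd a f) (x + s n *\<^sub>R a + t n *\<^sub>R b)" for a b
    by (subst choice_iff[symmetric], subst choice_iff[symmetric])
      (metis second_difference_mvt[OF f h])
  then obtain s t s' t' where
    1: "\<And>n. 0 < s n \<and> s n < h n \<and> 0 < t n \<and> t n < h n" 
    "\<And>n. f (x + h n *\<^sub>R a + h n *\<^sub>R b) - f (x + h n *\<^sub>R a) - f (x + h n *\<^sub>R b) + f x
      = h n * h n * dd b (dd a f) (x + s n *\<^sub>R a + t n *\<^sub>R b)"
    and 2: "\<And>n. 0 < s' n \<and> s' n < h n \<and> 0 < t' n \<and> t' n < h n" 
    "\<And>n. f (x + h n *\<^sub>R b + h n *\<^sub>R a) - f (x + h n *\<^sub>R b) - f (x + h n *\<^sub>R a) + f x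
      = h n * h n * dd a (dd b f) (x + s' n *\<^sub>R b + t' n *\<^sub>R a)"
    by metis
  have "h n * h n * dd b (dd a f) (x + s n *\<^sub>R a + t n *\<^sub>R b) = h n * h n * dd a (dd b f) (x + s' n *\<^sub>R b + t' n *\<^sub>R a)" for n
    using 1(2)[of n] 2(2)[of n] add.commute[of "h n *\<^sub>R a" "h n *\<^sub>R b"]
    by (simp only: add.assoc)
  then have "dd b (dd a f) (x + s n *\<^sub>R a + t n *\<^sub>R b) = dd a (dd b f) (x + s' n *\<^sub>R b + t' n *\<^sub>R a)" for n
    using h[of n] by (metis mult_eq_0_iff mult_left_cancel less_irrefl)
  moreover have "(\<lambda>n. dd b (dd a f) (x + s n *\<^sub>R a + t n *\<^sub>R b)) \<longlonglongrightarrow> dd b (dd a f) x"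
    using 1(1) by (intro lim smooth_continuous smooth_dd f) 
  moreover have "(\<lambda>n. dd a (dd b f) (x + s' n *\<^sub>R b + t' n *\<^sub>R a)) \<longlonglongrightarrow> dd a (dd b f) x"
    using 2(1) by (intro lim smooth_continuous smooth_dd f) 
  ultimately show ?thesis using LIMSEQ_unique by fastforce
qed

section \<open>A smooth bump function\<close>

text \<open>The functions \<open>p(1/t) e\<^sup>-\<^sup>1\<^sup>/\<^sup>t\<close>, extended by \<open>0\<close> to \<open>t \<le> 0\<close>, form a family closed under
differentiation. This makes all of them smooth; the case \<open>p = 1\<close> is the classical flat function.\<close>

definition flat_exp :: "real poly \<Rightarrow> real \<Rightarrow> real" where
  "flat_exp p t = (if t > 0 then poly p (1 / t) * exp (- 1 / t) else 0)"

lemma poly_div_exp_tendsto_0: "((\<lambda>x. poly p x * exp (- x)) \<longlongrightarrow> 0) (at_top :: real filter)"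
proof -
  have "((\<lambda>x. coeff p i * (x ^ i / exp x)) \<longlongrightarrow> coeff p i * 0) at_top" for i
    by (intro tendsto_intros tendsto_power_div_exp_0)
  then have "((\<lambda>x. \<Sum>i\<le>degree p. coeff p i * (x ^ i / exp x)) \<longlongrightarrow> (\<Sum>i\<le>degree p. 0)) at_top"
    by (intro tendsto_sum) auto
  then show ?thesis
    by (simp add: poly_altdef sum_distrib_right exp_minus divide_inverse mult.assoc)
qed

lemma flat_exp_has_derivative:
  "(flat_exp p has_real_derivative flat_exp (monom 1 2 * (p - pderiv p)) t) (at t)"
proof -
  consider "t > 0" | "t < 0" | "t = 0" by linarith
  then show ?thesis
  proof cases
    case 1
    have "((\<lambda>t. poly p (1 / t) * exp (- 1 / t)) has_real_derivative 
       flat_exp (monom 1 2 * (p - pderiv p)) t) (at t)"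
      using 1 by (auto intro!: derivative_eq_intros DERIV_chain2[OF poly_DERIV]
          simp: flat_exp_def poly_monom field_simps power2_eq_square)
    then show ?thesis
      by (rule has_field_derivative_transform_within_open[of _ _ _ "{0<..}"])
        (use 1 in \<open>auto simp: flat_exp_def\<close>)
  next
    case 2
    have "((\<lambda>t. 0) has_real_derivative flat_exp (monom 1 2 * (p - pderiv p)) t) (at t)"
      using 2 by (simp add: flat_exp_def)
    then show ?thesis
      by (rule has_field_derivative_transform_within_open[of _ _ _ "{..<0}"])
        (use 2 in \<open>auto simp: flat_exp_def\<close>)
  next
    case 3
    have r: "((\<lambda>h. flat_exp p h / h) \<longlongrightarrow> 0) (at_right 0)"
    proof (subst filterlim_at_right_to_top)
      have "((\<lambda>x. poly (monom 1 1 * p) x * exp (- x)) \<longlongrightarrow> 0) (at_top :: real filter)"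
        by (rule poly_div_exp_tendsto_0)
      then show "((\<lambda>x. flat_exp p (inverse x) / inverse x) \<longlongrightarrow> 0) at_top"
        by (rule Lim_transform_eventually)
          (auto simp: flat_exp_def poly_monom field_simps intro!: eventually_mono[OF eventually_gt_at_top[of 0]])
    qed
    have l: "((\<lambda>h. flat_exp p h / h) \<longlongrightarrow> 0) (at_left 0)"
      by (rule Lim_transform_eventually[OF tendsto_const])
        (auto simp: flat_exp_def eventually_at_left_field intro!: exI[of _ "-1"])
    have "((\<lambda>h. flat_exp p h / h) \<longlongrightarrow> 0) (at 0)"
      using l r filterlim_split_at by blast
    then show ?thesis using 3 by (simp add: DERIV_def flat_exp_def)
  qed
qed

lemma smooth_flat_exp: "smooth (flat_exp p)"
proof -
  have "Ck k (flat_exp p)" for k p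
  proof (induction k arbitrary: p)
    case 0
    show ?case unfolding Ck.simps
      by (rule continuous_at_imp_continuous_on) (blast intro: DERIV_isCont flat_exp_has_derivative)
  next
    case (Suc k)
    have d: "(flat_exp p has_derivative (\<lambda>v. flat_exp (monom 1 2 * (p - pderiv p)) t * v)) (at t)" for t p
      using flat_exp_has_derivative[of p t] by (simp add: has_field_derivative_def)
    have "Ck k (\<lambda>t. flat_exp (monom 1 2 * (p - pderiv p)) t * v)" for v
      by (intro Ck_bounded_linear[OF bounded_linear_mult_left] Suc)
    then show ?case by (rule Ck_SucI[OF d])
  qed
  then show ?thesis by (simp add: smooth_def)
qed

definition bump :: "'a::euclidean_space \<Rightarrow> real \<Rightarrow> 'a \<Rightarrow> real" where
  "bump c r y = flat_exp 1 (1 - (y - c) \<bullet> (y - c) / r\<^sup>2)"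

lemma smooth_bump: "smooth (bump c r)"
proof -
  have "smooth (\<lambda>y. 1 + (y - c) \<bullet> (y - c) * (- 1 / r\<^sup>2))"
    by (intro smooth_add smooth_mult smooth_const smooth_bilinear[OF bounded_bilinear_inner]
       smooth_diff smooth_ident)
  from smooth_compose_real[OF smooth_flat_exp this, of 1]
  show ?thesis by (simp add: bump_def[abs_def])
qed

lemma bump_nonneg: "0 \<le> bump c r y" and bump_le_1: "bump c r y \<le> 1"
  by (auto simp: bump_def flat_exp_def)

lemma bump_outside: assumes "r > 0" "y \<notin> cball c r" shows "bump c r y = 0"
proof -
  have "r\<^sup>2 \<le> (norm (y - c))\<^sup>2"
    using assms by (intro power_mono) (auto simp: dist_norm norm_minus_commute)
  then show ?thesis using assms
    by (simp add: bump_def flat_exp_def field_simps power2_norm_eq_inner)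
qed

lemma bump_lower: assumes "r > 0" "y \<in> cball c (r / 2)" shows "exp (- 4 / 3) \<le> bump c r y"
proof -
  have "(norm (y - c))\<^sup>2 \<le> (r / 2)\<^sup>2"
    using assms by (intro power_mono) (auto simp: dist_norm norm_minus_commute)
  then have *: "3 / 4 \<le> 1 - (y - c) \<bullet> (y - c) / r\<^sup>2"
    using assms by (simp add: field_simps power2_norm_eq_inner power_divide)
  then have "- 4 / 3 \<le> - 1 / (1 - (y - c) \<bullet> (y - c) / r\<^sup>2)"
    using frac_le[of 1 1 "3/4" "1 - (y - c) \<bullet> (y - c) / r\<^sup>2"] by simp
  then have "exp (- 4 / 3) \<le> exp (- 1 / (1 - (y - c) \<bullet> (y - c) / r\<^sup>2))" by simp
  moreover have "0 < 1 - (y - c) \<bullet> (y - c) / r\<^sup>2" using * by linarith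
  ultimately show ?thesis by (simp only: bump_def flat_exp_def) simp
qed

lemma smooth_cos: "smooth (cos :: real \<Rightarrow> real)"
proof -
  have "Ck k (\<lambda>t. a * cos t + b * sin t)" for k and a b :: real
  proof (induction k arbitrary: a b)
    case 0 show ?case by (auto intro!: continuous_intros)
  next
    case (Suc k)
    have d: "((\<lambda>t. a * cos t + b * sin t) has_derivative (\<lambda>v. v * b * cos t + (- v * a) * sin t)) (at t)" for t
      by (auto intro!: derivative_eq_intros simp: algebra_simps)
    have "Ck k (\<lambda>t. v * b * cos t + (- v * a) * sin t)" for v by (rule Suc)
    then show ?case by (rule Ck_SucI[OF d])
  qed
  from this[of _ 1 0] show ?thesis by (simp add: smooth_def)
qed

section \<open>Integrals over Euclidean space\<close>

lemma integrable_indicator_cball: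
  "integrable lebesgue (\<lambda>y. c * indicator (cball (a::'a::euclidean_space) R) y :: real)"
  using lmeasurable_cball[of a R] by (intro integrable_mult_right)
    (auto simp: fmeasurable_def integrable_indicator_iff)

lemma integrable_bounded_support:
  fixes f :: "'a::euclidean_space \<Rightarrow> 'b::euclidean_space"
  assumes "f \<in> borel_measurable lebesgue" "bounded \<Omega>"
    "AE y in lebesgue. norm (f y) \<le> C" "AE y in lebesgue. y \<notin> \<Omega> \<longrightarrow> f y = 0"
  shows "integrable lebesgue f"
proof -
  obtain R where R: "\<Omega> \<subseteq> cball 0 R"
    using bounded_subset_ballD[OF assms(2), of 0] ball_subset_cball by blast
  have "integrable lebesgue (\<lambda>y. \<bar>C\<bar> * indicator (cball (0::'a) R) y)"
    by (rule integrable_indicator_cball)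
  then show ?thesis
  proof (rule Bochner_Integration.integrable_bound)
    show "AE y in lebesgue. norm (f y) \<le> norm (\<bar>C\<bar> * indicator (cball 0 R) y)"
      using assms(3,4) by eventually_elim (use R in \<open>auto simp: indicator_def\<close>)
  qed (use assms in auto)
qed

text \<open>All functions that occur later are uniformly bounded and vanish outside one bounded set, so that a
multiple of the indicator of a ball dominates them.\<close>

lemma dominated_convergence_bounded_support:
  fixes f :: "nat \<Rightarrow> 'a::euclidean_space \<Rightarrow> 'b::euclidean_space"
  assumes "\<And>k. f k \<in> borel_measurable lebesgue" "g \<in> borel_measurable lebesgue" "bounded \<Omega>"
    "\<And>k. AE y in lebesgue. norm (f k y) \<le> C" "\<And>k. AE y in lebesgue. y \<notin> \<Omega> \<longrightarrow> f k y = 0"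
    "AE y in lebesgue. (\<lambda>k. f k y) \<longlonglongrightarrow> g y"
  shows "(\<lambda>k. LINT y|lebesgue. f k y) \<longlonglongrightarrow> (LINT y|lebesgue. g y)"
proof -
  obtain R where R: "\<Omega> \<subseteq> cball 0 R"
    using bounded_subset_ballD[OF assms(3), of 0] ball_subset_cball by blast
  show ?thesis
  proof (rule integral_dominated_convergence)
    show "integrable lebesgue (\<lambda>y. \<bar>C\<bar> * indicator (cball (0::'a) R) y)"
      by (rule integrable_indicator_cball)
    show "AE y in lebesgue. norm (f k y) \<le> \<bar>C\<bar> * indicator (cball 0 R) y" for k
      using assms(4,5)[of k] by eventually_elim (use R in \<open>auto simp: indicator_def\<close>)
  qed (use assms in auto)
qed

lemma integrable_affine:
  fixes f :: "'a::euclidean_space \<Rightarrow> 'b::euclidean_space"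
  assumes c: "c \<noteq> 0" and f: "integrable lebesgue f"
  shows "integrable lebesgue (\<lambda>x. f (t + c *\<^sub>R x))" (is ?i)
    and "(LINT x|lebesgue. f (t + c *\<^sub>R x)) = (LINT x|lebesgue. f x) /\<^sub>R \<bar>c\<bar> ^ DIM('a)" (is ?e)
proof -
  let ?T = "\<lambda>x::'a. t + c *\<^sub>R x"
  have T: "(\<lambda>x. t + (\<Sum>j\<in>Basis. (c * (x \<bullet> j)) *\<^sub>R j)) = ?T"
    by (simp add: scaleR_scaleR[symmetric] scaleR_sum_right[symmetric] euclidean_representation del: scaleR_scaleR)
  have m: "?T \<in> lebesgue \<rightarrow>\<^sub>M lebesgue"
    using lebesgue_affine_measurable[of "\<lambda>_. c" t] c unfolding T by simp
  have L: "lebesgue = density (distr lebesgue lebesgue ?T) (\<lambda>_. ennreal (\<bar>c\<bar> ^ DIM('a)))"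
    using lebesgue_affine_euclidean[of "\<lambda>_. c" t] c unfolding T by simp
  have fm: "f \<in> borel_measurable (distr lebesgue lebesgue ?T)"
    using f by (simp add: borel_measurable_integrable)
  have cp: "\<bar>c\<bar> ^ DIM('a) > 0" using c by simp
  have "integrable (distr lebesgue lebesgue ?T) (\<lambda>x. (\<bar>c\<bar> ^ DIM('a)) *\<^sub>R f x)"
    using f fm by (subst (asm) L, subst (asm) integrable_density) auto
  from integrable_scaleR_right[OF this, of "inverse (\<bar>c\<bar> ^ DIM('a))"]
  have i: "integrable (distr lebesgue lebesgue ?T) f"
    using c by simp
  then show ?i
    using m f by (subst (asm) integrable_distr_eq) (auto simp: borel_measurable_integrable)
  have "(LINT x|lebesgue. f x) = (LINT x|distr lebesgue lebesgue ?T. (\<bar>c\<bar> ^ DIM('a)) *\<^sub>R f x)"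
    using fm by (subst L, subst integral_density) auto
  also have "\<dots> = (\<bar>c\<bar> ^ DIM('a)) *\<^sub>R (LINT x|lebesgue. f (?T x))"
    using m f by (subst integral_distr) (auto simp: borel_measurable_integrable)
  finally show ?e using cp by simp
qed

lemma integrable_shift:
  fixes f :: "'a::euclidean_space \<Rightarrow> 'b::euclidean_space"
  assumes f: "integrable lebesgue f"
  shows "integrable lebesgue (\<lambda>x. f (x + h))"
    and "(LINT x|lebesgue. f (x + h)) = (LINT x|lebesgue. f x)"
  using integrable_affine[of 1 f h] f by (simp_all add: add.commute)

text \<open>A measurable function is an almost everywhere limit of continuous functions. Cutting off both \<open>f\<close> and
these continuous functions, in domain and in range, makes the convergence dominated.\<close>

lemma L1_approx_continuous:
  fixes f :: "'a::euclidean_space \<Rightarrow> 'b::euclidean_space"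
  assumes f: "integrable lebesgue f" and e: "e > 0"
  obtains g R where "continuous_on UNIV g" "\<And>x. x \<notin> cball 0 R \<Longrightarrow> g x = 0"
    "integrable lebesgue g" "(LINT x|lebesgue. norm (f x - g x)) < e"
proof -
  have [measurable]: "f \<in> borel_measurable lebesgue" using f by (simp add: borel_measurable_integrable)
  define F where "F n x = (if norm x \<le> real n \<and> norm (f x) \<le> real n then f x else 0)" for n x
  have Fm[measurable]: "F n \<in> borel_measurable lebesgue" for n
  proof -
    have [measurable]: "(\<lambda>x::'a. norm x) \<in> borel_measurable lebesgue"
      by (rule measurable_completion) simp
    have [measurable]: "(\<lambda>x. norm (f x)) \<in> borel_measurable lebesgue" by simp
    show ?thesis unfolding F_def by measurable
  qed
  have "(\<lambda>n. LINT x|lebesgue. norm (f x - F n x)) \<longlonglongrightarrow> (LINT x|(lebesgue :: 'a measure). 0)"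
  proof (rule integral_dominated_convergence)
    show "integrable lebesgue (\<lambda>x. norm (f x))" using f by simp
    show "AE x in lebesgue. (\<lambda>n. norm (f x - F n x)) \<longlonglongrightarrow> 0"
    proof (rule AE_I2)
      fix x
      have "eventually (\<lambda>n. norm (f x - F n x) = 0) sequentially"
        using eventually_ge_at_top[of "nat \<lceil>max (norm x) (norm (f x))\<rceil>"]
        by eventually_elim (auto simp: F_def nat_ceiling_le_eq)
      then show "(\<lambda>n. norm (f x - F n x)) \<longlonglongrightarrow> 0"
        by (rule tendsto_eventually)
    qed
    show "AE x in lebesgue. norm (norm (f x - F n x)) \<le> norm (f x)" for n
      by (auto simp: F_def)
  qed auto
  then have "eventually (\<lambda>n. (LINT x|lebesgue. norm (f x - F n x)) < e / 2) sequentially"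
    using e by (intro order_tendstoD(2)[where y = 0]) simp_all
  then obtain n where n: "(LINT x|lebesgue. norm (f x - F n x)) < e / 2"
    unfolding eventually_sequentially by auto
  define R where "R = real n + 1"
  have "F n measurable_on UNIV"
    by (intro lebesgue_measurable_imp_measurable_on) auto
  then obtain N g where N: "negligible N" "\<And>k. continuous_on UNIV (g k)"
    "\<And>x. x \<notin> N \<Longrightarrow> (\<lambda>k. g k x) \<longlonglongrightarrow> F n x"
    unfolding measurable_on_def by auto
  \<comment> \<open>a cutoff in the domain times the radial retraction of the values onto the ball of radius \<open>R\<close>;
    both are the identity where \<open>F n\<close> does not vanish\<close>
  define G where "G k x = (max 0 (min 1 (R - norm x)) * R / max R (norm (g k x))) *\<^sub>R g k x" for k x
  have Rp: "R \<ge> 1" by (simp add: R_def)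
  have Gc: "continuous_on UNIV (G k)" for k
    unfolding G_def using Rp by (intro continuous_intros N(2)) auto
  have Gm[measurable]: "G k \<in> borel_measurable lebesgue" for k
    by (rule measurable_completion) (simp add: borel_measurable_continuous_onI Gc)
  have G0: "G k x = 0" if "x \<notin> cball 0 R" for k x
    using that by (simp add: G_def)
  have Gb: "norm (G k x) \<le> R" for k x
  proof -
    have "norm (G k x) = max 0 (min 1 (R - norm x)) * (R * (norm (g k x) / max R (norm (g k x))))"
      using Rp by (simp add: G_def)
    also have "\<dots> \<le> 1 * (R * 1)"
      using Rp by (intro mult_mono) (auto simp: divide_le_eq_1)
    finally show ?thesis by simp
  qed
  have Gi: "integrable lebesgue (G k)" for k
    by (rule integrable_bounded_support[of _ "cball 0 R" R]) (use Gb G0 in auto)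
  have Fi: "integrable lebesgue (F n)"
    by (rule Bochner_Integration.integrable_bound[OF f Fm]) (auto simp: F_def)
  have "(\<lambda>k. LINT x|lebesgue. norm (F n x - G k x)) \<longlonglongrightarrow> (LINT x|(lebesgue :: 'a measure). 0)"
  proof (rule dominated_convergence_bounded_support[of _ _ "cball 0 R" "2 * R"])
    have Fb: "norm (F n x) \<le> R" for x by (simp add: F_def R_def)
    show "AE y in lebesgue. norm (norm (F n y - G k y)) \<le> 2 * R" for k
    proof (rule AE_I2)
      show "norm (norm (F n y - G k y)) \<le> 2 * R" for y
        using norm_triangle_ineq4[of "F n y" "G k y"] Fb[of y] Gb[of k y] by simp
    qed
    show "AE y in lebesgue. y \<notin> cball 0 R \<longrightarrow> norm (F n y - G k y) = 0" for k
      by (rule AE_I2) (use G0 in \<open>simp add: F_def R_def\<close>)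
    have "AE x in lebesgue. x \<notin> N"
      using N(1) by (simp add: negligible_iff_null_sets AE_not_in)
    then show "AE y in lebesgue. (\<lambda>k. norm (F n y - G k y)) \<longlonglongrightarrow> 0"
    proof eventually_elim
      case (elim x)
      have "(\<lambda>k. G k x) \<longlonglongrightarrow> (max 0 (min 1 (R - norm x)) * R / max R (norm (F n x))) *\<^sub>R F n x"
        unfolding G_def using Rp by (intro tendsto_intros N(3)[OF elim]) auto
      also have "(max 0 (min 1 (R - norm x)) * R / max R (norm (F n x))) *\<^sub>R F n x = F n x"
        by (auto simp: F_def R_def max_def min_def)
      finally have "(\<lambda>k. norm (F n x - G k x)) \<longlonglongrightarrow> norm (F n x - F n x)"
        by (intro tendsto_intros)
      then show ?case by simp
    qed
  qed auto
  then have "eventually (\<lambda>k. (LINT x|lebesgue. norm (F n x - G k x)) < e / 2) sequentially"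
    using e by (intro order_tendstoD(2)[where y = 0]) simp_all
  then obtain k where k: "(LINT x|lebesgue. norm (F n x - G k x)) < e / 2"
    unfolding eventually_sequentially by auto
  have "(LINT x|lebesgue. norm (f x - G k x)) \<le> (LINT x|lebesgue. norm (f x - F n x) + norm (F n x - G k x))"
  proof (rule integral_mono)
    show "norm (f x - G k x) \<le> norm (f x - F n x) + norm (F n x - G k x)" for x
      using norm_triangle_ineq[of "f x - F n x" "F n x - G k x"] by simp
  qed (use f Fi Gi in auto)
  also have "\<dots> = (LINT x|lebesgue. norm (f x - F n x)) + (LINT x|lebesgue. norm (F n x - G k x))"
    using f Fi Gi by (intro Bochner_Integration.integral_add) auto
  also have "\<dots> < e" using n k by simp
  finally show ?thesis using that[OF Gc G0 Gi] by blast
qed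

text \<open>Uniform continuity gives the claim for continuous functions of compact support, and translations are
isometries of \<open>L\<^sup>1\<close>, so it passes to the limit.\<close>

lemma L1_shift_continuous:
  fixes f :: "'a::euclidean_space \<Rightarrow> 'b::euclidean_space"
  assumes f: "integrable lebesgue f" and e: "e > 0"
  obtains d where "d > 0" "\<And>h. norm h < d \<Longrightarrow> (LINT x|lebesgue. norm (f (x + h) - f x)) < e"
proof -
  obtain g R where g: "continuous_on UNIV g" "\<And>x. x \<notin> cball 0 R \<Longrightarrow> g x = 0"
    "integrable lebesgue g" "(LINT x|lebesgue. norm (f x - g x)) < e / 3"
    using L1_approx_continuous[OF f, of "e / 3"] e by auto
  define m where "m = measure lebesgue (cball (0::'a) (R + 1))"
  have m: "m \<ge> 0" by (simp add: m_def)
  have "uniformly_continuous_on (cball 0 (R + 2)) g"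
    by (intro compact_uniformly_continuous continuous_on_subset[OF g(1)]) auto
  moreover have "e / 3 / (m + 1) > 0" using e m by (simp add: field_simps)
  ultimately obtain d where d: "d > 0" "\<And>x x'. \<lbrakk>x \<in> cball 0 (R + 2); x' \<in> cball 0 (R + 2); dist x' x < d\<rbrakk>
      \<Longrightarrow> dist (g x') (g x) < e / 3 / (m + 1)"
    unfolding uniformly_continuous_on_def by metis
  show ?thesis
  proof (rule that[of "min d 1"])
    fix h :: 'a assume h: "norm h < min d 1"
    have gb: "norm (g (x + h) - g x) \<le> e / 3 / (m + 1) * indicator (cball 0 (R + 1)) x" for x
    proof (cases "x \<in> cball 0 (R + 1)")
      case True
      have "norm (x + h) \<le> R + 2" using True h norm_triangle_ineq[of x h] by auto
      then show ?thesis using d(2)[of x "x + h"] True h by (simp add: mem_cball_0 dist_norm[of "x + h" x] dist_norm[of "g (x + h)"] del: mem_cball)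
    next
      case False
      moreover have "norm (x + h) \<ge> norm x - norm h" using norm_triangle_ineq4[of "x + h" h] by simp
      ultimately show ?thesis using h g(2)[of x] g(2)[of "x + h"] by auto
    qed
    have gi: "integrable lebesgue (\<lambda>x. g (x + h))" and fi: "integrable lebesgue (\<lambda>x. f (x + h))"
      using integrable_shift f g(3) by auto
    have ind: "integrable lebesgue (\<lambda>x. e / 3 / (m + 1) * indicator (cball (0::'a) (R + 1)) x)"
      by (rule integrable_indicator_cball)
    have "(LINT x|lebesgue. norm (g (x + h) - g x)) \<le> (LINT x|lebesgue. e / 3 / (m + 1) * indicator (cball (0::'a) (R + 1)) x)"
      using gi g(3) ind gb by (intro integral_mono) auto
    also have "\<dots> = e / 3 / (m + 1) * m" by (simp add: m_def)
    also have "\<dots> < e / 3" using e m by (simp add: field_simps)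
    finally have 1: "(LINT x|lebesgue. norm (g (x + h) - g x)) < e / 3" .
    have 2: "(LINT x|lebesgue. norm (f (x + h) - g (x + h))) = (LINT x|lebesgue. norm (f x - g x))"
      using integrable_shift(2)[of "\<lambda>x. norm (f x - g x)" h] f g(3) by simp
    have tri: "norm (f (x + h) - f x) \<le> norm (f (x + h) - g (x + h)) + norm (g (x + h) - g x) + norm (f x - g x)" for x
      using norm_triangle_ineq4[of "(f (x + h) - g (x + h)) + (g (x + h) - g x)" "f x - g x"]
        norm_triangle_ineq[of "f (x + h) - g (x + h)" "g (x + h) - g x"] by simp
    have "(LINT x|lebesgue. norm (f (x + h) - f x)) \<le> 
      (LINT x|lebesgue. norm (f (x + h) - g (x + h)) + norm (g (x + h) - g x) + norm (f x - g x))"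
      using f fi gi g(3) tri by (intro integral_mono) auto
    also have "\<dots> = (LINT x|lebesgue. norm (f (x + h) - g (x + h))) + (LINT x|lebesgue. norm (g (x + h) - g x)) 
        + (LINT x|lebesgue. norm (f x - g x))"
      using f fi gi g(3) by (subst Bochner_Integration.integral_add) auto
    finally show "(LINT x|lebesgue. norm (f (x + h) - f x)) < e" using 1 2 g(4) by simp
  qed (use d in auto)
qed

text \<open>A translation by half a period in direction \<open>k\<close> changes the sign of the cosine. Hence twice the integral
is at most the \<open>L\<^sup>1\<close> distance of \<open>f\<close> to a translate of itself, and the translation tends to \<open>0\<close> with the period.\<close>

lemma riemann_lebesgue:
  fixes f :: "'a::euclidean_space \<Rightarrow> real"
  assumes f: "integrable lebesgue f" and k: "k \<noteq> 0"
  shows "(\<lambda>N. LINT y|lebesgue. cos (real N * (k \<bullet> y)) * f y) \<longlonglongrightarrow> 0"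
proof (rule LIMSEQ_I)
  fix e :: real assume "e > 0"
  then obtain d where d: "d > 0" "\<And>h. norm h < d \<Longrightarrow> (LINT x|lebesgue. norm (f (x + h) - f x)) < e"
    using L1_shift_continuous[OF f] by blast
  have cm: "(\<lambda>y. cos (real N * (k \<bullet> y))) \<in> borel_measurable lebesgue" for N
    by (rule measurable_completion) (auto intro!: borel_measurable_continuous_onI continuous_intros)
  have ci: "integrable lebesgue (\<lambda>y. cos (real N * (k \<bullet> y)) * F y)" if "integrable lebesgue F" for N and F :: "'a \<Rightarrow> real"
    by (rule Bochner_Integration.integrable_bound[OF that])
      (auto intro!: borel_measurable_times cm mult_left_le_one_le simp: borel_measurable_integrable that abs_mult)
  obtain M where M: "real M > pi / (norm k * d)" using reals_Archimedean2 by blast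
  show "\<exists>no. \<forall>n\<ge>no. norm ((LINT y|lebesgue. cos (real n * (k \<bullet> y)) * f y) - 0) < e"
  proof (intro exI allI impI)
    fix N assume N: "N \<ge> max M 1"
    \<comment> \<open>half a period of \<open>cos (N * (k \<bullet> y))\<close>\<close>
    define h where "h = (pi / (real N * (k \<bullet> k))) *\<^sub>R k"
    let ?I = "LINT y|lebesgue. cos (real N * (k \<bullet> y)) * f y"
    have kk: "k \<bullet> k > 0" "norm k > 0" using k by auto
    have "norm h = pi / (real N * norm k)"
      using kk N by (simp add: h_def field_simps power2_norm_eq_inner flip: power2_eq_square)
    also have "\<dots> < d" 
    proof -
      have "pi / (norm k * d) < real N" using M N by linarith
      then show ?thesis using d(1) kk N by (simp add: field_simps)
    qed
    finally have hd: "norm h < d" .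
    have "real N * (k \<bullet> h) = pi" using kk N by (simp add: h_def)
    then have cs: "cos (real N * (k \<bullet> (y + h))) = - cos (real N * (k \<bullet> y))" for y
      by (simp add: inner_add_right distrib_left)
    have "?I = (LINT y|lebesgue. cos (real N * (k \<bullet> (y + h))) * f (y + h))"
      using integrable_shift(2)[OF ci[OF f, of N], of h] by simp
    also have "\<dots> = - (LINT y|lebesgue. cos (real N * (k \<bullet> y)) * f (y + h))"
      by (simp add: cs)
    finally have "2 * ?I = ?I - (LINT y|lebesgue. cos (real N * (k \<bullet> y)) * f (y + h))" by simp
    also have "\<dots> = (LINT y|lebesgue. cos (real N * (k \<bullet> y)) * f y - cos (real N * (k \<bullet> y)) * f (y + h))"
      by (intro Bochner_Integration.integral_diff[symmetric] ci f integrable_shift)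
    finally have "\<bar>2 * ?I\<bar> \<le> (LINT y|lebesgue. norm (cos (real N * (k \<bullet> y)) * f y - cos (real N * (k \<bullet> y)) * f (y + h)))"
      by simp
    also have "\<dots> \<le> (LINT y|lebesgue. norm (f (y + h) - f y))"
    proof (rule integral_mono)
      show "norm (cos (real N * (k \<bullet> y)) * f y - cos (real N * (k \<bullet> y)) * f (y + h)) \<le> norm (f (y + h) - f y)" for y
        by (simp add: abs_mult abs_minus_commute mult_left_le_one_le flip: right_diff_distrib)
    qed (intro integrable_norm Bochner_Integration.integrable_diff ci f integrable_shift)+
    also have "\<dots> < e" by (rule d(2)[OF hd])
    finally show "norm (?I - 0) < e" by simp
  qed
qed

text \<open>Young's inequality, applied to \<open>f\<close> and \<open>g\<close> divided by their norms.\<close>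

lemma Holder_integral:
  fixes f g :: "'a \<Rightarrow> real"
  assumes p: "p > 1" "q > 1" "1 / p + 1 / q = 1"
    and fm: "f \<in> borel_measurable M" "integrable M (\<lambda>x. \<bar>f x\<bar> powr p)"
    and gm: "g \<in> borel_measurable M" "integrable M (\<lambda>x. \<bar>g x\<bar> powr q)"
  shows "integrable M (\<lambda>x. f x * g x)"
    and "(LINT x|M. \<bar>f x * g x\<bar>) \<le> (LINT x|M. \<bar>f x\<bar> powr p) powr (1 / p) * (LINT x|M. \<bar>g x\<bar> powr q) powr (1 / q)"
proof -
  have Y: "\<bar>f x * g x\<bar> \<le> \<bar>f x\<bar> powr p / p + \<bar>g x\<bar> powr q / q" for x
    using Youngs_inequality[OF p, of "\<bar>f x\<bar>" "\<bar>g x\<bar>"] by (simp add: abs_mult)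
  show i: "integrable M (\<lambda>x. f x * g x)"
    by (rule Bochner_Integration.integrable_bound[of M "\<lambda>x. \<bar>f x\<bar> powr p / p + \<bar>g x\<bar> powr q / q"])
      (use fm gm Y p in \<open>auto intro!: AE_I2 order_trans[OF Y]\<close>)
  define A where "A = (LINT x|M. \<bar>f x\<bar> powr p)"
  define B where "B = (LINT x|M. \<bar>g x\<bar> powr q)"
  have AB: "A \<ge> 0" "B \<ge> 0" by (auto simp: A_def B_def)
  have zero: "(LINT x|M. \<bar>f x * g x\<bar>) = 0" if "A = 0 \<or> B = 0"
  proof -
    from that have "AE x in M. f x * g x = 0"
    proof
      assume "A = 0"
      then have "AE x in M. \<bar>f x\<bar> powr p = 0"
        unfolding A_def using fm(2) by (subst (asm) integral_nonneg_eq_0_iff_AE) auto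
      then show ?thesis by eventually_elim auto
    next
      assume "B = 0"
      then have "AE x in M. \<bar>g x\<bar> powr q = 0"
        unfolding B_def using gm(2) by (subst (asm) integral_nonneg_eq_0_iff_AE) auto
      then show ?thesis by eventually_elim auto
    qed
    then have "(LINT x|M. \<bar>f x * g x\<bar>) = (LINT x|M. 0)"
      by (intro integral_cong_AE) (use fm gm in auto)
    then show ?thesis by simp
  qed
  have "(LINT x|M. \<bar>f x * g x\<bar>) \<le> A powr (1/p) * B powr (1/q)"
  proof (cases "A = 0 \<or> B = 0")
    case True then show ?thesis using zero by simp
  next
    case False
    then have pos: "A > 0" "B > 0" using AB by auto
    let ?a = "A powr (1/p)" and ?b = "B powr (1/q)"
    have ab: "?a > 0" "?b > 0" using pos by auto
    have pw: "(\<bar>f x\<bar> / ?a) powr p = \<bar>f x\<bar> powr p / A" "(\<bar>g x\<bar> / ?b) powr q = \<bar>g x\<bar> powr q / B" for x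
      using pos p by (simp_all add: powr_divide powr_powr)
    have "\<bar>f x * g x\<bar> / (?a * ?b) \<le> \<bar>f x\<bar> powr p / A / p + \<bar>g x\<bar> powr q / B / q" for x
      using Youngs_inequality[OF p, of "\<bar>f x\<bar> / ?a" "\<bar>g x\<bar> / ?b"] ab by (simp add: abs_mult pw)
    then have "(LINT x|M. \<bar>f x * g x\<bar> / (?a * ?b)) \<le> (LINT x|M. \<bar>f x\<bar> powr p / A / p + \<bar>g x\<bar> powr q / B / q)"
      using i fm gm by (intro integral_mono) auto
    also have "\<dots> = A / A / p + B / B / q"
      using fm gm by (subst Bochner_Integration.integral_add) (auto simp: A_def B_def)
    also have "\<dots> = 1" using pos p by simp
    finally show ?thesis using ab by (simp add: field_simps)
  qed
  then show "(LINT x|M. \<bar>f x * g x\<bar>) \<le> (LINT x|M. \<bar>f x\<bar> powr p) powr (1 / p) * (LINT x|M. \<bar>g x\<bar> powr q) powr (1 / q)"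
    by (simp add: A_def B_def)
qed

section \<open>The constraint set and its relaxation\<close>

lemma outer_nth [simp]: "outer v w $ i $ j = v $ i * w $ j" by (simp add: outer_def)
lemma outer_row: "outer v w $ i = (v $ i) *\<^sub>R w" by (simp add: vec_eq_iff)

lemma bounded_bilinear_outer: "bounded_bilinear (outer :: real^'n::finite \<Rightarrow> real^'n \<Rightarrow> real^'n^'n)"
  by (subst bilinear_conv_bounded_bilinear[symmetric])
    (auto simp: bilinear_def vec_eq_iff algebra_simps intro!: linearI)

lemma trace_outer: "trace (outer v w) = v \<bullet> w"
  by (simp add: trace_def inner_vec_def)

lemma trace_add_matrix: "trace (A + B :: real^'n::finite^'n) = trace A + trace B"
  and trace_diff_matrix: "trace (A - B :: real^'n::finite^'n) = trace A - trace B"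
  and trace_scaleR: "trace (r *\<^sub>R A) = r * trace A"
  by (auto simp: trace_def sum.distrib sum_subtractf sum_distrib_left)

text \<open>Points of \<open>Kset\<close> are quadratic expressions in \<open>(u, b)\<close>. The same expressions with operators in place of
\<open>u\<close> and \<open>b\<close> will give potentials for the linear system.\<close>

definition K_point :: "real^'n::finite \<Rightarrow> real^'n \<Rightarrow> (real^'n) \<times> (real^'n) \<times> (real^'n^'n) \<times> (real^'n^'n)" where
  "K_point u b = (u, b, outer u u - outer b b, outer b u - outer u b)"

lemma Kset_eq: "Kset = (\<lambda>(u, b). K_point u b) ` (sphere 0 1 \<times> sphere 0 1)"
proof -
  have "outer u u - outer b b \<in> sym_tracefree" if "norm u = 1" "norm b = 1" for u b :: "real^'n"
    using that by (auto simp: sym_tracefree_def trace_diff_matrix trace_outer transpose_def vec_eq_iff mult.commute norm_eq_1)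
  moreover have "outer b u - outer u b \<in> skew" for u b :: "real^'n"
    by (auto simp: skew_def transpose_def vec_eq_iff)
  ultimately show ?thesis unfolding Kset_def K_point_def by auto
qed

lemma compact_Kset: "compact (Kset :: ((real^'n::finite) \<times> (real^'n) \<times> (real^'n^'n) \<times> (real^'n^'n)) set)"
  unfolding Kset_eq K_point_def
  by (intro compact_continuous_image compact_Times compact_sphere)
    (auto intro!: continuous_intros bounded_bilinear.continuous_on[OF bounded_bilinear_outer] simp: case_prod_unfold)

lemma compact_hull_Kset: "compact (convex hull Kset :: ((real^'n::finite) \<times> (real^'n) \<times> (real^'n^'n) \<times> (real^'n^'n)) set)"
  by (intro compact_convex_hull compact_Kset)

lemma transpose_linear: "transpose (A + B) = transpose A + transpose (B :: real^'n::finite^'n)"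
    "transpose (r *\<^sub>R A) = r *\<^sub>R transpose A" "transpose (0 :: real^'n^'n) = 0"
  by (auto simp: transpose_def vec_eq_iff)

lemma subspace_sym_tracefree: "subspace sym_tracefree"
  by (auto simp: sym_tracefree_def subspace_def trace_add_matrix trace_scaleR transpose_linear) (simp add: trace_def)

lemma subspace_skew: "subspace skew"
  by (auto simp: skew_def subspace_def transpose_linear)

lemma subspace_state_space: "subspace (state_space :: 'n::finite state set)"
  using subspace_sym_tracefree subspace_skew
  by (auto simp: state_space_def subspace_def zero_prod_def)

text \<open>\<open>Uset\<close> is the interior of this convex set relative to \<open>state_space\<close>.\<close>

definition relaxed_box :: "('n::finite state) set" where
  "relaxed_box = {(u, b, M, Q, q). (u, b, M, Q) \<in> convex hull Kset \<and> q \<in> {-1..1}}"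

lemma hull_Kset_bounds: "(u, b, M, Q) \<in> convex hull Kset \<Longrightarrow> M \<in> sym_tracefree \<and> Q \<in> skew \<and> norm u \<le> 1 \<and> norm b \<le> 1"
proof -
  assume a: "(u, b, M, Q) \<in> convex hull Kset"
  have "Kset \<subseteq> cball (0::real^'n) 1 \<times> cball (0::real^'n) 1 \<times> sym_tracefree \<times> skew"
    unfolding Kset_def by (intro subsetI, clarify) simp
  then have "convex hull Kset \<subseteq> cball (0::real^'n) 1 \<times> cball (0::real^'n) 1 \<times> sym_tracefree \<times> skew"
    by (intro hull_minimal convex_Times convex_cball subspace_imp_convex subspace_sym_tracefree subspace_skew)
  then show ?thesis using a by auto
qed

lemma relaxed_box_sub: "relaxed_box \<subseteq> state_space"
  using hull_Kset_bounds by (auto simp: relaxed_box_def state_space_def)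

definition group_pressure :: "'n::finite state \<Rightarrow> ((real^'n) \<times> (real^'n) \<times> (real^'n^'n) \<times> (real^'n^'n)) \<times> real" where
  "group_pressure = (\<lambda>(u, b, M, Q, q). ((u, b, M, Q), q))"

lemma linear_group_pressure: "linear group_pressure"
  by (auto simp: group_pressure_def intro!: linearI)

lemma relaxed_box_vimage: "relaxed_box = group_pressure -` ((convex hull Kset) \<times> {-1..1})"
  by (auto simp: relaxed_box_def group_pressure_def)

lemma convex_relaxed_box: "convex (relaxed_box :: 'n::finite state set)"
  unfolding relaxed_box_vimage
  by (intro convex_linear_vimage linear_group_pressure convex_Times convex_convex_hull convex_real_interval)

lemma closed_relaxed_box: "closed (relaxed_box :: 'n::finite state set)"
  unfolding relaxed_box_vimage
  by (intro closed_vimage closed_Times compact_imp_closed[OF compact_hull_Kset] closed_real_atLeastAtMost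
      linear_continuous_on linear_conv_bounded_linear[THEN iffD1] linear_group_pressure)

lemma relaxed_box_bounded: obtains C where "C > 0" "\<And>z. z \<in> (relaxed_box :: 'n::finite state set) \<Longrightarrow> norm z \<le> C"
proof -
  obtain B where B: "\<And>x. x \<in> (convex hull Kset :: ((real^'n) \<times> (real^'n) \<times> (real^'n^'n) \<times> (real^'n^'n)) set) \<Longrightarrow> norm x \<le> B"
    using compact_imp_bounded[OF compact_hull_Kset, unfolded bounded_iff] by metis
  have n: "norm z \<le> norm u + (norm b + (norm M + (norm Q + norm q)))" if "z = (u, b, M, Q, q)" for z :: "'n state" and u b M Q q
    unfolding that by (intro order_trans[OF norm_Pair_le] add_left_mono order_refl)
  have "norm z \<le> 4 * \<bar>B\<bar> + 1" if "z \<in> relaxed_box" for z :: "'n state"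
  proof -
    obtain u b M Q q where z: "z = (u, b, M, Q, q)" by (cases z)
    then have x: "norm (u, b, M, Q) \<le> B" and q: "norm q \<le> 1" using that B by (auto simp: relaxed_box_def)
    have "norm u \<le> norm (u, b, M, Q)" using norm_fst_le[of u "(b, M, Q)"] by simp
    moreover have "norm (b, M, Q) \<le> norm (u, b, M, Q)" using norm_snd_le[of "(b, M, Q)" u] by simp
    moreover have "norm b \<le> norm (b, M, Q)" using norm_fst_le[of b "(M, Q)"] by simp
    moreover have "norm (M, Q) \<le> norm (b, M, Q)" using norm_snd_le[of "(M, Q)" b] by simp
    moreover have "norm M \<le> norm (M, Q)" "norm Q \<le> norm (M, Q)" using norm_fst_le[of M Q] norm_snd_le[of Q M] by auto
    ultimately show ?thesis using n[OF z] x q by linarith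
  qed
  then show ?thesis using that[of "4 * \<bar>B\<bar> + 1"] by auto
qed

lemma Uset_eq: "Uset = top_of_set state_space interior_of relaxed_box"
  by (simp add: Uset_def relaxed_box_def)

lemma Uset_sub_box: "Uset \<subseteq> relaxed_box"
  by (simp add: Uset_eq interior_of_subset)

lemma Uset_iff: "z \<in> Uset \<longleftrightarrow> z \<in> state_space \<and> (\<exists>e>0. ball z e \<inter> state_space \<subseteq> relaxed_box)"
proof
  assume "z \<in> Uset"
  then obtain T where T: "openin (top_of_set state_space) T" "z \<in> T" "T \<subseteq> relaxed_box"
    by (auto simp: Uset_eq interior_of_def)
  then obtain e where "e > 0" "ball z e \<inter> state_space \<subseteq> T"
    by (auto simp: openin_contains_ball)
  then show "z \<in> state_space \<and> (\<exists>e>0. ball z e \<inter> state_space \<subseteq> relaxed_box)"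
    using T openin_imp_subset by blast
next
  assume "z \<in> state_space \<and> (\<exists>e>0. ball z e \<inter> state_space \<subseteq> relaxed_box)"
  then obtain e where e: "z \<in> state_space" "e > 0" "ball z e \<inter> state_space \<subseteq> relaxed_box" by blast
  have "openin (top_of_set state_space) (state_space \<inter> ball z e)"
    by (simp add: openin_open_Int)
  then show "z \<in> Uset" using e unfolding Uset_eq interior_of_def by (auto intro!: exI[of _ "state_space \<inter> ball z e"])
qed

lemma Uset_sub_state: "Uset \<subseteq> state_space" using Uset_iff by blast

text \<open>The line segment principle, for the relative interior: a small ball around \<open>z\<close> is contracted towards \<open>c\<close>.\<close>

lemma Uset_mix:
  assumes z: "z \<in> Uset" and c: "c \<in> relaxed_box" and s: "0 \<le> s" "s < 1"
  shows "(1 - s) *\<^sub>R z + s *\<^sub>R c \<in> (Uset :: 'n::finite state set)"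
proof -
  obtain e where e: "z \<in> state_space" "e > 0" "ball z e \<inter> state_space \<subseteq> relaxed_box"
    using z Uset_iff by blast
  let ?p = "(1 - s) *\<^sub>R z + s *\<^sub>R c"
  note sub = subspace_add[OF subspace_state_space] subspace_scale[OF subspace_state_space] subspace_diff[OF subspace_state_space]
  have cs: "c \<in> state_space" using c relaxed_box_sub by blast
  have "ball ?p ((1 - s) * e) \<inter> state_space \<subseteq> relaxed_box"
  proof
    fix x assume x: "x \<in> ball ?p ((1 - s) * e) \<inter> state_space"
    define y where "y = (x - s *\<^sub>R c) /\<^sub>R (1 - s)"
    have xy: "x = (1 - s) *\<^sub>R y + s *\<^sub>R c" using s by (simp add: y_def)
    then have "norm (?p - x) = (1 - s) * norm (z - y)"
      using s by (simp add: scaleR_diff_right[symmetric] )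
    then have "y \<in> ball z e" using x s by (simp add: dist_norm)
    moreover have "y \<in> state_space" unfolding y_def using x cs by (intro sub) auto
    ultimately have "y \<in> relaxed_box" using e by blast
    then show "x \<in> relaxed_box" unfolding xy using c s
      by (intro convexD[OF convex_relaxed_box]) auto
  qed
  moreover have "?p \<in> state_space" using e cs by (intro sub)
  ultimately show ?thesis unfolding Uset_iff using e s by (auto intro!: exI[of _ "(1 - s) * e"])
qed

text \<open>\<open>Uset\<close> is open only relative to \<open>state_space\<close>, so the perturbation \<open>p\<close> has to stay in that subspace.\<close>

lemma Uset_margin:
  assumes S: "compact S" "S \<subseteq> (Uset :: 'n::finite state set)"
  obtains e where "e > 0" "\<And>z p. z \<in> S \<Longrightarrow> p \<in> state_space \<Longrightarrow> norm p < e \<Longrightarrow> z + p \<in> Uset"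
proof -
  have "openin (top_of_set state_space) (Uset :: 'n state set)" by (simp add: Uset_eq)
  then obtain T where T: "open T" "(Uset :: 'n state set) = state_space \<inter> T" by (auto simp: openin_open)
  obtain e where e: "e > 0" "(\<Union>x\<in>S. ball x e) \<subseteq> T"
    using compact_subset_open_imp_ball_epsilon_subset[OF S(1) T(1)] S(2) T(2) by blast
  show ?thesis
  proof (rule that[OF e(1)])
    fix z p :: "'n state" assume *: "z \<in> S" "p \<in> state_space" "norm p < e"
    then have "z + p \<in> ball z e" by (simp add: dist_norm)
    then show "z + p \<in> Uset" using * e S T subspace_add[OF subspace_state_space, of z p] by blast
  qed
qed

section \<open>Segments in the relaxed set\<close>

lemma finite_argmax:
  fixes f :: "'a \<Rightarrow> real"
  assumes "finite S" "S \<noteq> {}"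
  obtains x where "x \<in> S" "\<And>y. y \<in> S \<Longrightarrow> f y \<le> f x"
proof -
  have "Max (f ` S) \<in> f ` S" using assms by (intro Max_in) auto
  then obtain x where "x \<in> S" "f x = Max (f ` S)" by auto
  then show ?thesis using that assms by (metis Max_ge finite_imageI imageI)
qed

text \<open>Write \<open>k\<close> as a convex combination of at most \<open>DIM + 1\<close> points, let \<open>k\<^sub>1\<close> be one of largest weight and \<open>k\<^sub>2\<close>
one for which weight times distance to \<open>k\<^sub>1\<close> is largest. Moving weight between \<open>k\<^sub>1\<close> and \<open>k\<^sub>2\<close> stays in
the hull as long as at most the weight \<open>l\<close> of \<open>k\<^sub>2\<close> is moved. As \<open>k - k\<^sub>1\<close> is the weighted sum of the
differences to \<open>k\<^sub>1\<close>, its largest term carries at least the fraction \<open>1 / (DIM + 1)\<close> of its norm.\<close>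

lemma hull_segment:
  fixes k :: "'a::euclidean_space"
  assumes "k \<in> convex hull K"
  obtains k1 k2 l where "k1 \<in> K" "k2 \<in> K" "l \<ge> 0" "norm (k - k1) \<le> (DIM('a) + 1) * (l * norm (k2 - k1))"
    "\<And>t. \<bar>t\<bar> \<le> l \<Longrightarrow> k + t *\<^sub>R (k2 - k1) \<in> convex hull K"
proof -
  obtain S where S: "finite S" "S \<subseteq> K" "card S \<le> DIM('a) + 1" "k \<in> convex hull S"
    using assms unfolding caratheodory[of K] by blast
  then obtain w where w: "\<And>x. x \<in> S \<Longrightarrow> 0 \<le> w x" "sum w S = 1" "(\<Sum>x\<in>S. w x *\<^sub>R x) = k"
    unfolding convex_hull_finite[OF S(1)] by blast
  have ne: "S \<noteq> {}" using S(4) by auto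
  obtain k1 where k1: "k1 \<in> S" "\<And>x. x \<in> S \<Longrightarrow> w x \<le> w k1"
    using finite_argmax[OF S(1) ne, of w] by blast
  obtain k2 where k2: "k2 \<in> S" "\<And>x. x \<in> S \<Longrightarrow> w x * norm (x - k1) \<le> w k2 * norm (k2 - k1)"
    using finite_argmax[OF S(1) ne, of "\<lambda>x. w x * norm (x - k1)"] by blast
  have "k - k1 = (\<Sum>x\<in>S. w x *\<^sub>R (x - k1))"
    by (simp add: scaleR_diff_right sum_subtractf w(3) scaleR_left.sum[symmetric] w(2))
  then have "norm (k - k1) \<le> (\<Sum>x\<in>S. w x * norm (x - k1))"
    by (metis (mono_tags, lifting) norm_scaleR norm_sum sum.cong w(1) abs_of_nonneg)
  also have "\<dots> \<le> (\<Sum>x\<in>S. w k2 * norm (k2 - k1))" by (intro sum_mono k2)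
  also have "\<dots> = card S * (w k2 * norm (k2 - k1))" by simp
  also have "\<dots> \<le> (DIM('a) + 1) * (w k2 * norm (k2 - k1))"
    using S(3) w(1)[OF k2(1)] by (intro mult_right_mono) (auto simp flip: of_nat_Suc)
  finally have n: "norm (k - k1) \<le> (DIM('a) + 1) * (w k2 * norm (k2 - k1))" .
  have "k + t *\<^sub>R (k2 - k1) \<in> convex hull K" if t: "\<bar>t\<bar> \<le> w k2" for t
  proof (cases "k1 = k2")
    case True then show ?thesis using assms by simp
  next
    case False
    \<comment> \<open>nonnegative, since \<open>w k1\<close> is at least \<open>w k2\<close>\<close>
    define w' where "w' x = w x + (if x = k2 then t else 0) - (if x = k1 then t else 0)" for x
    have "0 \<le> w' x" if "x \<in> S" for x
      using that w(1)[of x] t k1(2)[OF k2(1)] False by (auto simp: w'_def)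
    moreover have "sum w' S = 1"
      using k1(1) k2(1) S(1) by (simp add: w'_def sum.distrib sum_subtractf w(2) sum.delta')
    moreover have "(\<Sum>x\<in>S. w' x *\<^sub>R x) = k + t *\<^sub>R (k2 - k1)"
    proof -
      have "(\<Sum>x\<in>S. w' x *\<^sub>R x) = (\<Sum>x\<in>S. w x *\<^sub>R x + (if x = k2 then t *\<^sub>R x else 0) - (if x = k1 then t *\<^sub>R x else 0))"
        by (intro sum.cong) (auto simp: w'_def algebra_simps)
      also have "\<dots> = k + t *\<^sub>R k2 - t *\<^sub>R k1"
        using k1(1) k2(1) S(1) by (simp add: sum.distrib sum_subtractf w(3))
      finally show ?thesis by (simp add: algebra_simps)
    qed
    ultimately have "k + t *\<^sub>R (k2 - k1) \<in> convex hull S"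
      unfolding convex_hull_finite[OF S(1)] by blast
    then show ?thesis using hull_mono[OF S(2)] by blast
  qed
  then show ?thesis using that[of k1 k2 "w k2"] k1(1) k2(1) S(2) w(1) n by blast
qed

definition pressureless :: "(real^'n::finite) \<times> (real^'n) \<times> (real^'n^'n) \<times> (real^'n^'n) \<Rightarrow> 'n state" where
  "pressureless = (\<lambda>(u, b, M, Q). (u, b, M, Q, 0))"

text \<open>The \<open>(u, b)\<close>-part has norm \<open>sqrt 2\<close> on \<open>Kset\<close>, so a state as in the hypothesis has distance at least
\<open>sqrt 2 - sqrt (2 - \<delta>)\<close> from \<open>Kset\<close>, and the segment of \<open>hull_segment\<close> is long. It lies in the closed hull
only; its middle half lies in the relative interior by \<open>Uset_mix\<close>.\<close>

lemma Uset_segment: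
  fixes z :: "'n::finite state"
  assumes z: "z \<in> Uset" and d: "(norm (fst z))\<^sup>2 + (norm (fst (snd z)))\<^sup>2 \<le> 2 - \<delta>"
  obtains u1 b1 u2 b2 l where "norm u1 = 1" "norm b1 = 1" "norm u2 = 1" "norm b2 = 1"
    "\<And>s. \<bar>s\<bar> \<le> 1 \<Longrightarrow> z + s *\<^sub>R l *\<^sub>R pressureless (K_point u1 b1 - K_point u2 b2) \<in> Uset"
    "(sqrt 2 - sqrt (2 - \<delta>)) / (2 * real (DIM((real^'n) \<times> (real^'n) \<times> (real^'n^'n) \<times> (real^'n^'n)) + 1))
      \<le> norm (l *\<^sub>R pressureless (K_point u1 b1 - K_point u2 b2))"
proof -
  obtain u b M Q q where zz: "z = (u, b, M, Q, q)" by (cases z)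
  define k where "k = (u, b, M, Q)"
  have k: "k \<in> convex hull Kset" and q: "q \<in> {-1..1}"
    using z Uset_sub_box by (auto simp: relaxed_box_def zz k_def)
  let ?D = "real (DIM((real^'n) \<times> (real^'n) \<times> (real^'n^'n) \<times> (real^'n^'n)) + 1)"
  obtain k1 k2 l where l: "k1 \<in> Kset" "k2 \<in> Kset" "l \<ge> 0" "norm (k - k1) \<le> ?D * (l * norm (k2 - k1))"
    "\<And>t. \<bar>t\<bar> \<le> l \<Longrightarrow> k + t *\<^sub>R (k2 - k1) \<in> convex hull Kset"
    using hull_segment[OF k] by metis
  obtain u1 b1 where k1: "k1 = K_point u1 b1" "norm u1 = 1" "norm b1 = 1"
    using l(1) by (auto simp: Kset_eq)
  obtain u2 b2 where k2: "k2 = K_point u2 b2" "norm u2 = 1" "norm b2 = 1"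
    using l(2) by (auto simp: Kset_eq)
  have ne: "norm (pressureless x) = norm x" for x :: "(real^'n) \<times> (real^'n) \<times> (real^'n^'n) \<times> (real^'n^'n)"
    by (cases x) (simp add: pressureless_def norm_Pair)
  have "z + s *\<^sub>R (l / 2) *\<^sub>R pressureless (K_point u2 b2 - K_point u1 b1) \<in> Uset" if s: "\<bar>s\<bar> \<le> 1" for s
  proof -
    \<comment> \<open>the point twice as far from \<open>z\<close> still lies in the closed hull\<close>
    let ?c = "z + (s * l) *\<^sub>R pressureless (k2 - k1)"
    have "\<bar>s * l\<bar> \<le> l" using s l(3) by (simp add: abs_mult mult_left_le_one_le)
    from l(5)[OF this] have "?c \<in> relaxed_box"
      using q by (cases k1; cases k2) (simp add: relaxed_box_def zz k_def pressureless_def)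
    from Uset_mix[OF z this, of "1/2"] have "(1/2) *\<^sub>R z + (1/2) *\<^sub>R ?c \<in> Uset" by simp
    moreover have "(1/2) *\<^sub>R z + (1/2) *\<^sub>R (z + x) = z + (1/2) *\<^sub>R x" for x
      by (simp add: scaleR_add_right add.assoc[symmetric] scaleR_left_distrib[symmetric])
    ultimately show ?thesis by (simp add: k1 k2 mult.commute)
  qed
  moreover have "(sqrt 2 - sqrt (2 - \<delta>)) / (2 * ?D) \<le> norm ((l / 2) *\<^sub>R pressureless (K_point u2 b2 - K_point u1 b1))"
  proof -
    have nub: "norm (a, c) \<le> norm (a, c, A, B)" for a c :: "real^'n" and A B :: "real^'n^'n"
      unfolding norm_Pair by (intro real_sqrt_le_mono add_left_mono power_mono) (auto intro!: real_le_rsqrt)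
    have "norm (u1, b1) \<le> norm (u, b) + norm (u - u1, b - b1)"
      using norm_triangle_ineq4[of "(u, b)" "(u - u1, b - b1)"] by simp
    moreover have "norm (u1, b1) = sqrt 2" by (simp add: norm_Pair k1)
    moreover have "norm (u, b) \<le> sqrt (2 - \<delta>)" using d by (simp add: norm_Pair zz)
    moreover have "norm (u - u1, b - b1) \<le> norm (k - k1)"
      using nub by (simp add: k_def k1 K_point_def)
    ultimately have "sqrt 2 - sqrt (2 - \<delta>) \<le> ?D * (l * norm (k2 - k1))" using l(4) by linarith
    moreover have "?D > 0" by (simp only: of_nat_0_less_iff)
    ultimately have "(sqrt 2 - sqrt (2 - \<delta>)) / (2 * ?D) \<le> (?D * (l * norm (k2 - k1))) / (2 * ?D)"
      by (intro divide_right_mono) auto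
    also have "\<dots> = l / 2 * norm (k2 - k1)" using \<open>?D > 0\<close> by (simp add: field_simps)
    finally show ?thesis using l(3) ne by (simp add: k1 k2)
  qed
  ultimately show ?thesis using k1 k2 by (intro that[of u2 b2 u1 b1 "l / 2"])
qed

section \<open>Potentials for plane waves of the linear system\<close>

text \<open>The relaxed system at one point, as a condition on the derivative \<open>D\<close> of the state there.\<close>

definition linear_mhd :: "('n::finite spacetime \<Rightarrow> 'n state) \<Rightarrow> bool" where
  "linear_mhd D \<longleftrightarrow> 
    (\<forall>i. fst (D (0, 1)) $ i + (\<Sum>j\<in>UNIV. fst (snd (snd (D (axis j 1, 0)))) $ i $ j) 
         + snd (snd (snd (snd (D (axis i 1, 0))))) = 0) \<and>
    (\<forall>i. fst (snd (D (0, 1))) $ i + (\<Sum>j\<in>UNIV. fst (snd (snd (snd (D (axis j 1, 0))))) $ i $ j) = 0) \<and>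
    (\<Sum>j\<in>UNIV. fst (D (axis j 1, 0)) $ j) = 0 \<and> (\<Sum>j\<in>UNIV. fst (snd (D (axis j 1, 0))) $ j) = 0"

lemma dd_fst: "smooth f \<Longrightarrow> dd v (\<lambda>x. fst (f x)) y = fst (dd v f y)"
  by (rule dd_linear_compose[OF bounded_linear_fst])
lemma dd_snd: "smooth f \<Longrightarrow> dd v (\<lambda>x. snd (f x)) y = snd (dd v f y)"
  by (rule dd_linear_compose[OF bounded_linear_snd])

lemma relaxed_mhd_iff:
  assumes z: "smooth z"
  shows "relaxed_mhd z \<longleftrightarrow> (\<forall>y. linear_mhd (\<lambda>v. dd v z y))"
proof -
  have zz: "z = (\<lambda>y. (u y, b y, M y, Q y, q y)) \<longleftrightarrow> u = (\<lambda>y. fst (z y)) \<and> b = (\<lambda>y. fst (snd (z y))) \<and>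
     M = (\<lambda>y. fst (snd (snd (z y)))) \<and> Q = (\<lambda>y. fst (snd (snd (snd (z y))))) \<and> q = (\<lambda>y. snd (snd (snd (snd (z y)))))"
    for u b M Q q by (auto simp: fun_eq_iff)
  note sm = smooth_fst smooth_snd smooth_nth z
  show ?thesis
    unfolding relaxed_mhd_def zz linear_mhd_def dt_def dx_def div_x_def Div_x_def grad_x_def
    by (simp add: dd_fst dd_snd dd_nth sm vec_eq_iff all_conj_distrib) 
qed

text \<open>For a fixed state \<open>c\<close> and a scalar function \<open>f\<close>, the left-hand side of the \<open>i\<close>-th momentum equation for
\<open>f *\<^sub>R c\<close> is the derivative of \<open>f\<close> in the direction of this space-time vector; likewise below for the
magnetic field.\<close>

definition momentum_flux :: "'n::finite \<Rightarrow> 'n state \<Rightarrow> 'n spacetime" where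
  "momentum_flux i = (\<lambda>(u, b, M, Q, q). (M $ i + axis i q, u $ i))"
definition induction_flux :: "'n::finite \<Rightarrow> 'n state \<Rightarrow> 'n spacetime" where
  "induction_flux i = (\<lambda>(u, b, M, Q, q). (Q $ i, b $ i))"

lemma linear_spacetime:
  fixes f :: "'n::finite spacetime \<Rightarrow> real"
  assumes "linear f"
  shows "f (x, t) = t * f (0, 1) + (\<Sum>j\<in>UNIV. x $ j * f (axis j 1, 0))"
proof -
  have "(x, t) = t *\<^sub>R (0, 1) + (\<Sum>j\<in>UNIV. x $ j *\<^sub>R (axis j 1, 0))"
    by (simp add: sum_prod basis_expansion[of x, unfolded scalar_mult_eq_scaleR]) 
  then have "f (x, t) = f (t *\<^sub>R (0, 1) + (\<Sum>j\<in>UNIV. x $ j *\<^sub>R (axis j 1, 0)))" by simp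
  also have "\<dots> = t * f (0, 1) + (\<Sum>j\<in>UNIV. x $ j * f (axis j 1, 0))"
    by (simp only: linear_add[OF assms] linear_scale[OF assms] linear_sum[OF assms] real_scaleR_def)
  finally show ?thesis .
qed

text \<open>Each equation of the system is a space-time divergence. On a sum of scalar functions times fixed states
it becomes a sum of directional derivatives, the directions being the fluxes of these states.\<close>

lemma linear_mhd_sum:
  fixes f :: "'i \<Rightarrow> 'n::finite spacetime \<Rightarrow> real"
  assumes lin: "\<And>l. l \<in> I \<Longrightarrow> linear (f l)"
    and U: "\<And>i. (\<Sum>l\<in>I. f l (momentum_flux i (c l))) = 0" and B: "\<And>i. (\<Sum>l\<in>I. f l (induction_flux i (c l))) = 0"
    and u: "(\<Sum>l\<in>I. f l (fst (c l), 0)) = 0" and b: "(\<Sum>l\<in>I. f l (fst (snd (c l)), 0)) = 0"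
  shows "linear_mhd (\<lambda>v. \<Sum>l\<in>I. f l v *\<^sub>R c l)"
proof -
  have fs: "fst (\<Sum>l\<in>I. h l) = (\<Sum>l\<in>I. fst (h l))" "snd (\<Sum>l\<in>I. h l) = (\<Sum>l\<in>I. snd (h l))" for h :: "'i \<Rightarrow> 'x::real_vector \<times> 'y::real_vector"
    by (induction I rule: infinite_finite_induct) auto
  have ax: "(\<Sum>j\<in>UNIV. axis i q $ j * g j) = q * g i" for i :: 'n and q and g :: "'n \<Rightarrow> real"
  proof -
    have "(\<Sum>j\<in>UNIV. axis i q $ j * g j) = (\<Sum>j\<in>UNIV. if j = i then q * g j else 0)"
      by (intro sum.cong) (auto simp: axis_def)
    then show ?thesis by simp
  qed
  have 1: "f l (momentum_flux i (c l)) = f l (0, 1) * fst (c l) $ i + (\<Sum>j\<in>UNIV. f l (axis j 1, 0) * fst (snd (snd (c l))) $ i $ j)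
      + f l (axis i 1, 0) * snd (snd (snd (snd (c l))))" if "l \<in> I" for l i
    unfolding momentum_flux_def case_prod_unfold
    by (subst linear_spacetime[OF lin[OF that]]) (simp add: distrib_right sum.distrib ax, simp add: algebra_simps)
  have 2: "f l (induction_flux i (c l)) = f l (0, 1) * fst (snd (c l)) $ i + (\<Sum>j\<in>UNIV. f l (axis j 1, 0) * fst (snd (snd (snd (c l)))) $ i $ j)"
     if "l \<in> I" for l i
    unfolding induction_flux_def case_prod_unfold
    by (subst linear_spacetime[OF lin[OF that]]) (simp add: algebra_simps)
  have 3: "f l (x, 0) = (\<Sum>j\<in>UNIV. f l (axis j 1, 0) * x $ j)" if "l \<in> I" for l x
    by (subst linear_spacetime[OF lin[OF that]]) (simp add: algebra_simps)
  show ?thesis unfolding linear_mhd_def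
  proof (intro conjI allI)
    fix i
    have "fst (\<Sum>l\<in>I. f l (0, 1) *\<^sub>R c l) $ i + (\<Sum>j\<in>UNIV. fst (snd (snd (\<Sum>l\<in>I. f l (axis j 1, 0) *\<^sub>R c l))) $ i $ j) 
         + snd (snd (snd (snd (\<Sum>l\<in>I. f l (axis i 1, 0) *\<^sub>R c l)))) 
      = (\<Sum>l\<in>I. f l (0, 1) * fst (c l) $ i) + (\<Sum>l\<in>I. \<Sum>j\<in>UNIV. f l (axis j 1, 0) * fst (snd (snd (c l))) $ i $ j)
         + (\<Sum>l\<in>I. f l (axis i 1, 0) * snd (snd (snd (snd (c l)))))"
      by (simp add: fs sum.swap[of _ I UNIV])
    also have "\<dots> = (\<Sum>l\<in>I. f l (momentum_flux i (c l)))"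
      by (simp add: 1 sum.distrib)
    finally show "fst (\<Sum>l\<in>I. f l (0, 1) *\<^sub>R c l) $ i + (\<Sum>j\<in>UNIV. fst (snd (snd (\<Sum>l\<in>I. f l (axis j 1, 0) *\<^sub>R c l))) $ i $ j) 
         + snd (snd (snd (snd (\<Sum>l\<in>I. f l (axis i 1, 0) *\<^sub>R c l)))) = 0" using U by simp
  next
    fix i
    have "fst (snd (\<Sum>l\<in>I. f l (0, 1) *\<^sub>R c l)) $ i + (\<Sum>j\<in>UNIV. fst (snd (snd (snd (\<Sum>l\<in>I. f l (axis j 1, 0) *\<^sub>R c l)))) $ i $ j) 
      = (\<Sum>l\<in>I. f l (0, 1) * fst (snd (c l)) $ i) + (\<Sum>l\<in>I. \<Sum>j\<in>UNIV. f l (axis j 1, 0) * fst (snd (snd (snd (c l)))) $ i $ j)"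
      by (simp add: fs sum.swap[of _ I UNIV])
    also have "\<dots> = (\<Sum>l\<in>I. f l (induction_flux i (c l)))"
      by (simp add: 2 sum.distrib)
    finally show "fst (snd (\<Sum>l\<in>I. f l (0, 1) *\<^sub>R c l)) $ i + (\<Sum>j\<in>UNIV. fst (snd (snd (snd (\<Sum>l\<in>I. f l (axis j 1, 0) *\<^sub>R c l)))) $ i $ j) = 0"
      using B by simp
  next
    show "(\<Sum>j\<in>UNIV. fst (\<Sum>l\<in>I. f l (axis j 1, 0) *\<^sub>R c l) $ j) = 0"
      using u by (simp add: fs 3 sum.swap[of _ I UNIV])
    show "(\<Sum>j\<in>UNIV. fst (snd (\<Sum>l\<in>I. f l (axis j 1, 0) *\<^sub>R c l)) $ j) = 0"
      using b by (simp add: fs 3 sum.swap[of _ I UNIV])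
  qed
qed

text \<open>A second-order operator with constant coefficients from scalar functions to states, given by its list of
terms \<open>D\<^sub>a D\<^sub>b \<psi> *\<^sub>R c\<close>.\<close>

definition wave_op :: "('n::finite spacetime \<times> 'n spacetime \<times> 'n state) list \<Rightarrow> ('n spacetime \<Rightarrow> real) \<Rightarrow> 'n spacetime \<Rightarrow> 'n state" where
  "wave_op L \<psi> y = (\<Sum>(a, b, c)\<leftarrow>L. dd a (dd b \<psi>) y *\<^sub>R c)"

lemma sum_nth_list: "(\<Sum>l<length L. F (L ! l)) = (\<Sum>x\<leftarrow>L. F x)"
  by (simp add: sum_list_sum_nth atLeast0LessThan)

lemma smooth_wave_op: assumes "smooth \<psi>" shows "smooth (wave_op L \<psi>)"
  unfolding wave_op_def[abs_def]
  by (induction L) (auto intro!: smooth_add smooth_scaleR smooth_dd assms simp: case_prod_unfold)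

lemma wave_op_outside: "y \<notin> fun_supp \<psi> \<Longrightarrow> wave_op L \<psi> y = 0"
  unfolding wave_op_def
proof (induction L)
  case (Cons x L)
  then have "dd a (dd b \<psi>) y = 0" for a b
    using fun_supp_dd[of "dd b \<psi>" a] fun_supp_dd[of \<psi> b] by (intro not_fun_supp) blast
  with Cons show ?case by (auto simp: case_prod_unfold)
qed simp

lemma wave_op_state:
  assumes "\<forall>(a, b, c)\<in>set L. c \<in> state_space" shows "wave_op L \<psi> y \<in> state_space"
  unfolding wave_op_def using assms
  by (induction L) (auto intro!: subspace_add subspace_scale subspace_state_space subspace_0)

lemma relaxed_wave_op:
  fixes L :: "('n::finite spacetime \<times> 'n spacetime \<times> 'n state) list"
  assumes \<psi>: "smooth \<psi>"
    and "\<And>y i. (\<Sum>(a, b, c)\<leftarrow>L. dd (momentum_flux i c) (dd a (dd b \<psi>)) y) = 0"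
    and "\<And>y i. (\<Sum>(a, b, c)\<leftarrow>L. dd (induction_flux i c) (dd a (dd b \<psi>)) y) = 0"
    and "\<And>y. (\<Sum>(a, b, c)\<leftarrow>L. dd (fst c, 0) (dd a (dd b \<psi>)) y) = 0"
    and "\<And>y. (\<Sum>(a, b, c)\<leftarrow>L. dd (fst (snd c), 0) (dd a (dd b \<psi>)) y) = 0"
  shows "relaxed_mhd (wave_op L \<psi>)"
proof -
  have w: "wave_op L \<psi> = (\<lambda>y. \<Sum>l<length L. dd (fst (L ! l)) (dd (fst (snd (L ! l))) \<psi>) y *\<^sub>R snd (snd (L ! l)))"
    by (subst sum_nth_list) (simp add: wave_op_def fun_eq_iff case_prod_unfold)
  have d: "(\<lambda>v. dd v (wave_op L \<psi>) y) = (\<lambda>v. \<Sum>l<length L. dd v (dd (fst (L ! l)) (dd (fst (snd (L ! l))) \<psi>)) y *\<^sub>R snd (snd (L ! l)))" for y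
    unfolding w
    by (rule ext, subst dd_sum) (auto intro!: smooth_scaleR smooth_dd \<psi> sum.cong dd_scaleR_const)
  note n = sum_nth_list[of "\<lambda>x. dd (F (snd (snd x))) (dd (fst x) (dd (fst (snd x)) \<psi>)) y" L for F y]
  show ?thesis
    unfolding relaxed_mhd_iff[OF smooth_wave_op[OF \<psi>]] d
    by (intro allI linear_mhd_sum dd_linear smooth_dd \<psi>; subst n)
      (use assms(2-) in \<open>simp_all add: case_prod_unfold\<close>)
qed

text \<open>The trace of the momentum flux is the part that the pressure has to carry.\<close>

definition split_trace :: "(real^'n::finite) \<times> (real^'n) \<times> (real^'n^'n) \<times> (real^'n^'n) \<Rightarrow> 'n state" where
  "split_trace = (\<lambda>(u, b, M, Q). (u, b, M - (trace M / CARD('n)) *\<^sub>R mat 1, Q, trace M / CARD('n)))"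

lemma flux_split_trace: 
  "momentum_flux i (r *\<^sub>R split_trace (u, b, M, Q)) = r *\<^sub>R (M $ i, u $ i)"
  "induction_flux i (r *\<^sub>R split_trace (u, b, M, Q)) = r *\<^sub>R (Q $ i, b $ i)"
  by (auto simp: momentum_flux_def induction_flux_def split_trace_def vec_eq_iff mat_def axis_def right_diff_distrib)

lemma trace_mat1: "trace (mat 1 :: real^'n::finite^'n) = CARD('n)"
  by (simp add: trace_def mat_def)

lemma split_trace_state:
  assumes "transpose M = M" "transpose Q = - Q" shows "split_trace (u, b, M, Q) \<in> state_space"
proof -
  have "transpose (M - r *\<^sub>R mat 1) = M - r *\<^sub>R mat 1" for r
    using transpose_linear(1)[of M "(- r) *\<^sub>R mat 1"] transpose_linear(2)[of "- r" "mat 1"] assms(1) by (simp add: transpose_mat)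
  with assms(2) show ?thesis
    by (simp add: split_trace_def state_space_def sym_tracefree_def skew_def trace_diff_matrix trace_scaleR trace_mat1)
qed

text \<open>Let \<open>\<zeta> = (s, 0)\<close>, \<open>v = (u, 1)\<close>, \<open>w = (b, 0)\<close> and let \<open>L\<^sub>v = v D\<^sub>\<zeta> - \<zeta> D\<^sub>v\<close>, a vector-valued first-order operator. It
is divergence-free because \<open>D\<^sub>v\<close> and \<open>D\<^sub>\<zeta>\<close> commute. The space-time matrices \<open>L\<^sub>v \<otimes> L\<^sub>v - L\<^sub>w \<otimes> L\<^sub>w\<close> and
\<open>L\<^sub>w \<otimes> L\<^sub>v - L\<^sub>v \<otimes> L\<^sub>w\<close>, applied to \<open>\<psi>\<close>, therefore have divergence-free rows. Their spatial blocks are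
the fluxes, in the form they have in \<open>K_point\<close>, and their last columns are \<open>u\<close> and \<open>b\<close>. The list collects the
coefficients of \<open>D\<^sub>\<zeta> D\<^sub>\<zeta>\<close>, \<open>D\<^sub>v D\<^sub>\<zeta>\<close>, \<open>D\<^sub>w D\<^sub>\<zeta>\<close>, \<open>D\<^sub>v D\<^sub>v\<close> and \<open>D\<^sub>w D\<^sub>w\<close>.\<close>

definition wave_piece :: "real^'n::finite \<Rightarrow> real^'n \<Rightarrow> real^'n \<Rightarrow> ('n spacetime \<times> 'n spacetime \<times> 'n state) list" where
  "wave_piece s u b = 
    [((s, 0), (s, 0), split_trace (K_point u b)),
     ((u, 1), (s, 0), split_trace (- s, 0, - (outer u s + outer s u), - (outer b s - outer s b))),
     ((b, 0), (s, 0), split_trace (0, - s, outer b s + outer s b, - (outer s u - outer u s))),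
     ((u, 1), (u, 1), split_trace (0, 0, outer s s, 0)),
     ((b, 0), (b, 0), split_trace (0, 0, - outer s s, 0))]"

lemma wave_piece_state: "(a, c, k) \<in> set (wave_piece s u b) \<Longrightarrow> k \<in> state_space"
  unfolding wave_piece_def K_point_def
  by (auto intro!: split_trace_state) (auto simp: transpose_def vec_eq_iff)

text \<open>\<open>G\<close> stands for the third derivative of the potential at a point, a symmetric trilinear form. All equations
hold except \<open>div u = 0\<close>, which is violated because \<open>v = (u, 1)\<close> has a time component. The error depends on
neither \<open>u\<close> nor \<open>b\<close>, so it cancels in the difference of two pieces with the same \<open>s\<close>.\<close>

lemma wave_piece_flux:
  fixes G :: "'n::finite spacetime \<Rightarrow> 'n spacetime \<Rightarrow> 'n spacetime \<Rightarrow> real"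
  assumes lin: "\<And>a b. linear (\<lambda>x. G x a b)" and sw: "\<And>a b c. G a b c = G b a c" "\<And>a b c. G a b c = G a c b"
  shows "(\<Sum>(a, c, k)\<leftarrow>wave_piece s u b. G (momentum_flux i (r *\<^sub>R k)) a c) = 0"
    "(\<Sum>(a, c, k)\<leftarrow>wave_piece s u b. G (induction_flux i (r *\<^sub>R k)) a c) = 0"
    "(\<Sum>(a, c, k)\<leftarrow>wave_piece s u b. G (fst (r *\<^sub>R k), 0) a c) = - r * G (0, 1) (s, 0) (s, 0)"
    "(\<Sum>(a, c, k)\<leftarrow>wave_piece s u b. G (fst (snd (r *\<^sub>R k)), 0) a c) = 0"
proof -
  let ?c1 = "split_trace (K_point u b)"
    and ?c2 = "split_trace (- s, 0, - (outer u s + outer s u), - (outer b s - outer s b))"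
    and ?c3 = "split_trace (0, - s, outer b s + outer s b, - (outer s u - outer u s))"
    and ?c4 = "split_trace (0, 0, outer s s, 0)"
    and ?c5 = "split_trace (0, 0, - outer s s, 0)"
  let ?z = "(s, 0) :: 'n spacetime" and ?v = "(u, 1) :: 'n spacetime" and ?w = "(b, 0) :: 'n spacetime"
  note L = linear_add[OF lin] linear_diff[OF lin] linear_scale[OF lin] linear_neg[OF lin] linear_0[OF lin]
  have U: "momentum_flux i (r *\<^sub>R ?c1) = r *\<^sub>R (u $ i *\<^sub>R ?v - b $ i *\<^sub>R ?w)"
    "momentum_flux i (r *\<^sub>R ?c2) = r *\<^sub>R (- (u $ i *\<^sub>R ?z) - s $ i *\<^sub>R ?v)"
    "momentum_flux i (r *\<^sub>R ?c3) = r *\<^sub>R (b $ i *\<^sub>R ?z + s $ i *\<^sub>R ?w)"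
    "momentum_flux i (r *\<^sub>R ?c4) = r *\<^sub>R (s $ i *\<^sub>R ?z)"
    "momentum_flux i (r *\<^sub>R ?c5) = r *\<^sub>R (- (s $ i *\<^sub>R ?z))" for r
    unfolding K_point_def flux_split_trace by (auto simp: outer_row)
  have B: "induction_flux i (r *\<^sub>R ?c1) = r *\<^sub>R (b $ i *\<^sub>R ?v - u $ i *\<^sub>R ?w)"
    "induction_flux i (r *\<^sub>R ?c2) = r *\<^sub>R (s $ i *\<^sub>R ?w - b $ i *\<^sub>R ?z)"
    "induction_flux i (r *\<^sub>R ?c3) = r *\<^sub>R (u $ i *\<^sub>R ?z - s $ i *\<^sub>R ?v)"
    "induction_flux i (r *\<^sub>R ?c4) = 0"
    "induction_flux i (r *\<^sub>R ?c5) = 0" for r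
    unfolding K_point_def flux_split_trace by (auto simp: outer_row zero_prod_def)
  have 3: "(fst (r *\<^sub>R ?c1), 0) = r *\<^sub>R (?v - (0, 1))"
    "(fst (r *\<^sub>R ?c2), 0) = r *\<^sub>R (- ?z)"
    "(fst (r *\<^sub>R ?c3), 0) = 0"
    "(fst (r *\<^sub>R ?c4), 0) = 0"
    "(fst (r *\<^sub>R ?c5), 0) = 0"
    by (auto simp: split_trace_def K_point_def zero_prod_def)
  have 4: "(fst (snd (r *\<^sub>R ?c1)), 0) = r *\<^sub>R ?w"
    "(fst (snd (r *\<^sub>R ?c2)), 0) = 0"
    "(fst (snd (r *\<^sub>R ?c3)), 0) = r *\<^sub>R (- ?z)"
    "(fst (snd (r *\<^sub>R ?c4)), 0) = 0"
    "(fst (snd (r *\<^sub>R ?c5)), 0) = 0"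
    by (auto simp: split_trace_def K_point_def zero_prod_def)
  have g: "G ?z ?v ?z = G ?v ?z ?z" "G ?z ?w ?z = G ?w ?z ?z" "G ?v ?v ?z = G ?z ?v ?v" "G ?w ?w ?z = G ?z ?w ?w"
    "G ?w ?v ?z = G ?v ?w ?z" using sw by metis+
  show "(\<Sum>(a, c, k)\<leftarrow>wave_piece s u b. G (momentum_flux i (r *\<^sub>R k)) a c) = 0"
    by (simp only: wave_piece_def list.map sum_list.Cons sum_list.Nil prod.case U L real_scaleR_def g; simp add: algebra_simps)
  show "(\<Sum>(a, c, k)\<leftarrow>wave_piece s u b. G (induction_flux i (r *\<^sub>R k)) a c) = 0"
    by (simp only: wave_piece_def list.map sum_list.Cons sum_list.Nil prod.case B L real_scaleR_def g; simp add: algebra_simps)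
  show "(\<Sum>(a, c, k)\<leftarrow>wave_piece s u b. G (fst (r *\<^sub>R k), 0) a c) = - r * G (0, 1) (s, 0) (s, 0)"
    by (simp only: wave_piece_def list.map sum_list.Cons sum_list.Nil prod.case 3 L real_scaleR_def g; simp add: algebra_simps)
  show "(\<Sum>(a, c, k)\<leftarrow>wave_piece s u b. G (fst (snd (r *\<^sub>R k)), 0) a c) = 0"
    by (simp only: wave_piece_def list.map sum_list.Cons sum_list.Nil prod.case 4 L real_scaleR_def g; simp add: algebra_simps)
qed

text \<open>The wave vector is \<open>\<eta> = (x, - u\<^sub>1 \<bullet> x)\<close> with \<open>x \<noteq> 0\<close> orthogonal to \<open>u\<^sub>1 - u\<^sub>2\<close>, \<open>b\<^sub>1 - b\<^sub>2\<close> and \<open>b\<^sub>1\<close>; three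
conditions leave such an \<open>x\<close> when \<open>n \<ge> 4\<close>. Then \<open>\<eta>\<close> is orthogonal to all four vectors \<open>(u\<^sub>i, 1)\<close> and
\<open>(b\<^sub>i, 0)\<close>, and with \<open>s = x / |x|\<^sup>2\<close> it has inner product \<open>1\<close> with \<open>(s, 0)\<close>. So at frequency \<open>\<eta>\<close> only the first
term of each piece survives, and this term is the point of \<open>Kset\<close>.\<close>

lemma wave_exists:
  fixes u1 b1 u2 b2 :: "real^'n::finite"
  assumes n: "CARD('n) \<ge> 4" and "norm u1 = 1" "norm b1 = 1" "norm u2 = 1" "norm b2 = 1"
  obtains \<eta> L where "\<eta> \<noteq> 0" "\<forall>(a, b, c)\<in>set L. c \<in> state_space" "\<And>\<psi>. smooth \<psi> \<Longrightarrow> relaxed_mhd (wave_op L \<psi>)"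
    "(\<Sum>(a, b, c)\<leftarrow>L. ((a \<bullet> \<eta>) * (b \<bullet> \<eta>)) *\<^sub>R c) = l *\<^sub>R pressureless (K_point u1 b1 - K_point u2 b2)"
proof -
  have "dim {u1 - u2, b1 - b2, b1} \<le> card {u1 - u2, b1 - b2, b1}" by (intro dim_le_card') simp
  also have "\<dots> \<le> 3" by (intro card_insert_le_m1) auto
  also have "3 < DIM(real^'n)" using n by simp
  finally obtain x where x: "x \<noteq> 0" "\<And>y. y \<in> span {u1 - u2, b1 - b2, b1} \<Longrightarrow> orthogonal x y"
    using orthogonal_to_subspace_exists by blast
  have "orthogonal x (u1 - u2)" "orthogonal x (b1 - b2)" "orthogonal x b1"
    by (intro x(2) span_base; simp)+
  then have o: "u2 \<bullet> x = u1 \<bullet> x" "b1 \<bullet> x = 0" "b2 \<bullet> x = 0"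
    by (auto simp: orthogonal_def inner_diff_right inner_commute)
  define \<eta> where "\<eta> = (x, - (u1 \<bullet> x))"
  define s where "s = x /\<^sub>R (x \<bullet> x)"
  define L where "L = map (\<lambda>(a, b, c). (a, b, l *\<^sub>R c)) (wave_piece s u1 b1) @ map (\<lambda>(a, b, c). (a, b, (- l) *\<^sub>R c)) (wave_piece s u2 b2)"
  have m: "(\<Sum>(a, b, c)\<leftarrow>map (\<lambda>(a, b, c). (a, b, l *\<^sub>R c)) xs. F a b c) = (\<Sum>(a, b, c)\<leftarrow>xs. F a b (l *\<^sub>R c))" 
    for xs :: "('n spacetime \<times> 'n spacetime \<times> 'n state) list" and F :: "'n spacetime \<Rightarrow> 'n spacetime \<Rightarrow> 'n state \<Rightarrow> 'q::monoid_add" and l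
    by (simp add: case_prod_unfold o_def)
  show ?thesis
  proof (rule that)
    show "\<eta> \<noteq> 0" using x by (simp add: \<eta>_def zero_prod_def)
    show "\<forall>(a, b, c)\<in>set L. c \<in> state_space"
    proof -
      have w: "r *\<^sub>R snd (snd x) \<in> state_space" if "x \<in> set (wave_piece s u b)" for x u b r
        using wave_piece_state[of "fst x" "fst (snd x)" "snd (snd x)"] that
        by (intro subspace_scale[OF subspace_state_space]) simp
      show ?thesis
        unfolding L_def set_append set_map ball_Un ball_simps case_prod_unfold fst_conv snd_conv
        using w by blast
    qed
    show "relaxed_mhd (wave_op L \<psi>)" if \<psi>: "smooth \<psi>" for \<psi>
    proof -
      have sw: "dd a (dd b \<psi>) = dd b (dd a \<psi>)" for a b
        by (intro ext dd_commute_real \<psi>)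
      have sw2: "dd a (dd b (dd c \<psi>)) y = dd b (dd a (dd c \<psi>)) y" for a b c y
        by (intro dd_commute_real smooth_dd \<psi>)
      note wp = wave_piece_flux[of "\<lambda>a b c. dd a (dd b (dd c \<psi>)) y" for y, OF dd_linear[OF smooth_dd[OF smooth_dd[OF \<psi>]]] sw2]
      have sw3: "dd a (dd b (dd c \<psi>)) y = dd a (dd c (dd b \<psi>)) y" for a b c y
        by (simp only: sw[of b c])
      note wp' = wp[OF sw3]
      show ?thesis
        unfolding L_def
        by (intro relaxed_wave_op \<psi>; simp only: map_append sum_list_append m wp'; simp)
    qed
    have xx: "x \<bullet> x \<noteq> 0" using x by simp
    have z: "(s, 0) \<bullet> \<eta> = 1" "(u1, 1) \<bullet> \<eta> = 0" "(u2, 1) \<bullet> \<eta> = 0" "(b1, 0) \<bullet> \<eta> = 0" "(b2, 0) \<bullet> \<eta> = 0"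
      using xx by (auto simp: \<eta>_def s_def o)
    have t: "split_trace (K_point u b) = pressureless (K_point u b)" if "norm u = 1" "norm b = 1" for u b :: "real^'n"
      using that by (simp add: split_trace_def K_point_def pressureless_def trace_diff_matrix trace_outer norm_eq_1)
    have e: "pressureless (a - b) = pressureless a - pressureless b" for a b :: "(real^'n) \<times> (real^'n) \<times> (real^'n^'n) \<times> (real^'n^'n)"
      by (cases a; cases b) (simp add: pressureless_def)
    show "(\<Sum>(a, b, c)\<leftarrow>L. ((a \<bullet> \<eta>) * (b \<bullet> \<eta>)) *\<^sub>R c) = l *\<^sub>R pressureless (K_point u1 b1 - K_point u2 b2)"
      unfolding L_def map_append sum_list_append m
      by (simp add: wave_piece_def z t assms e scaleR_diff_right)
  qed
qed

section \<open>Localised plane waves\<close>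

text \<open>The factor \<open>- 1 / N\<^sup>2\<close> is undone by the two derivatives of \<open>wave_op\<close>.\<close>

definition plane_potential :: "('a::euclidean_space \<Rightarrow> real) \<Rightarrow> 'a \<Rightarrow> real \<Rightarrow> 'a \<Rightarrow> real" where
  "plane_potential \<phi> \<eta> N y = - \<phi> y * cos (N * (\<eta> \<bullet> y)) / N\<^sup>2"

lemma smooth_plane_potential: assumes "smooth \<phi>" shows "smooth (plane_potential \<phi> \<eta> N)"
proof -
  have "smooth (\<lambda>y. (\<phi> y * cos (N * (\<eta> \<bullet> y))) * (- 1 / N\<^sup>2))"
    by (intro smooth_mult assms smooth_compose_real[OF smooth_cos] smooth_const smooth_bilinear[OF bounded_bilinear_inner] smooth_ident)
  then show ?thesis by (simp add: plane_potential_def[abs_def])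
qed

lemma hessian_plane_potential:
  fixes \<phi> :: "'a::euclidean_space \<Rightarrow> real"
  assumes \<phi>: "smooth \<phi>" and N: "N > 0"
  shows "dd a (dd b (plane_potential \<phi> \<eta> N)) y = (a \<bullet> \<eta>) * (b \<bullet> \<eta>) * (\<phi> y * cos (N * (\<eta> \<bullet> y)))
     + (((b \<bullet> \<eta>) * dd a \<phi> y + (a \<bullet> \<eta>) * dd b \<phi> y) * sin (N * (\<eta> \<bullet> y)) - dd a (dd b \<phi>) y * cos (N * (\<eta> \<bullet> y)) / N) / N"
proof -
  note d [derivative_intros] = smooth_has_derivative[OF \<phi>] smooth_has_derivative[OF smooth_dd[OF \<phi>]]
  have b: "dd b (plane_potential \<phi> \<eta> N) = (\<lambda>y. \<phi> y * (b \<bullet> \<eta>) * sin (N * (\<eta> \<bullet> y)) / N - dd b \<phi> y * cos (N * (\<eta> \<bullet> y)) / N\<^sup>2)"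
  proof (intro ext dd_eq)
    fix y
    have "((\<lambda>y. \<phi> y * cos (N * (\<eta> \<bullet> y)) * (- 1 / N\<^sup>2)) has_derivative
        (\<lambda>b. (\<phi> y * (- sin (N * (\<eta> \<bullet> y)) * (N * (\<eta> \<bullet> b))) + dd b \<phi> y * cos (N * (\<eta> \<bullet> y))) * (- 1 / N\<^sup>2))) (at y)"
      by (intro has_derivative_mult_left) (auto intro!: derivative_eq_intros simp: algebra_simps)
    moreover have "(\<lambda>y. \<phi> y * cos (N * (\<eta> \<bullet> y)) * (- 1 / N\<^sup>2)) = plane_potential \<phi> \<eta> N"
      by (simp add: plane_potential_def fun_eq_iff)
    moreover have "(\<lambda>b. (\<phi> y * (- sin (N * (\<eta> \<bullet> y)) * (N * (\<eta> \<bullet> b))) + dd b \<phi> y * cos (N * (\<eta> \<bullet> y))) * (- 1 / N\<^sup>2)) = 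
       (\<lambda>b. \<phi> y * (b \<bullet> \<eta>) * sin (N * (\<eta> \<bullet> y)) / N - dd b \<phi> y * cos (N * (\<eta> \<bullet> y)) / N\<^sup>2)"
      using N by (simp add: fun_eq_iff divide_simps power2_eq_square inner_commute)
    ultimately show "(plane_potential \<phi> \<eta> N has_derivative (\<lambda>b. \<phi> y * (b \<bullet> \<eta>) * sin (N * (\<eta> \<bullet> y)) / N - dd b \<phi> y * cos (N * (\<eta> \<bullet> y)) / N\<^sup>2)) (at y)"
      by simp
  qed
  have "((\<lambda>y. \<phi> y * (b \<bullet> \<eta>) * sin (N * (\<eta> \<bullet> y)) * (1 / N) - dd b \<phi> y * cos (N * (\<eta> \<bullet> y)) * (1 / N\<^sup>2)) has_derivative
    (\<lambda>a. (dd a \<phi> y * (b \<bullet> \<eta>) * sin (N * (\<eta> \<bullet> y)) + \<phi> y * (b \<bullet> \<eta>) * (cos (N * (\<eta> \<bullet> y)) * (N * (\<eta> \<bullet> a)))) * (1 / N)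
      - (dd a (dd b \<phi>) y * cos (N * (\<eta> \<bullet> y)) - dd b \<phi> y * (sin (N * (\<eta> \<bullet> y)) * (N * (\<eta> \<bullet> a)))) * (1 / N\<^sup>2))) (at y)"
    by (intro has_derivative_diff has_derivative_mult_left) (auto intro!: derivative_eq_intros simp: algebra_simps)
  from dd_eq[OF this, of a] show ?thesis
    unfolding b using N by (simp add: divide_simps power2_eq_square inner_commute, simp add: algebra_simps)
qed

text \<open>Whenever a derivative falls on \<open>\<phi>\<close> instead of the cosine, a factor \<open>1 / N\<close> remains.\<close>

lemma plane_wave_error:
  fixes \<phi> :: "'n::finite spacetime \<Rightarrow> real"
  assumes \<phi>: "\<phi> \<in> Cc_infty"
  obtains C where "C > 0" "\<And>N y. N \<ge> 1 \<Longrightarrow> norm (wave_op L (plane_potential \<phi> \<eta> N) y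
      - (\<phi> y * cos (N * (\<eta> \<bullet> y))) *\<^sub>R (\<Sum>(a, b, c)\<leftarrow>L. ((a \<bullet> \<eta>) * (b \<bullet> \<eta>)) *\<^sub>R c)) \<le> C / N"
proof -
  have sm: "smooth \<phi>" using \<phi> by (simp add: Cc_infty_def)
  have one: "\<exists>C>0. \<forall>N\<ge>1. \<forall>y. \<bar>dd a (dd b (plane_potential \<phi> \<eta> N)) y - (a \<bullet> \<eta>) * (b \<bullet> \<eta>) * (\<phi> y * cos (N * (\<eta> \<bullet> y)))\<bar> \<le> C / N" for a b
  proof -
    obtain A where A: "A > 0" "\<And>y. norm (dd a \<phi> y) \<le> A" using compact_support_bounded[OF Cc_infty_dd[OF \<phi>]] by blast
    obtain B where B: "B > 0" "\<And>y. norm (dd b \<phi> y) \<le> B" using compact_support_bounded[OF Cc_infty_dd[OF \<phi>]] by blast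
    obtain D where D: "D > 0" "\<And>y. norm (dd a (dd b \<phi>) y) \<le> D" using compact_support_bounded[OF Cc_infty_dd[OF Cc_infty_dd[OF \<phi>]]] by blast
    define C where "C = \<bar>b \<bullet> \<eta>\<bar> * A + \<bar>a \<bullet> \<eta>\<bar> * B + D"
    have "\<bar>dd a (dd b (plane_potential \<phi> \<eta> N)) y - (a \<bullet> \<eta>) * (b \<bullet> \<eta>) * (\<phi> y * cos (N * (\<eta> \<bullet> y)))\<bar> \<le> C / N" if N: "N \<ge> 1" for N y
    proof -
      let ?s = "sin (N * (\<eta> \<bullet> y))" and ?c = "cos (N * (\<eta> \<bullet> y))"
      have 1: "\<bar>(b \<bullet> \<eta>) * dd a \<phi> y\<bar> \<le> \<bar>b \<bullet> \<eta>\<bar> * A" "\<bar>(a \<bullet> \<eta>) * dd b \<phi> y\<bar> \<le> \<bar>a \<bullet> \<eta>\<bar> * B"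
        using A(2)[of y] B(2)[of y] by (auto simp: abs_mult intro!: mult_left_mono)
      have "\<bar>((b \<bullet> \<eta>) * dd a \<phi> y + (a \<bullet> \<eta>) * dd b \<phi> y) * ?s\<bar> \<le> \<bar>(b \<bullet> \<eta>) * dd a \<phi> y + (a \<bullet> \<eta>) * dd b \<phi> y\<bar> * 1"
        unfolding abs_mult by (intro mult_left_mono) auto
      moreover have "\<bar>dd a (dd b \<phi>) y * ?c / N\<bar> \<le> D"
      proof -
        have "\<bar>dd a (dd b \<phi>) y * ?c / N\<bar> = \<bar>dd a (dd b \<phi>) y\<bar> * (\<bar>?c\<bar> / N)" using N by (simp add: abs_mult)
        also have "\<dots> \<le> D * 1" using D(1) D(2)[of y] N by (intro mult_mono) (auto simp: divide_le_eq intro: order_trans[OF abs_cos_le_one])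
        finally show ?thesis by simp
      qed
      moreover have "\<bar>(b \<bullet> \<eta>) * dd a \<phi> y + (a \<bullet> \<eta>) * dd b \<phi> y\<bar> * 1 \<le> \<bar>b \<bullet> \<eta>\<bar> * A + \<bar>a \<bullet> \<eta>\<bar> * B"
        using order_trans[OF abs_triangle_ineq add_mono[OF 1]] by simp
      ultimately have "\<bar>((b \<bullet> \<eta>) * dd a \<phi> y + (a \<bullet> \<eta>) * dd b \<phi> y) * ?s - dd a (dd b \<phi>) y * ?c / N\<bar> \<le> C"
        unfolding C_def by (intro order_trans[OF abs_triangle_ineq4] add_mono) (rule order_trans)
      then show ?thesis
        using N by (subst hessian_plane_potential[OF sm]) (auto intro!: divide_right_mono)
    qed
    moreover have "C > 0" using A B D by (auto simp: C_def intro!: add_nonneg_pos)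
    ultimately show ?thesis by blast
  qed
  have "\<exists>C>0. \<forall>N\<ge>1. \<forall>y. norm (wave_op L (plane_potential \<phi> \<eta> N) y
      - (\<phi> y * cos (N * (\<eta> \<bullet> y))) *\<^sub>R (\<Sum>(a, b, c)\<leftarrow>L. ((a \<bullet> \<eta>) * (b \<bullet> \<eta>)) *\<^sub>R c)) \<le> C / N"
  proof (induction L)
    case Nil
    show ?case by (auto simp: wave_op_def intro!: exI[of _ 1])
  next
    case (Cons x L)
    obtain a b c where x: "x = (a, b, c)" by (cases x)
    obtain C where C: "C > 0" "\<And>N y. N \<ge> 1 \<Longrightarrow> norm (wave_op L (plane_potential \<phi> \<eta> N) y
      - (\<phi> y * cos (N * (\<eta> \<bullet> y))) *\<^sub>R (\<Sum>(a, b, c)\<leftarrow>L. ((a \<bullet> \<eta>) * (b \<bullet> \<eta>)) *\<^sub>R c)) \<le> C / N"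
      using Cons by blast
    obtain D where D: "D > 0" "\<And>N y. N \<ge> 1 \<Longrightarrow> \<bar>dd a (dd b (plane_potential \<phi> \<eta> N)) y - (a \<bullet> \<eta>) * (b \<bullet> \<eta>) * (\<phi> y * cos (N * (\<eta> \<bullet> y)))\<bar> \<le> D / N"
      using one by blast
    have "norm (wave_op (x # L) (plane_potential \<phi> \<eta> N) y
      - (\<phi> y * cos (N * (\<eta> \<bullet> y))) *\<^sub>R (\<Sum>(a, b, c)\<leftarrow>x # L. ((a \<bullet> \<eta>) * (b \<bullet> \<eta>)) *\<^sub>R c)) \<le> (C + D * norm c) / N" if N: "N \<ge> 1" for N y
    proof -
      have "wave_op (x # L) (plane_potential \<phi> \<eta> N) y
        - (\<phi> y * cos (N * (\<eta> \<bullet> y))) *\<^sub>R (\<Sum>(a, b, c)\<leftarrow>x # L. ((a \<bullet> \<eta>) * (b \<bullet> \<eta>)) *\<^sub>R c) =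
        (wave_op L (plane_potential \<phi> \<eta> N) y - (\<phi> y * cos (N * (\<eta> \<bullet> y))) *\<^sub>R (\<Sum>(a, b, c)\<leftarrow>L. ((a \<bullet> \<eta>) * (b \<bullet> \<eta>)) *\<^sub>R c))
        + (dd a (dd b (plane_potential \<phi> \<eta> N)) y - (a \<bullet> \<eta>) * (b \<bullet> \<eta>) * (\<phi> y * cos (N * (\<eta> \<bullet> y)))) *\<^sub>R c"
        by (simp add: wave_op_def x scaleR_add_right scaleR_diff_left mult_ac)
      also have "norm \<dots> \<le> C / N + (D / N) * norm c"
        by (intro norm_triangle_mono C N) (use mult_right_mono[OF D(2)[OF N, of y] norm_ge_zero[of c]] in simp)
      finally show ?thesis by (simp add: add_divide_distrib)
    qed
    moreover have "C + D * norm c > 0" using C D by (simp add: add_pos_nonneg)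
    ultimately show ?case by blast
  qed
  then show ?thesis using that by blast
qed

lemma measure_half_cball: 
  fixes c :: "'a::euclidean_space"
  assumes "r \<ge> 0" shows "measure lebesgue (cball c (r / 2)) = measure lebesgue (cball c r) / 2 ^ DIM('a)"
  using assms by (simp add: content_cball power_divide)

lemma Cc_infty_integrable:
  fixes f :: "'a::euclidean_space \<Rightarrow> 'b::euclidean_space"
  assumes "f \<in> Cc_infty" shows "integrable lebesgue f" "f \<in> borel_measurable lebesgue"
proof -
  show m: "f \<in> borel_measurable lebesgue"
    using assms by (intro measurable_completion) (auto simp: Cc_infty_def intro!: borel_measurable_continuous_onI smooth_continuous)
  obtain C where "\<And>y. norm (f y) \<le> C" using compact_support_bounded[OF assms] by blast
  then show "integrable lebesgue f"
    using assms by (intro integrable_bounded_support[OF m, of "fun_supp f"])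
      (auto simp: Cc_infty_def not_fun_supp compact_imp_bounded)
qed

lemma integrable_inner_bounded:
  fixes f g :: "'a::euclidean_space \<Rightarrow> 'b::euclidean_space"
  assumes f: "f \<in> borel_measurable lebesgue" "\<And>y. norm (f y) \<le> C" and g: "integrable lebesgue g"
  shows "integrable lebesgue (\<lambda>y. f y \<bullet> g y)"
proof (rule Bochner_Integration.integrable_bound)
  show "integrable lebesgue (\<lambda>y. C * norm (g y))" using g by simp
  have "\<bar>f y \<bullet> g y\<bar> \<le> \<bar>C * norm (g y)\<bar>" for y
    using order_trans[OF Cauchy_Schwarz_ineq2 mult_right_mono[OF f(2)]] by (metis abs_ge_self norm_ge_zero order_trans)
  then show "AE y in lebesgue. norm (f y \<bullet> g y) \<le> norm (C * norm (g y))" by simp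
qed (use f g in \<open>auto intro!: borel_measurable_inner simp: borel_measurable_integrable\<close>)

text \<open>A lower bound, per unit of amplitude and of volume of the ball, for the \<open>L\<^sup>1\<close> norm of a localised wave:
the bump is at least \<open>exp (- 4 / 3)\<close> on the half ball, whose share of the volume is \<open>1 / 2 ^ DIM\<close>, the mean
of the squared cosine is \<open>1 / 2\<close>, and another factor \<open>1 / 2\<close> absorbs the errors.\<close>

definition wave_gain :: "'n::finite itself \<Rightarrow> real" where
  "wave_gain _ = exp (- 4 / 3) / (4 * 2 ^ DIM('n spacetime))"

text \<open>Up to a uniform error of order \<open>1 / N\<close>, \<open>P N\<close> is \<open>\<phi> y * cos (N * (\<eta> \<bullet> y)) *\<^sub>R w\<close> with a bump function \<open>\<phi>\<close>. So
it moves \<open>z y\<close> along the segment in direction \<open>w\<close>, it is weakly small by the Riemann-Lebesgue lemma, and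
its \<open>L\<^sup>1\<close> norm is bounded below because \<open>|cos|\<close> dominates \<open>cos\<^sup>2\<close>, whose mean is \<open>1 / 2\<close>.\<close>

lemma local_wave:
  fixes z :: "'n::finite spacetime \<Rightarrow> 'n state"
  assumes n: "CARD('n) \<ge> 4" and nrm: "norm u1 = 1" "norm b1 = 1" "norm u2 = 1" "norm b2 = 1"
    and w: "w = l *\<^sub>R pressureless (K_point u1 b1 - K_point u2 b2)" "w \<noteq> 0"
    and z: "continuous_on (cball y0 r) z" and r: "r > 0"
    and U: "\<And>y s. y \<in> cball y0 r \<Longrightarrow> \<bar>s\<bar> \<le> 1 \<Longrightarrow> z y + s *\<^sub>R w \<in> Uset"
  obtains P where "\<And>N. smooth (P N)" "\<And>N. relaxed_mhd (P N)" "\<And>N y. y \<notin> cball y0 r \<Longrightarrow> P N y = 0"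
    "\<And>N y. P N y \<in> state_space"
    "eventually (\<lambda>N. \<forall>y\<in>cball y0 r. z y + P N y \<in> Uset) sequentially"
    "\<And>g. integrable lebesgue g \<Longrightarrow> (\<lambda>N. LINT y|lebesgue. P N y \<bullet> g y) \<longlonglongrightarrow> 0"
    "eventually (\<lambda>N. (LINT y|lebesgue. norm (P N y)) \<ge> wave_gain TYPE('n) * norm w * measure lebesgue (cball y0 r)) sequentially"
proof -
  obtain \<eta> L where \<eta>: "\<eta> \<noteq> 0" and L: "\<forall>(a, b, c)\<in>set L. c \<in> state_space" 
    "\<And>\<psi>. smooth \<psi> \<Longrightarrow> relaxed_mhd (wave_op L \<psi>)"
    "(\<Sum>(a, b, c)\<leftarrow>L. ((a \<bullet> \<eta>) * (b \<bullet> \<eta>)) *\<^sub>R c) = w"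
    unfolding w(1) using wave_exists[OF n nrm] by metis
  define \<phi> where "\<phi> = bump y0 r"
  have \<phi>c: "\<phi> \<in> Cc_infty"
    by (rule Cc_inftyI[of _ "cball y0 r"]) (auto simp: \<phi>_def smooth_bump bump_outside r simp del: mem_cball)
  have \<phi>s: "smooth \<phi>" by (simp add: \<phi>_def smooth_bump)
  have \<phi>b: "0 \<le> \<phi> y" "\<phi> y \<le> 1" for y by (auto simp: \<phi>_def bump_nonneg bump_le_1)
  define P where "P N = wave_op L (plane_potential \<phi> \<eta> (real N))" for N :: nat
  define \<theta> where "\<theta> N y = \<phi> y * cos (real N * (\<eta> \<bullet> y))" for N y
  have \<theta>b: "\<bar>\<theta> N y\<bar> \<le> 1" for N y
    unfolding \<theta>_def abs_mult using \<phi>b[of y] by (intro mult_le_one) auto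
  obtain C where C: "C > 0" "\<And>N y. N \<ge> 1 \<Longrightarrow> norm (P N y - \<theta> N y *\<^sub>R w) \<le> C / real N"
    using plane_wave_error[OF \<phi>c, of L \<eta>, unfolded L(3)] unfolding P_def \<theta>_def
    by (metis of_nat_1 of_nat_le_iff)
  have C0: "(\<lambda>N. C / real N) \<longlonglongrightarrow> 0" by (rule lim_const_over_n)
  have Psm: "smooth (P N)" for N unfolding P_def by (intro smooth_wave_op smooth_plane_potential \<phi>s)
  have Pout: "P N y = 0" if "y \<notin> cball y0 r" for N y
  proof -
    have "fun_supp (plane_potential \<phi> \<eta> (real N)) \<subseteq> cball y0 r"
      by (subst fun_supp_subset_iff) (auto simp: plane_potential_def \<phi>_def bump_outside r simp del: mem_cball)
    then show ?thesis using that unfolding P_def by (intro wave_op_outside) blast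
  qed
  have Pst: "P N y \<in> state_space" for N y unfolding P_def by (rule wave_op_state[OF L(1)])
  have PC: "P N \<in> Cc_infty" for N by (rule Cc_inftyI[OF Psm compact_cball Pout])
  have ws: "w \<in> state_space"
    unfolding L(3)[symmetric] using L(1)
    by (induction L) (auto intro!: subspace_add subspace_scale subspace_state_space subspace_0)
  define S where "S = (\<lambda>(y, s). z y + s *\<^sub>R w) ` (cball y0 r \<times> {-1..1})"
  have "compact S"
    unfolding S_def case_prod_unfold
    by (intro compact_continuous_image compact_Times compact_cball compact_Icc continuous_intros continuous_on_compose2[OF z]) auto
  moreover have "S \<subseteq> Uset" unfolding S_def using U by auto
  ultimately obtain e where e: "e > 0" "\<And>z p. z \<in> S \<Longrightarrow> p \<in> state_space \<Longrightarrow> norm p < e \<Longrightarrow> z + p \<in> Uset"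
    using Uset_margin by blast
  have 5: "eventually (\<lambda>N. \<forall>y\<in>cball y0 r. z y + P N y \<in> Uset) sequentially"
    using order_tendstoD(2)[OF C0 e(1)] eventually_ge_at_top[of 1]
  proof eventually_elim
    case (elim N)
    show ?case
    proof
      fix y assume y: "y \<in> cball y0 r"
      have "z y + \<theta> N y *\<^sub>R w \<in> S" unfolding S_def using y \<theta>b[of N y] by (auto simp: abs_le_iff intro!: image_eqI[of _ _ "(y, \<theta> N y)"])
      moreover have "P N y - \<theta> N y *\<^sub>R w \<in> state_space"
        using Pst ws by (intro subspace_diff subspace_scale subspace_state_space)
      moreover have "norm (P N y - \<theta> N y *\<^sub>R w) < e" using C(2)[of N y] elim by linarith
      ultimately have "(z y + \<theta> N y *\<^sub>R w) + (P N y - \<theta> N y *\<^sub>R w) \<in> Uset" by (rule e(2))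
      then show "z y + P N y \<in> Uset" by simp
    qed
  qed
  have \<phi>m: "\<phi> \<in> borel_measurable lebesgue" and \<phi>i: "integrable lebesgue \<phi>" using Cc_infty_integrable[OF \<phi>c] by auto
  have cm: "(\<lambda>y. cos (real N * (k \<bullet> y))) \<in> borel_measurable lebesgue" for N and k :: "'n spacetime"
    by (rule measurable_completion) (auto intro!: borel_measurable_continuous_onI continuous_intros)
  have \<theta>m: "\<theta> N \<in> borel_measurable lebesgue" for N unfolding \<theta>_def using \<phi>m cm by (intro borel_measurable_times)
  have 6: "(\<lambda>N. LINT y|lebesgue. P N y \<bullet> g y) \<longlonglongrightarrow> 0" if g: "integrable lebesgue g" for g
  proof -
    have "integrable lebesgue (\<lambda>y. (\<phi> y *\<^sub>R w) \<bullet> g y)"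
      by (rule integrable_inner_bounded[of _ "norm w"]) (use \<phi>m \<phi>b g in \<open>auto intro!: mult_left_le_one_le\<close>)
    from riemann_lebesgue[OF this \<eta>]
    have A: "(\<lambda>N. LINT y|lebesgue. (\<theta> N y *\<^sub>R w) \<bullet> g y) \<longlonglongrightarrow> 0"
      by (simp add: \<theta>_def mult_ac)
    have i1: "integrable lebesgue (\<lambda>y. (\<theta> N y *\<^sub>R w) \<bullet> g y)" for N
      by (rule integrable_inner_bounded[of _ "norm w"]) (use \<theta>m \<theta>b g in \<open>auto intro!: mult_left_le_one_le\<close>)
    have i2: "integrable lebesgue (\<lambda>y. P N y \<bullet> g y)" for N
    proof -
      obtain B where "\<And>y. norm (P N y) \<le> B" using compact_support_bounded[OF PC[of N]] by blast
      then show ?thesis by (rule integrable_inner_bounded[OF Cc_infty_integrable(2)[OF PC] _ g])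
    qed
    have B: "(\<lambda>N. (LINT y|lebesgue. P N y \<bullet> g y) - (LINT y|lebesgue. (\<theta> N y *\<^sub>R w) \<bullet> g y)) \<longlonglongrightarrow> 0"
    proof (rule Lim_null_comparison)
      show "(\<lambda>N. C / real N * (LINT y|lebesgue. norm (g y))) \<longlonglongrightarrow> 0"
        using tendsto_mult_left_zero[OF C0] by simp
      show "eventually (\<lambda>N. norm ((LINT y|lebesgue. P N y \<bullet> g y) - (LINT y|lebesgue. (\<theta> N y *\<^sub>R w) \<bullet> g y)) \<le> C / real N * (LINT y|lebesgue. norm (g y))) sequentially"
        using eventually_ge_at_top[of 1]
      proof eventually_elim
        case (elim N)
        have "norm ((LINT y|lebesgue. P N y \<bullet> g y) - (LINT y|lebesgue. (\<theta> N y *\<^sub>R w) \<bullet> g y)) 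
          = norm (LINT y|lebesgue. (P N y - \<theta> N y *\<^sub>R w) \<bullet> g y)"
          using i1 i2 by (simp add: inner_diff_left Bochner_Integration.integral_diff)
        also have "\<dots> \<le> (LINT y|lebesgue. norm ((P N y - \<theta> N y *\<^sub>R w) \<bullet> g y))" by (rule integral_norm_bound)
        also have "\<dots> \<le> (LINT y|lebesgue. C / real N * norm (g y))"
        proof (rule integral_mono)
          show "integrable lebesgue (\<lambda>y. norm ((P N y - \<theta> N y *\<^sub>R w) \<bullet> g y))"
            using i1 i2 by (simp add: inner_diff_left)
          show "norm ((P N y - \<theta> N y *\<^sub>R w) \<bullet> g y) \<le> C / real N * norm (g y)" for y
            using order_trans[OF Cauchy_Schwarz_ineq2 mult_right_mono[OF C(2)[OF elim, of y]]] by simp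
        qed (use g in simp)
        finally show ?case by simp
      qed
    qed
    show ?thesis using tendsto_add[OF A B] by simp
  qed
  define m where "m = measure lebesgue (cball y0 r)"
  have mp: "m > 0" unfolding m_def using r by (simp add: content_cball)
  define I where "I = (LINT y|lebesgue. \<phi> y)"
  have Ib: "I \<ge> exp (- 4 / 3) * (m / 2 ^ DIM('n spacetime))"
  proof -
    have "(LINT y|lebesgue. exp (- 4 / 3) * indicator (cball y0 (r / 2)) y) \<le> I"
      unfolding I_def
    proof (rule integral_mono[OF _ \<phi>i])
      show "integrable lebesgue (\<lambda>y. exp (- 4 / 3 :: real) * indicator (cball y0 (r / 2)) y)"
        by (rule integrable_indicator_cball)
      show "exp (- 4 / 3) * indicator (cball y0 (r / 2)) y \<le> \<phi> y" for y
        using bump_lower[OF r, of y y0] \<phi>b(1)[of y] by (auto simp: indicator_def \<phi>_def)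
    qed
    then show ?thesis using measure_half_cball[of r y0] r by (simp add: m_def)
  qed
  have 7: "eventually (\<lambda>N. (LINT y|lebesgue. norm (P N y)) \<ge> wave_gain TYPE('n) * norm w * m) sequentially"
  proof -
    define J where "J N = (LINT y|lebesgue. cos (real N * ((2 *\<^sub>R \<eta>) \<bullet> y)) * \<phi> y)" for N
    have J: "J \<longlonglongrightarrow> 0" unfolding J_def using riemann_lebesgue[OF \<phi>i, of "2 *\<^sub>R \<eta>"] \<eta> by simp
    have "(\<lambda>N. norm w * ((I + J N) / 2) - C / real N * m) \<longlonglongrightarrow> norm w * ((I + 0) / 2) - 0 * m"
      by (intro tendsto_intros J C0) auto
    moreover have "wave_gain TYPE('n) * norm w * m < norm w * ((I + 0) / 2) - 0 * m"
    proof -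
      \<comment> \<open>\<open>wave_gain\<close> was chosen to leave a factor \<open>2\<close> of room\<close>
      define q where "q = exp (- 4 / 3) * (m / 2 ^ DIM('n spacetime))"
      have "wave_gain TYPE('n) * m = q / 4" by (simp add: q_def wave_gain_def)
      moreover have "q > 0" using mp by (simp add: q_def)
      ultimately have "wave_gain TYPE('n) * m < I / 2" using Ib unfolding q_def[symmetric] by linarith
      then have "norm w * (wave_gain TYPE('n) * m) < norm w * (I / 2)" using w(2) by (intro mult_strict_left_mono) auto
      then show ?thesis by (simp add: mult_ac)
    qed
    ultimately have "eventually (\<lambda>N. wave_gain TYPE('n) * norm w * m < norm w * ((I + J N) / 2) - C / real N * m) sequentially"
      by (rule order_tendstoD(1))
    then show ?thesis using eventually_ge_at_top[of 1]
    proof eventually_elim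
      case (elim N)
      have ci: "integrable lebesgue (\<lambda>y. cos (real N * ((2 *\<^sub>R \<eta>) \<bullet> y)) * \<phi> y)"
        by (rule Bochner_Integration.integrable_bound[OF \<phi>i])
          (auto intro!: borel_measurable_times cm[of N "2 *\<^sub>R \<eta>", simplified] \<phi>m mult_left_le_one_le simp: abs_mult)
      have ii: "integrable lebesgue (\<lambda>y. C / real N * indicator (cball y0 r) y)"
        by (rule integrable_indicator_cball)
      have pt: "norm w * ((\<phi> y + cos (real N * ((2 *\<^sub>R \<eta>) \<bullet> y)) * \<phi> y) / 2) - C / real N * indicator (cball y0 r) y \<le> norm (P N y)" for y
      proof (cases "y \<in> cball y0 r")
        case True
        let ?c = "cos (real N * (\<eta> \<bullet> y))"
        have e: "cos (real N * ((2 *\<^sub>R \<eta>) \<bullet> y)) = 2 * ?c\<^sup>2 - 1"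
          using cos_double_cos[of "real N * (\<eta> \<bullet> y)"] by (simp add: mult_ac)
        have "(\<phi> y + cos (real N * ((2 *\<^sub>R \<eta>) \<bullet> y)) * \<phi> y) / 2 = \<phi> y * ?c\<^sup>2"
          unfolding e by (simp add: field_simps)
        also have "\<dots> \<le> \<phi> y * \<bar>?c\<bar>"
        proof (rule mult_left_mono[OF _ \<phi>b(1)])
          have "?c\<^sup>2 = \<bar>?c\<bar> * \<bar>?c\<bar>" by (simp add: power2_eq_square)
          also have "\<dots> \<le> \<bar>?c\<bar>" by (rule mult_left_le_one_le) auto
          finally show "?c\<^sup>2 \<le> \<bar>?c\<bar>" .
        qed
        also have "\<dots> = \<bar>\<theta> N y\<bar>" using \<phi>b(1)[of y] by (simp add: \<theta>_def abs_mult)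
        finally have "norm w * ((\<phi> y + cos (real N * ((2 *\<^sub>R \<eta>) \<bullet> y)) * \<phi> y) / 2) \<le> norm w * \<bar>\<theta> N y\<bar>"
          by (rule mult_left_mono) simp
        also have "\<dots> = norm (\<theta> N y *\<^sub>R w)" by (simp add: mult.commute)
        also have "\<dots> \<le> norm (P N y) + norm (P N y - \<theta> N y *\<^sub>R w)"
          using norm_triangle_ineq4[of "P N y" "P N y - \<theta> N y *\<^sub>R w"] by simp
        also have "\<dots> \<le> norm (P N y) + C / real N" using C(2)[OF elim(2), of y] by simp
        finally show ?thesis using True by simp
      next
        case False
        then have "\<phi> y = 0" by (simp add: \<phi>_def bump_outside[OF r])
        then show ?thesis using False by simp
      qed
      have "norm w * ((I + J N) / 2) - C / real N * m = (LINT y|lebesgue. norm w * ((\<phi> y + cos (real N * ((2 *\<^sub>R \<eta>) \<bullet> y)) * \<phi> y) / 2) - C / real N * indicator (cball y0 r) y)"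
        using ci \<phi>i ii by (simp add: I_def J_def m_def)
      also have "\<dots> \<le> (LINT y|lebesgue. norm (P N y))"
        using ci \<phi>i ii Cc_infty_integrable(1)[OF PC] pt by (intro integral_mono) auto
      finally show ?case using elim(1) by linarith
    qed
  qed
  show ?thesis
    using that[of P, OF Psm _ Pout Pst 5 6 7[unfolded m_def]] L(2)[OF smooth_plane_potential[OF \<phi>s]] unfolding P_def by blast
qed

section \<open>Weak* small perturbations of relaxed solutions\<close>

lemma relaxed_mhd_add:
  assumes "smooth z" "smooth w" "relaxed_mhd z" "relaxed_mhd w"
  shows "relaxed_mhd (\<lambda>y. z y + w y)"
proof -
  have s: "smooth (\<lambda>y. z y + w y)" using assms by blast
  have add: "linear_mhd (\<lambda>v. D v + E v)" if "linear_mhd D" "linear_mhd E" for D E :: "'a spacetime \<Rightarrow> 'a state"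
  proof -
    note D = that(1)[unfolded linear_mhd_def] and E = that(2)[unfolded linear_mhd_def]
    show ?thesis unfolding linear_mhd_def fst_add snd_add vector_add_component sum.distrib
    proof (intro conjI allI, goal_cases)
      case (1 i) show ?case using conjunct1[OF D, THEN spec, of i] conjunct1[OF E, THEN spec, of i] by linarith
    next
      case (2 i) show ?case
        using conjunct1[OF conjunct2[OF D], THEN spec, of i] conjunct1[OF conjunct2[OF E], THEN spec, of i] by linarith
    qed (use D E in simp_all)
  qed
  show ?thesis
    using assms add unfolding relaxed_mhd_iff[OF s] relaxed_mhd_iff[OF assms(1)] relaxed_mhd_iff[OF assms(2)] dd_add[OF assms(1,2)]
    by blast
qed

lemma relaxed_mhd_sum:
  fixes w :: "'i \<Rightarrow> 'n::finite spacetime \<Rightarrow> 'n state"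
  assumes "finite I" "\<And>i. i \<in> I \<Longrightarrow> smooth (w i)" "\<And>i. i \<in> I \<Longrightarrow> relaxed_mhd (w i)"
  shows "relaxed_mhd (\<lambda>y. \<Sum>i\<in>I. w i y)"
  using assms
proof (induction I)
  case empty
  have "linear_mhd (\<lambda>v. dd v (\<lambda>y. 0 :: 'n state) y)" for y
    by (simp add: dd_const linear_mhd_def)
  then show ?case by (simp add: relaxed_mhd_iff[OF smooth_const])
next
  case (insert x F)
  then have "relaxed_mhd (\<lambda>y. w x y + (\<Sum>i\<in>F. w i y))"
    by (intro relaxed_mhd_add smooth_sum) auto
  then show ?case using insert by simp
qed

lemma X0_smooth: "z \<in> X0 \<Omega> \<Longrightarrow> smooth z" and X0_Uset: "z \<in> X0 \<Omega> \<Longrightarrow> z y \<in> Uset"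
  and X0_relaxed: "z \<in> X0 \<Omega> \<Longrightarrow> relaxed_mhd z" and X0_supp: "z \<in> X0 \<Omega> \<Longrightarrow> fun_supp z \<subseteq> \<Omega>"
  unfolding X0_def by blast+

lemma X0_outside: "z \<in> X0 \<Omega> \<Longrightarrow> y \<notin> \<Omega> \<Longrightarrow> z y = 0"
  using X0_supp not_fun_supp by blast

lemma X0_Cc: assumes "z \<in> X0 \<Omega>" "bounded \<Omega>" shows "z \<in> Cc_infty"
proof -
  have "bounded (fun_supp z)" by (rule bounded_subset[OF assms(2) X0_supp[OF assms(1)]])
  then show ?thesis using assms X0_smooth
    by (intro Cc_inftyI[of z "fun_supp z"]) (auto simp: compact_eq_bounded_closed not_fun_supp)
qed

lemma Uset_bounded: obtains C where "C > 0" "\<And>z. z \<in> (Uset :: 'n::finite state set) \<Longrightarrow> norm z \<le> C"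
proof -
  obtain C where C: "C > 0" "\<And>z. z \<in> (relaxed_box :: 'n::finite state set) \<Longrightarrow> norm z \<le> C"
    using relaxed_box_bounded by blast
  show ?thesis by (rule that[OF C(1)]) (use C(2) Uset_sub_box in blast)
qed

lemma X0_Linf: assumes "z \<in> X0 \<Omega>" "bounded \<Omega>" shows "z \<in> Linf \<Omega>"
proof -
  obtain C where C: "\<And>y. norm (z y) \<le> C" using compact_support_bounded[OF X0_Cc[OF assms]] by blast
  have "\<exists>C. AE y in lebesgue. norm (z y) \<le> C" using C by (intro exI[of _ C] AE_I2)
  moreover have "z y \<in> state_space" for y using X0_Uset[OF assms(1)] Uset_sub_state by blast
  ultimately show ?thesis unfolding Linf_def
    using Cc_infty_integrable(2)[OF X0_Cc[OF assms]] X0_outside[OF assms(1)] by (auto intro!: AE_I2)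
qed

lemma topspace_weak_star: "topspace (weak_star \<Omega>) = Linf \<Omega>"
proof -
  let ?B = "{{z \<in> Linf \<Omega>. (LINT y|lebesgue. z y \<bullet> \<phi> y) \<in> A} | \<phi> A. integrable lebesgue \<phi> \<and> open A}"
  have "Linf \<Omega> \<in> ?B" by (rule CollectI, rule exI[of _ "\<lambda>_. 0"], rule exI[of _ UNIV]) simp
  moreover have "\<Union>?B \<subseteq> Linf \<Omega>" by auto
  ultimately have "\<Union>?B = Linf \<Omega>" by (intro equalityI Union_upper) 
  then show ?thesis unfolding weak_star_def topology_generated_by_topspace .
qed

lemma X0_X: assumes "z \<in> X0 \<Omega>" "bounded \<Omega>" shows "z \<in> X \<Omega>"
proof -
  have "X0 \<Omega> \<subseteq> topspace (weak_star \<Omega>)"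
    unfolding topspace_weak_star using X0_Linf assms(2) by (intro subsetI)
  from closure_of_subset[OF this] assms(1) show ?thesis unfolding X_def by (rule subsetD)
qed

lemma X_Linf: "z \<in> X \<Omega> \<Longrightarrow> z \<in> Linf \<Omega>"
  unfolding X_def using closure_of_subset_topspace[of "weak_star \<Omega>" "X0 \<Omega>"] by (auto simp: topspace_weak_star)

text \<open>Convergence only has to be tested on the generating sets, by induction over the generated topology.\<close>

lemma weak_star_eventually:
  assumes S: "openin (weak_star \<Omega>) S" "z \<in> S" and zs: "\<And>N. zs N \<in> Linf \<Omega>"
    and lim: "\<And>g. integrable lebesgue g \<Longrightarrow> (\<lambda>N. LINT y|lebesgue. zs N y \<bullet> g y) \<longlonglongrightarrow> (LINT y|lebesgue. z y \<bullet> g y)"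
  shows "eventually (\<lambda>N. zs N \<in> S) sequentially"
proof -
  let ?B = "{{z \<in> Linf \<Omega>. (LINT y|lebesgue. z y \<bullet> \<phi> y) \<in> A} | \<phi> A. integrable lebesgue \<phi> \<and> open A}"
  have "generate_topology_on ?B S"
    using S(1) unfolding weak_star_def by (simp add: openin_topology_generated_by_iff)
  then show ?thesis using S(2)
  proof (induction S)
    case (Int a b)
    then show ?case by (auto intro: eventually_conj)
  next
    case (UN K)
    then obtain k where "k \<in> K" "z \<in> k" by blast
    with UN have "eventually (\<lambda>N. zs N \<in> k) sequentially" by blast
    then show ?case by eventually_elim (use \<open>k \<in> K\<close> in blast)
  next
    case (Basis s)
    then obtain \<phi> A where s: "s = {z \<in> Linf \<Omega>. (LINT y|lebesgue. z y \<bullet> \<phi> y) \<in> A}" "integrable lebesgue \<phi>" "open A" by blast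
    have "eventually (\<lambda>N. (LINT y|lebesgue. zs N y \<bullet> \<phi> y) \<in> A) sequentially"
      using topological_tendstoD[OF lim[OF s(2)] s(3)] Basis s(1) by blast
    then show ?case by eventually_elim (use zs s in blast)
  qed simp
qed

text \<open>The lower bound of \<open>Uset_segment\<close> for half the length of the segment.\<close>

definition segment_gain :: "'n::finite itself \<Rightarrow> real \<Rightarrow> real" where
  "segment_gain _ \<delta> = (sqrt 2 - sqrt (2 - \<delta>)) / (2 * real (DIM((real^'n) \<times> (real^'n) \<times> (real^'n^'n) \<times> (real^'n^'n)) + 1))"

lemma segment_gain_pos: "\<delta> > 0 \<Longrightarrow> segment_gain TYPE('n::finite) \<delta> > 0"
  unfolding segment_gain_def
  by (intro divide_pos_pos mult_pos_pos, simp, simp, simp only: of_nat_0_less_iff)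

text \<open>The compact segment at \<open>y\<close> has a positive distance to the relative boundary of \<open>Uset\<close>, so by continuity of
\<open>z\<close> the same direction works on a whole ball.\<close>

lemma segment_ball:
  fixes z :: "'n::finite spacetime \<Rightarrow> 'n state"
  assumes z: "z \<in> X0 \<Omega>" and O: "open \<Omega>" and y: "y \<in> \<Omega>"
    and d: "(norm (fst (z y)))\<^sup>2 + (norm (fst (snd (z y))))\<^sup>2 \<le> 2 - \<delta>"
  obtains u1 b1 u2 b2 w l R where "norm u1 = 1" "norm b1 = 1" "norm u2 = 1" "norm b2 = 1"
    "w = l *\<^sub>R pressureless (K_point u1 b1 - K_point u2 b2)" "segment_gain TYPE('n) \<delta> \<le> norm w" "R > 0" "cball y R \<subseteq> \<Omega>"
    "\<And>y' s. y' \<in> cball y R \<Longrightarrow> \<bar>s\<bar> \<le> 1 \<Longrightarrow> z y' + s *\<^sub>R w \<in> Uset"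
proof -
  obtain u1 b1 u2 b2 l where n: "norm u1 = 1" "norm b1 = 1" "norm u2 = 1" "norm b2 = 1"
    and seg: "\<And>s. \<bar>s\<bar> \<le> 1 \<Longrightarrow> z y + s *\<^sub>R l *\<^sub>R pressureless (K_point u1 b1 - K_point u2 b2) \<in> Uset"
    and g: "segment_gain TYPE('n) \<delta> \<le> norm (l *\<^sub>R pressureless (K_point u1 b1 - K_point u2 b2))"
    using Uset_segment[OF X0_Uset[OF z] d] unfolding segment_gain_def by metis
  define w where "w = l *\<^sub>R pressureless (K_point u1 b1 - K_point u2 b2)"
  define S where "S = (\<lambda>s. z y + s *\<^sub>R w) ` {-1..1}"
  have "compact S" unfolding S_def by (intro compact_continuous_image continuous_intros) auto
  moreover have "S \<subseteq> Uset" using seg unfolding S_def w_def by auto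
  ultimately obtain e where e: "e > 0" "\<And>z p. z \<in> S \<Longrightarrow> p \<in> state_space \<Longrightarrow> norm p < e \<Longrightarrow> z + p \<in> Uset"
    using Uset_margin by blast
  have "isCont z y" using smooth_continuous[OF X0_smooth[OF z], of UNIV]
    unfolding continuous_on_eq_continuous_at[OF open_UNIV] by (rule bspec) simp
  then obtain d1 where d1: "d1 > 0" "\<And>y'. dist y' y < d1 \<Longrightarrow> dist (z y') (z y) < e"
    unfolding continuous_at_eps_delta using e(1) by blast
  obtain d2 where d2: "d2 > 0" "cball y d2 \<subseteq> \<Omega>" using O y open_contains_cball by blast
  define R where "R = min (d1 / 2) d2"
  show ?thesis
  proof (rule that[OF n w_def])
    show "segment_gain TYPE('n) \<delta> \<le> norm w" using g by (simp add: w_def)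
    show "R > 0" using d1 d2 by (simp add: R_def)
    show "cball y R \<subseteq> \<Omega>" using d2 by (force simp: R_def)
    fix y' s assume *: "y' \<in> cball y R" "\<bar>s\<bar> \<le> (1::real)"
    have "z y + s *\<^sub>R w \<in> S" using * unfolding S_def by (auto simp: abs_le_iff)
    moreover have "z y' - z y \<in> state_space"
      using X0_Uset[OF z] Uset_sub_state by (intro subspace_diff[OF subspace_state_space]) blast+
    moreover have "norm (z y' - z y) < e"
    proof -
      have "dist y' y \<le> d1 / 2" using * by (simp add: R_def dist_commute)
      then have "dist y' y < d1" using d1(1) by linarith
      from d1(2)[OF this] show ?thesis by (simp only: dist_norm)
    qed
    ultimately have "(z y + s *\<^sub>R w) + (z y' - z y) \<in> Uset" by (rule e(2))
    then show "z y' + s *\<^sub>R w \<in> Uset" by (simp add: algebra_simps)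
  qed
qed

text \<open>Vitali's covering theorem exhausts \<open>F\<close> by countably many disjoint balls up to a null set; finitely many of
them carry half of the volume.\<close>

lemma finite_half_covering:
  fixes F :: "'a::euclidean_space set"
  assumes F: "F \<in> lmeasurable" and R: "\<And>y. y \<in> F \<Longrightarrow> R y > 0"
  obtains D where "finite D" "\<And>y r. (y, r) \<in> D \<Longrightarrow> y \<in> F \<and> 0 < r \<and> r \<le> R y"
    "pairwise (\<lambda>i j. disjnt (cball (fst i) (snd i)) (cball (fst j) (snd j))) D"
    "measure lebesgue F / 2 \<le> (\<Sum>i\<in>D. measure lebesgue (cball (fst i) (snd i)))"
proof (cases "measure lebesgue F = 0")
  case True
  then show ?thesis using that[of "{}"] by auto
next
  case False
  then have m: "measure lebesgue F > 0" using measure_nonneg[of lebesgue F] by linarith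
  define K where "K = {(y, r). y \<in> F \<and> 0 < r \<and> r \<le> R y}"
  have Kr: "0 < snd i" if "i \<in> K" for i using that by (auto simp: K_def)
  have ex: "\<exists>i. i \<in> K \<and> x \<in> cball (fst i) (snd i) \<and> snd i < d" if "x \<in> F" "0 < d" for x d
    using that R[OF that(1)] by (intro exI[of _ "(x, min (R x) (d / 2))"]) (auto simp: K_def)
  obtain C where C: "countable C" "C \<subseteq> K"
    "pairwise (\<lambda>i j. disjnt (cball (fst i) (snd i)) (cball (fst j) (snd j))) C"
    "negligible (F - (\<Union>i \<in> C. cball (fst i) (snd i)))"
    by (rule Vitali_covering_theorem_cballs[of K snd F fst, OF Kr ex]) (assumption | (rule that; assumption))+
  have "\<exists>D\<subseteq>C. finite D \<and> measure lebesgue F / 2 \<le> (\<Sum>i\<in>D. measure lebesgue (cball (fst i) (snd i)))"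
  proof (rule ccontr)
    assume "\<not> ?thesis"
    then have lt: "(\<Sum>i\<in>D. measure lebesgue (cball (fst i) (snd i))) < measure lebesgue F / 2" if "D \<subseteq> C" "finite D" for D
      using that by (meson not_le)
    have b: "measure lebesgue (\<Union>i\<in>D. cball (fst i) (snd i)) \<le> measure lebesgue F / 2" if "D \<subseteq> C" "finite D" for D
      using lt[OF that] measure_UNION_le[OF that(2), of "\<lambda>i. cball (fst i) (snd i)" lebesgue] by fastforce
    have fm: "(\<Union>i\<in>C. cball (fst i) (snd i)) \<in> lmeasurable" and
      le: "measure lebesgue (\<Union>i\<in>C. cball (fst i) (snd i)) \<le> measure lebesgue F / 2"
      by (rule fmeasurable_UN_bound[OF C(1) _ b] measure_UN_bound[OF C(1) _ b]; auto)+
    have "measure lebesgue F \<le> measure lebesgue (\<Union>i\<in>C. cball (fst i) (snd i)) + measure lebesgue (F - (\<Union>i\<in>C. cball (fst i) (snd i)))"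
    proof -
      have n: "F - (\<Union>i\<in>C. cball (fst i) (snd i)) \<in> lmeasurable" using C(4) by (simp add: negligible_imp_measurable)
      have "measure lebesgue F \<le> measure lebesgue ((\<Union>i\<in>C. cball (fst i) (snd i)) \<union> (F - (\<Union>i\<in>C. cball (fst i) (snd i))))"
        using F fm n by (intro measure_mono_fmeasurable fmeasurable.Un) (auto simp: fmeasurableD)
      also have "\<dots> \<le> measure lebesgue (\<Union>i\<in>C. cball (fst i) (snd i)) + measure lebesgue (F - (\<Union>i\<in>C. cball (fst i) (snd i)))"
        using fm n by (intro measure_Un_le) (auto simp: fmeasurableD)
      finally show ?thesis .
    qed
    then show False using le m C(4) by (simp add: negligible_imp_measure0)
  qed
  then obtain D where D: "D \<subseteq> C" "finite D" "measure lebesgue F / 2 \<le> (\<Sum>i\<in>D. measure lebesgue (cball (fst i) (snd i)))" by blast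
  show ?thesis
    by (rule that[OF D(2) _ _ D(3)]) (use D(1) C K_def pairwise_subset in blast)+
qed

text \<open>The waves of \<open>local_wave\<close> on finitely many disjoint balls that fill half of the volume of the set where \<open>z\<close> is
far from saturated. As the supports are disjoint, each value is moved by one wave only and the \<open>L\<^sup>1\<close>
norms add up.\<close>

lemma weak_star_perturbation:
  fixes z :: "'n::finite spacetime \<Rightarrow> 'n state"
  assumes n: "CARD('n) \<ge> 4" and \<Omega>: "open \<Omega>" "bounded \<Omega>" and z: "z \<in> X0 \<Omega>" and \<delta>: "\<delta> > 0"
  obtains zs where "\<And>N. zs N \<in> X0 \<Omega>"
    "\<And>g. integrable lebesgue g \<Longrightarrow> (\<lambda>N. LINT y|lebesgue. zs N y \<bullet> g y) \<longlonglongrightarrow> (LINT y|lebesgue. z y \<bullet> g y)"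
    "\<And>N. (LINT y|lebesgue. norm (zs N y - z y)) \<ge> wave_gain TYPE('n) * segment_gain TYPE('n) \<delta> / 2
        * measure lebesgue {y\<in>\<Omega>. (norm (fst (z y)))\<^sup>2 + (norm (fst (snd (z y))))\<^sup>2 \<le> 2 - \<delta>}"
proof -
  define F where "F = {y\<in>\<Omega>. (norm (fst (z y)))\<^sup>2 + (norm (fst (snd (z y))))\<^sup>2 \<le> 2 - \<delta>}"
  let ?sg = "segment_gain TYPE('n) \<delta>"
  have zc: "continuous_on S z" for S using smooth_continuous[OF X0_smooth[OF z]] .
  have Fm: "F \<in> lmeasurable"
  proof -
    have "closed {y. (norm (fst (z y)))\<^sup>2 + (norm (fst (snd (z y))))\<^sup>2 \<le> 2 - \<delta>}"
      by (intro closed_Collect_le continuous_intros zc)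
    moreover have "F = \<Omega> \<inter> {y. (norm (fst (z y)))\<^sup>2 + (norm (fst (snd (z y))))\<^sup>2 \<le> 2 - \<delta>}"
      unfolding F_def by (rule Collect_conj_eq[of "\<lambda>y. y \<in> \<Omega>", unfolded Collect_mem_eq])
    ultimately have "F \<in> sets borel" using \<Omega>(1) by (simp only: sets.Int borel_open borel_closed)
    then have "F \<in> sets lebesgue" by simp
    moreover have "bounded F" using \<Omega>(2) by (rule bounded_subset) (auto simp: F_def)
    ultimately show ?thesis by (rule bounded_set_imp_lmeasurable[rotated])
  qed
  define good where "good y w R \<longleftrightarrow> (\<exists>u1 b1 u2 b2 l. norm u1 = 1 \<and> norm b1 = 1 \<and> norm u2 = 1 \<and> norm b2 = 1 \<and>
    w = l *\<^sub>R pressureless (K_point u1 b1 - K_point u2 b2)) \<and> ?sg \<le> norm w \<and> R > 0 \<and> cball y R \<subseteq> \<Omega> \<and>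
    (\<forall>y'\<in>cball y R. \<forall>s. \<bar>s\<bar> \<le> 1 \<longrightarrow> z y' + s *\<^sub>R w \<in> Uset)" for y w R
  have "\<exists>w R. good y w R" if "y \<in> F" for y
  proof -
    from that have "y \<in> \<Omega>" "(norm (fst (z y)))\<^sup>2 + (norm (fst (snd (z y))))\<^sup>2 \<le> 2 - \<delta>" by (auto simp: F_def)
    from segment_ball[OF z \<Omega>(1) this] show ?thesis unfolding good_def by metis
  qed
  then obtain W R where WR: "\<And>y. y \<in> F \<Longrightarrow> good y (W y) (R y)" by metis
  obtain D where D: "finite D" "\<And>y r. (y, r) \<in> D \<Longrightarrow> y \<in> F \<and> 0 < r \<and> r \<le> R y"
    "pairwise (\<lambda>i j. disjnt (cball (fst i) (snd i)) (cball (fst j) (snd j))) D"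
    "measure lebesgue F / 2 \<le> (\<Sum>i\<in>D. measure lebesgue (cball (fst i) (snd i)))"
    using finite_half_covering[OF Fm, of R] WR by (auto simp: good_def)
  define B where "B i = cball (fst i) (snd i)" for i :: "'n spacetime \<times> real"
  have BO: "B i \<subseteq> \<Omega>" if "i \<in> D" for i
    using D(2)[of "fst i" "snd i"] WR[of "fst i"] that by (force simp: B_def good_def)
  define wave_on where "wave_on i P \<longleftrightarrow> (\<forall>N. smooth (P N) \<and> relaxed_mhd (P N) \<and> (\<forall>y. y \<notin> B i \<longrightarrow> P N y = 0) \<and> (\<forall>y. P N y \<in> state_space)) \<and>
    eventually (\<lambda>N. \<forall>y\<in>B i. z y + P N y \<in> Uset) sequentially \<and>
    (\<forall>g. integrable lebesgue g \<longrightarrow> (\<lambda>N. LINT y|lebesgue. P N y \<bullet> g y) \<longlonglongrightarrow> 0) \<and>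
    eventually (\<lambda>N. (LINT y|lebesgue. norm (P N y)) \<ge> wave_gain TYPE('n) * ?sg * measure lebesgue (B i)) sequentially"
    for i P
  have "\<exists>P. wave_on i P" if i: "i \<in> D" for i
  proof -
    obtain y r where yr: "i = (y, r)" by (cases i)
    have y: "y \<in> F" "0 < r" "r \<le> R y" using D(2) i yr by auto
    obtain u1 b1 u2 b2 l where nrm: "norm u1 = 1" "norm b1 = 1" "norm u2 = 1" "norm b2 = 1"
      "W y = l *\<^sub>R pressureless (K_point u1 b1 - K_point u2 b2)"
      and g: "?sg \<le> norm (W y)" "\<And>y' s. y' \<in> cball y (R y) \<Longrightarrow> \<bar>s\<bar> \<le> 1 \<Longrightarrow> z y' + s *\<^sub>R W y \<in> Uset"
      using WR[OF y(1)] unfolding good_def by blast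
    have W0: "W y \<noteq> 0" using g(1) segment_gain_pos[OF \<delta>, where 'n = 'n] by auto
    have sub: "cball y r \<subseteq> cball y (R y)" using y by auto
    obtain P where P: "\<And>N. smooth (P N)" "\<And>N. relaxed_mhd (P N)" "\<And>N x. x \<notin> cball y r \<Longrightarrow> P N x = 0"
      "\<And>N x. P N x \<in> state_space"
      "eventually (\<lambda>N. \<forall>x\<in>cball y r. z x + P N x \<in> Uset) sequentially"
      "\<And>g. integrable lebesgue g \<Longrightarrow> (\<lambda>N. LINT x|lebesgue. P N x \<bullet> g x) \<longlonglongrightarrow> 0"
      "eventually (\<lambda>N. (LINT x|lebesgue. norm (P N x)) \<ge> wave_gain TYPE('n) * norm (W y) * measure lebesgue (cball y r)) sequentially"
      using local_wave[OF n nrm(1-4) nrm(5) W0 zc y(2)] g(2) sub by blast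
    have "wave_gain TYPE('n) * ?sg * measure lebesgue (cball y r) \<le> wave_gain TYPE('n) * norm (W y) * measure lebesgue (cball y r)"
      using g(1) by (intro mult_right_mono mult_left_mono) (auto simp: wave_gain_def)
    then have "eventually (\<lambda>N. (LINT x|lebesgue. norm (P N x)) \<ge> wave_gain TYPE('n) * ?sg * measure lebesgue (cball y r)) sequentially"
      using P(7) by (auto elim: eventually_mono)
    with P(1-6) show ?thesis unfolding wave_on_def B_def yr fst_conv snd_conv by (intro exI[of _ P]) blast
  qed
  then obtain P where P_wave: "\<And>i. i \<in> D \<Longrightarrow> wave_on i (P i)" by metis
  then have P0: "\<And>i N. i \<in> D \<Longrightarrow> smooth (P i N)" "\<And>i N. i \<in> D \<Longrightarrow> relaxed_mhd (P i N)"
      "\<And>i N y. i \<in> D \<Longrightarrow> y \<notin> B i \<Longrightarrow> P i N y = 0"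
      "\<And>i N y. i \<in> D \<Longrightarrow> P i N y \<in> state_space"
      "\<And>i. i \<in> D \<Longrightarrow> eventually (\<lambda>N. \<forall>y\<in>B i. z y + P i N y \<in> Uset) sequentially"
      "\<And>i g. i \<in> D \<Longrightarrow> integrable lebesgue g \<Longrightarrow> (\<lambda>N. LINT y|lebesgue. P i N y \<bullet> g y) \<longlonglongrightarrow> 0"
      "\<And>i. i \<in> D \<Longrightarrow> eventually (\<lambda>N. (LINT y|lebesgue. norm (P i N y)) \<ge> wave_gain TYPE('n) * ?sg * measure lebesgue (B i)) sequentially"
    unfolding wave_on_def by blast+
  have "eventually (\<lambda>N. \<forall>i\<in>D. (\<forall>y\<in>B i. z y + P i N y \<in> Uset) \<and>
      (LINT y|lebesgue. norm (P i N y)) \<ge> wave_gain TYPE('n) * ?sg * measure lebesgue (B i)) sequentially"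
    by (rule eventually_ball_finite[OF D(1)]) (intro ballI eventually_conj[OF P0(5) P0(7)])
  then obtain N0 where N0: "\<And>N i y. N \<ge> N0 \<Longrightarrow> i \<in> D \<Longrightarrow> y \<in> B i \<Longrightarrow> z y + P i N y \<in> Uset"
    "\<And>N i. N \<ge> N0 \<Longrightarrow> i \<in> D \<Longrightarrow> (LINT y|lebesgue. norm (P i N y)) \<ge> wave_gain TYPE('n) * ?sg * measure lebesgue (B i)"
    unfolding eventually_sequentially by blast
  have one: "\<exists>i\<in>D. y \<in> B i \<and> (\<forall>j\<in>D. j \<noteq> i \<longrightarrow> y \<notin> B j)" if "\<exists>i\<in>D. y \<in> B i" for y
    using that D(3) unfolding pairwise_def disjnt_iff B_def by blast
  define Q where "Q N y = (\<Sum>i\<in>D. P i (N + N0) y)" for N y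
  have Q1: "Q N y = P i (N + N0) y" "(\<Sum>i\<in>D. norm (P i (N + N0) y)) = norm (P i (N + N0) y)"
    if "i \<in> D" "y \<in> B i" "\<forall>j\<in>D. j \<noteq> i \<longrightarrow> y \<notin> B j" for N i y
  proof -
    show "Q N y = P i (N + N0) y"
      unfolding Q_def using that P0(3) D(1) by (subst sum.remove[of D i]) (auto intro!: sum.neutral)
    show "(\<Sum>i\<in>D. norm (P i (N + N0) y)) = norm (P i (N + N0) y)"
      using that P0(3) D(1) by (subst sum.remove[of D i]) (auto intro!: sum.neutral)
  qed
  have Q0: "Q N y = 0" if "\<not> (\<exists>i\<in>D. y \<in> B i)" for N y
    unfolding Q_def using that P0(3) by (auto intro!: sum.neutral)
  have Qn: "norm (Q N y) = (\<Sum>i\<in>D. norm (P i (N + N0) y))" for N y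
  proof (cases "\<exists>i\<in>D. y \<in> B i")
    case True
    then show ?thesis using one[OF True] Q1 by metis
  next
    case False
    then show ?thesis using Q0[OF False] P0(3) by (auto intro!: sum.neutral[symmetric])
  qed
  have PCc: "P i N \<in> Cc_infty" if "i \<in> D" for i N
    by (rule Cc_inftyI[OF P0(1)[OF that] _ P0(3)[OF that], of "B i"]) (auto simp: B_def)
  define zs where "zs N y = z y + Q N y" for N y
  have mem: "zs N \<in> X0 \<Omega>" for N
  proof -
    have Qs: "smooth (Q N)" unfolding Q_def[abs_def] using P0(1) by (intro smooth_sum)
    have "smooth (zs N)" unfolding zs_def[abs_def] by (intro smooth_add X0_smooth[OF z] Qs)
    moreover have "relaxed_mhd (zs N)" unfolding zs_def[abs_def]
      by (intro relaxed_mhd_add X0_smooth[OF z] Qs X0_relaxed[OF z])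
        (unfold Q_def[abs_def], intro relaxed_mhd_sum D(1) P0, auto)
    moreover have "fun_supp (zs N) \<subseteq> \<Omega>"
    proof -
      have "closed (fun_supp z \<union> (\<Union>i\<in>D. B i))" using D(1) by (intro closed_Un closed_UN) (auto simp: B_def)
      then have "fun_supp (zs N) \<subseteq> fun_supp z \<union> (\<Union>i\<in>D. B i)"
        by (subst fun_supp_subset_iff) (use Q0 not_fun_supp[of _ z] in \<open>auto simp: zs_def\<close>)
      then show ?thesis using X0_supp[OF z] BO by blast
    qed
    moreover have "zs N y \<in> Uset" for y
    proof (cases "\<exists>i\<in>D. y \<in> B i")
      case True
      then obtain i where i: "i \<in> D" "y \<in> B i" "\<forall>j\<in>D. j \<noteq> i \<longrightarrow> y \<notin> B j" using one by blast
      then show ?thesis using N0(1)[of "N + N0" i y] Q1(1)[OF i] by (simp add: zs_def)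
    next
      case False
      then show ?thesis using Q0[OF False] X0_Uset[OF z] by (simp add: zs_def)
    qed
    ultimately show ?thesis unfolding X0_def by blast
  qed
  show ?thesis
  proof (rule that[of zs])
    show "zs N \<in> X0 \<Omega>" for N by (rule mem)
    show "(\<lambda>N. LINT y|lebesgue. zs N y \<bullet> g y) \<longlonglongrightarrow> (LINT y|lebesgue. z y \<bullet> g y)" if g: "integrable lebesgue g" for g
    proof -
      have ig: "integrable lebesgue (\<lambda>y. f y \<bullet> g y)" if fC: "f \<in> Cc_infty" for f :: "'n spacetime \<Rightarrow> 'n state"
      proof -
        obtain C where "\<And>y. norm (f y) \<le> C" using compact_support_bounded[OF fC] by blast
        then show ?thesis by (rule integrable_inner_bounded[OF Cc_infty_integrable(2)[OF fC] _ g])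
      qed
      have eq: "(LINT y|lebesgue. zs N y \<bullet> g y) = (LINT y|lebesgue. z y \<bullet> g y) + (\<Sum>i\<in>D. LINT y|lebesgue. P i (N + N0) y \<bullet> g y)" for N
        unfolding zs_def Q_def inner_add_left inner_sum_left
        by (subst Bochner_Integration.integral_add)
          (auto intro!: ig X0_Cc[OF z \<Omega>(2)] PCc Bochner_Integration.integral_sum)
      have "(\<lambda>N. (LINT y|lebesgue. z y \<bullet> g y) + (\<Sum>i\<in>D. LINT y|lebesgue. P i (N + N0) y \<bullet> g y)) \<longlonglongrightarrow> (LINT y|lebesgue. z y \<bullet> g y) + (\<Sum>i\<in>D. 0)"
        by (intro tendsto_intros LIMSEQ_ignore_initial_segment P0(6) g)
      then show ?thesis unfolding eq by simp
    qed
    show "wave_gain TYPE('n) * ?sg / 2 * measure lebesgue {y\<in>\<Omega>. (norm (fst (z y)))\<^sup>2 + (norm (fst (snd (z y))))\<^sup>2 \<le> 2 - \<delta>}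
      \<le> (LINT y|lebesgue. norm (zs N y - z y))" for N
    proof -
      have w0: "wave_gain TYPE('n) * ?sg \<ge> 0" using segment_gain_pos[OF \<delta>, where 'n = 'n] by (simp add: wave_gain_def)
      have "wave_gain TYPE('n) * ?sg / 2 * measure lebesgue F = wave_gain TYPE('n) * ?sg * (measure lebesgue F / 2)" by simp
      also have "\<dots> \<le> wave_gain TYPE('n) * ?sg * (\<Sum>i\<in>D. measure lebesgue (B i))"
        using D(4) w0 unfolding B_def by (rule mult_left_mono)
      also have "\<dots> = (\<Sum>i\<in>D. wave_gain TYPE('n) * ?sg * measure lebesgue (B i))" by (simp add: sum_distrib_left)
      also have "\<dots> \<le> (\<Sum>i\<in>D. LINT y|lebesgue. norm (P i (N + N0) y))" by (intro sum_mono N0) auto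
      also have "\<dots> = (LINT y|lebesgue. (\<Sum>i\<in>D. norm (P i (N + N0) y)))"
        by (rule Bochner_Integration.integral_sum[symmetric], rule integrable_norm, rule Cc_infty_integrable(1), rule PCc)
      also have "\<dots> = (LINT y|lebesgue. norm (zs N y - z y))" by (simp add: zs_def Qn)
      finally show ?thesis by (simp add: F_def)
    qed
  qed
qed

section \<open>Continuity points are saturated\<close>

text \<open>Hoelder's inequality against the indicator function of \<open>\<Omega>\<close>.\<close>

lemma L1_le_Lnorm:
  fixes f :: "'a::euclidean_space \<Rightarrow> 'b::euclidean_space"
  assumes f: "f \<in> borel_measurable lebesgue" "AE y in lebesgue. norm (f y) \<le> C"
    and \<Omega>: "open \<Omega>" "bounded \<Omega>" and m: "m > 1"
  shows "(LINT y:\<Omega>|lebesgue. norm (f y)) \<le> measure lebesgue \<Omega> powr (1 - 1 / m) * Lnorm m \<Omega> f"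
proof -
  have \<Omega>m: "\<Omega> \<in> sets lebesgue" using \<Omega> by simp
  define F where "F y = indicator \<Omega> y * norm (f y)" for y
  define G :: "'a \<Rightarrow> real" where "G = indicator \<Omega>"
  have fm: "F \<in> borel_measurable lebesgue" and gm: "G \<in> borel_measurable lebesgue"
    unfolding F_def G_def using f \<Omega>m by auto
  have Fp: "\<bar>F y\<bar> powr m = indicator \<Omega> y * norm (f y) powr m" for y
    using m by (auto simp: F_def indicator_def)
  have fi: "integrable lebesgue (\<lambda>y. \<bar>F y\<bar> powr m)"
  proof (rule integrable_bounded_support[of _ \<Omega> "\<bar>C\<bar> powr m"])
    show "AE y in lebesgue. norm (\<bar>F y\<bar> powr m) \<le> \<bar>C\<bar> powr m"
      using f(2) by eventually_elim (use m in \<open>auto simp: F_def indicator_def intro!: powr_mono2\<close>)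
    show "(\<lambda>y. \<bar>F y\<bar> powr m) \<in> borel_measurable lebesgue"
      using fm by (intro powr_real_measurable borel_measurable_abs) auto
    show "AE y in lebesgue. y \<notin> \<Omega> \<longrightarrow> \<bar>F y\<bar> powr m = 0"
      by (rule AE_I2) (simp add: F_def)
  qed (rule \<Omega>)
  define q where "q = m / (m - 1)"
  have q: "q > 1" "1 / m + 1 / q = 1" "1 / q = 1 - 1 / m" using m by (auto simp: q_def field_simps)
  have Gq: "\<bar>G y\<bar> powr q = indicator \<Omega> y" for y using q by (auto simp: G_def indicator_def)
  have gi: "integrable lebesgue (\<lambda>y. \<bar>G y\<bar> powr q)"
    unfolding Gq by (rule integrable_bounded_support[of _ \<Omega> 1]) (use \<Omega> gm in \<open>auto simp: G_def\<close>)
  have "(LINT y|lebesgue. \<bar>F y * G y\<bar>) \<le> (LINT y|lebesgue. \<bar>F y\<bar> powr m) powr (1 / m) * (LINT y|lebesgue. \<bar>G y\<bar> powr q) powr (1 / q)"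
    by (rule Holder_integral(2)[OF m q(1,2) fm fi gm gi])
  also have "(LINT y|lebesgue. \<bar>F y\<bar> powr m) powr (1 / m) = Lnorm m \<Omega> f"
    by (simp add: Fp Lnorm_def set_lebesgue_integral_def)
  also have "(LINT y|lebesgue. \<bar>G y\<bar> powr q) = measure lebesgue \<Omega>"
    by (simp add: Gq)
  also have "(\<lambda>y. \<bar>F y * G y\<bar>) = (\<lambda>y. indicator \<Omega> y *\<^sub>R norm (f y))" by (auto simp: F_def G_def indicator_def)
  finally show ?thesis by (simp add: set_lebesgue_integral_def q(3) mult.commute)
qed

lemma Lnorm_support:
  fixes f :: "'a::euclidean_space \<Rightarrow> 'b::euclidean_space"
  assumes "f \<in> borel_measurable lebesgue" "open \<Omega>" "AE y in lebesgue. y \<notin> \<Omega> \<longrightarrow> f y = 0"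
  shows "Lnorm m \<Omega> f = Lnorm m UNIV f" "(LINT y:\<Omega>|lebesgue. norm (f y)) = (LINT y|lebesgue. norm (f y))"
proof -
  have \<Omega>m: "\<Omega> \<in> sets lebesgue" using assms by simp
  have "(LINT y|lebesgue. indicator \<Omega> y *\<^sub>R norm (f y) powr m) = (LINT y|lebesgue. norm (f y) powr m)"
  proof (rule integral_cong_AE)
    show "(\<lambda>y. indicator \<Omega> y *\<^sub>R norm (f y) powr m) \<in> borel_measurable lebesgue" "(\<lambda>y. norm (f y) powr m) \<in> borel_measurable lebesgue"
      using assms(1) \<Omega>m by (auto intro!: borel_measurable_scaleR borel_measurable_indicator powr_real_measurable)
    show "AE y in lebesgue. indicator \<Omega> y *\<^sub>R norm (f y) powr m = norm (f y) powr m"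
      using assms(3) by eventually_elim (auto simp: indicator_def)
  qed
  then show "Lnorm m \<Omega> f = Lnorm m UNIV f" by (simp add: Lnorm_def set_lebesgue_integral_def)
  have "(LINT y|lebesgue. indicator \<Omega> y *\<^sub>R norm (f y)) = (LINT y|lebesgue. norm (f y))"
  proof (rule integral_cong_AE)
    show "(\<lambda>y. indicator \<Omega> y *\<^sub>R norm (f y)) \<in> borel_measurable lebesgue" "(\<lambda>y. norm (f y)) \<in> borel_measurable lebesgue"
      using assms(1) \<Omega>m by (auto intro!: borel_measurable_scaleR borel_measurable_indicator)
    show "AE y in lebesgue. indicator \<Omega> y *\<^sub>R norm (f y) = norm (f y)"
      using assms(3) by eventually_elim (auto simp: indicator_def)
  qed
  then show "(LINT y:\<Omega>|lebesgue. norm (f y)) = (LINT y|lebesgue. norm (f y))" by (simp add: set_lebesgue_integral_def)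
qed

lemma Linf_integrable:
  assumes "z \<in> Linf \<Omega>" "bounded \<Omega>" shows "integrable lebesgue z" "z \<in> borel_measurable lebesgue"
proof -
  note L = assms(1)[unfolded Linf_def, THEN CollectD]
  show zm: "z \<in> borel_measurable lebesgue" using L by (rule conjunct1)
  obtain C where "AE y in lebesgue. norm (z y) \<le> C" using L by (elim conjE exE)
  from integrable_bounded_support[OF zm assms(2) this] L show "integrable lebesgue z" by (elim conjE)
qed

lemma Linf_diff_L1:
  assumes "z \<in> Linf \<Omega>" "w \<in> Linf \<Omega>" and \<Omega>: "open \<Omega>" "bounded \<Omega>" and m: "m > 1"
  shows "(LINT y|lebesgue. norm (w y - z y)) \<le> measure lebesgue \<Omega> powr (1 - 1 / m) * Lnorm m UNIV (\<lambda>y. w y - z y)"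
proof -
  obtain C where C: "AE y in lebesgue. norm (z y) \<le> C" using assms by (auto simp: Linf_def)
  obtain D where D: "AE y in lebesgue. norm (w y) \<le> D" using assms by (auto simp: Linf_def)
  have m1: "(\<lambda>y. w y - z y) \<in> borel_measurable lebesgue"
    using Linf_integrable(2)[OF assms(1) \<Omega>(2)] Linf_integrable(2)[OF assms(2) \<Omega>(2)] by simp
  have b: "AE y in lebesgue. norm (w y - z y) \<le> D + C"
    using C D by eventually_elim (rule order_trans[OF norm_triangle_ineq4], rule add_mono)
  have "AE y in lebesgue. y \<notin> \<Omega> \<longrightarrow> z y = 0" "AE y in lebesgue. y \<notin> \<Omega> \<longrightarrow> w y = 0" using assms(1,2) by (auto simp: Linf_def)
  then have o: "AE y in lebesgue. y \<notin> \<Omega> \<longrightarrow> w y - z y = 0" by eventually_elim auto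
  show ?thesis
    using L1_le_Lnorm[OF m1 b \<Omega> m] Lnorm_support[OF m1 \<Omega>(1) o] by simp
qed

lemma weak_star_metric_ball_open:
  assumes d: "weak_star_metric \<Omega> d" and z: "z \<in> X \<Omega>"
  obtains T where "openin (weak_star \<Omega>) T" "{w \<in> X \<Omega>. d z w < e} = T \<inter> X \<Omega>"
proof -
  note d' = d[unfolded weak_star_metric_def]
  let ?S = "{w \<in> X \<Omega>. d z w < e}"
  have "\<exists>\<delta>>0. \<forall>v\<in>X \<Omega>. d w v < \<delta> \<longrightarrow> v \<in> ?S" if w: "w \<in> ?S" for w
  proof (intro exI[of _ "e - d z w"] conjI ballI impI)
    show "0 < e - d z w" using w by simp
    fix v assume v: "v \<in> X \<Omega>" "d w v < e - d z w"
    have "d z v \<le> d z w + d w v" using d' z w v by blast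
    then show "v \<in> ?S" using v by simp
  qed
  then have ball: "\<forall>w\<in>?S. \<exists>\<delta>>0. \<forall>v\<in>X \<Omega>. d w v < \<delta> \<longrightarrow> v \<in> ?S" by (rule ballI)
  have "?S \<subseteq> X \<Omega>" by (rule Collect_restrict)
  from d'[THEN conjunct2, THEN conjunct2, THEN spec, THEN mp, OF this, THEN iffD2, OF ball]
  show ?thesis unfolding openin_subtopology by (elim exE conjE) (rule that)
qed

lemma weak_star_metric_self: "weak_star_metric \<Omega> d \<Longrightarrow> z \<in> X \<Omega> \<Longrightarrow> d z z = 0"
  unfolding weak_star_metric_def by simp

definition deficient :: "'n::finite spacetime set \<Rightarrow> real \<Rightarrow> ('n spacetime \<Rightarrow> 'n state) \<Rightarrow> 'n spacetime set" where
  "deficient \<Omega> \<delta> z = {y\<in>\<Omega>. (norm (fst (z y)))\<^sup>2 + (norm (fst (snd (z y))))\<^sup>2 \<le> 2 - \<delta>}"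

text \<open>A weak* neighbourhood of \<open>z\<close> on which the \<open>L\<^sup>m\<close> distance to \<open>z\<close> is small contains some \<open>a \<in> X0 \<Omega>\<close>, and with
it the perturbations of \<open>a\<close> from \<open>weak_star_perturbation\<close>. So \<open>a\<close> and its perturbation are both strongly close to
\<open>z\<close>, hence to each other, while their distance bounds the volume of the deficient set of \<open>a\<close>.\<close>

lemma continuity_point_approx:
  fixes z :: "'n::finite spacetime \<Rightarrow> 'n state"
  assumes n: "CARD('n) \<ge> 4" and \<Omega>: "open \<Omega>" "bounded \<Omega>" and z: "z \<in> X \<Omega>" and m: "m \<ge> 2"
    and cp: "continuity_point \<Omega> m z" and \<delta>: "\<delta> > 0"
  obtains a where "\<And>k. a k \<in> X0 \<Omega>" "(\<lambda>k. LINT y|lebesgue. norm (a k y - z y)) \<longlonglongrightarrow> 0"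
    "(\<lambda>k. measure lebesgue (deficient \<Omega> \<delta> (a k))) \<longlonglongrightarrow> 0"
proof -
  obtain d where d: "weak_star_metric \<Omega> d"
    and c: "\<And>e. e > 0 \<Longrightarrow> \<exists>\<delta>>0. \<forall>w\<in>X \<Omega>. d z w < \<delta> \<longrightarrow> Lnorm m UNIV (\<lambda>y. w y - z y) < e"
    using cp unfolding continuity_point_def by blast
  define \<kappa> where "\<kappa> = wave_gain TYPE('n) * segment_gain TYPE('n) \<delta> / 2"
  have \<kappa>: "\<kappa> > 0" unfolding \<kappa>_def using segment_gain_pos[OF \<delta>, where 'n = 'n] by (simp add: wave_gain_def)
  define A where "A = measure lebesgue \<Omega> powr (1 - 1 / m)"
  have A: "A \<ge> 0" by (simp add: A_def)
  note zL = X_Linf[OF z]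
  have step: "\<exists>a\<in>X0 \<Omega>. (LINT y|lebesgue. norm (a y - z y)) \<le> A * e \<and> \<kappa> * measure lebesgue (deficient \<Omega> \<delta> a) \<le> 2 * (A * e)"
    if e: "e > 0" for e
  proof -
    obtain \<delta>' where \<delta>': "\<delta>' > 0" "\<And>w. w \<in> X \<Omega> \<Longrightarrow> d z w < \<delta>' \<Longrightarrow> Lnorm m UNIV (\<lambda>y. w y - z y) < e"
      using c[OF e] by blast
    have close: "(LINT y|lebesgue. norm (w y - z y)) \<le> A * e" if "w \<in> X \<Omega>" "d z w < \<delta>'" for w
      using Linf_diff_L1[OF zL X_Linf[OF that(1)] \<Omega>, of m] m
        mult_left_mono[OF less_imp_le[OF \<delta>'(2)[OF that]] A]
      unfolding A_def[symmetric] by linarith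
    obtain T where T: "openin (weak_star \<Omega>) T" "{w \<in> X \<Omega>. d z w < \<delta>' / 2} = T \<inter> X \<Omega>"
      using weak_star_metric_ball_open[OF d z] by blast
    have "z \<in> T \<inter> X \<Omega>" unfolding T(2)[symmetric] using z weak_star_metric_self[OF d z] \<delta>'(1) by simp
    then have zT: "z \<in> T" by (rule IntD1)
    have "\<forall>T. z \<in> T \<and> openin (weak_star \<Omega>) T \<longrightarrow> (\<exists>y. y \<in> X0 \<Omega> \<and> y \<in> T)"
      using z unfolding X_def in_closure_of by (rule conjunct2)
    with zT T(1) obtain a where a: "a \<in> X0 \<Omega>" "a \<in> T" by metis
    have aX: "a \<in> X \<Omega>" by (rule X0_X[OF a(1) \<Omega>(2)])
    have da: "d z a < \<delta>' / 2" using IntI[OF a(2) aX] unfolding T(2)[symmetric] by simp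
    obtain zs where zs: "\<And>N. zs N \<in> X0 \<Omega>"
      "\<And>g. integrable lebesgue g \<Longrightarrow> (\<lambda>N. LINT y|lebesgue. zs N y \<bullet> g y) \<longlonglongrightarrow> (LINT y|lebesgue. a y \<bullet> g y)"
      "\<And>N. (LINT y|lebesgue. norm (zs N y - a y)) \<ge> \<kappa> * measure lebesgue (deficient \<Omega> \<delta> a)"
      by (rule weak_star_perturbation[OF n \<Omega> a(1) \<delta>, folded deficient_def \<kappa>_def]) (rule that; assumption)
    obtain T' where T': "openin (weak_star \<Omega>) T'" "{w \<in> X \<Omega>. d a w < \<delta>' / 2} = T' \<inter> X \<Omega>"
      using weak_star_metric_ball_open[OF d aX] by blast
    have "a \<in> T' \<inter> X \<Omega>" unfolding T'(2)[symmetric] using aX weak_star_metric_self[OF d aX] \<delta>'(1) by simp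
    then have "a \<in> T'" by (rule IntD1)
    from weak_star_eventually[OF T'(1) this X0_Linf[OF zs(1) \<Omega>(2)] zs(2)]
    obtain N where N: "zs N \<in> T'" unfolding eventually_sequentially by blast
    define w where "w = zs N"
    have wX: "w \<in> X \<Omega>" using X0_X[OF zs(1) \<Omega>(2)] by (simp add: w_def)
    have "d a w < \<delta>' / 2" using IntI[OF N[folded w_def] wX] unfolding T'(2)[symmetric] by simp
    moreover have "d z w \<le> d z a + d a w"
      using d[unfolded weak_star_metric_def, THEN conjunct2, THEN conjunct1] z aX wX by (elim ballE) auto
    ultimately have dw: "d z w < \<delta>'" using da by linarith
    have 1: "(LINT y|lebesgue. norm (a y - z y)) \<le> A * e" using close[OF aX] da \<delta>'(1) by simp
    have 2: "(LINT y|lebesgue. norm (w y - z y)) \<le> A * e" using close[OF wX dw] .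
    have i: "integrable lebesgue a" "integrable lebesgue w" "integrable lebesgue z"
      using Linf_integrable(1)[OF X_Linf[OF aX] \<Omega>(2)] Linf_integrable(1)[OF X_Linf[OF wX] \<Omega>(2)] Linf_integrable(1)[OF zL \<Omega>(2)] .
    have "(LINT y|lebesgue. norm (w y - a y)) \<le> (LINT y|lebesgue. norm (w y - z y) + norm (a y - z y))"
    proof (rule integral_mono)
      show "norm (w y - a y) \<le> norm (w y - z y) + norm (a y - z y)" for y
        using norm_triangle_ineq4[of "w y - z y" "a y - z y"] by simp
    qed (use i in auto)
    also have "\<dots> = (LINT y|lebesgue. norm (w y - z y)) + (LINT y|lebesgue. norm (a y - z y))"
      using i by (intro Bochner_Integration.integral_add) auto
    finally have "\<kappa> * measure lebesgue (deficient \<Omega> \<delta> a) \<le> 2 * (A * e)"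
      using zs(3)[of N] 1 2 unfolding w_def by linarith
    with 1 a(1) show ?thesis by blast
  qed
  define e where "e k = 1 / real (Suc k)" for k
  have e0: "e \<longlonglongrightarrow> 0" unfolding e_def by (rule LIMSEQ_Suc, rule lim_1_over_n)
  have "e k > 0" for k by (simp add: e_def)
  then have "\<exists>a. \<forall>k. a k \<in> X0 \<Omega> \<and> (LINT y|lebesgue. norm (a k y - z y)) \<le> A * e k \<and> \<kappa> * measure lebesgue (deficient \<Omega> \<delta> (a k)) \<le> 2 * (A * e k)"
    using step by (intro choice allI) blast
  then obtain a where a: "\<And>k. a k \<in> X0 \<Omega>" "\<And>k. (LINT y|lebesgue. norm (a k y - z y)) \<le> A * e k"
    "\<And>k. \<kappa> * measure lebesgue (deficient \<Omega> \<delta> (a k)) \<le> 2 * (A * e k)" by blast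
  have Ae: "(\<lambda>k. A * e k) \<longlonglongrightarrow> 0" using tendsto_mult_right_zero[OF e0] .
  show ?thesis
  proof (rule that[OF a(1)])
    show "(\<lambda>k. LINT y|lebesgue. norm (a k y - z y)) \<longlonglongrightarrow> 0"
      by (rule tendsto_sandwich[OF _ _ tendsto_const Ae]) (use a(2) in auto)
    have "(\<lambda>k. 2 * (A * e k) / \<kappa>) \<longlonglongrightarrow> 2 * 0 / \<kappa>" using \<kappa> by (intro tendsto_intros Ae) auto
    then have lim0: "(\<lambda>k. 2 * (A * e k) / \<kappa>) \<longlonglongrightarrow> 0" by simp
    have "measure lebesgue (deficient \<Omega> \<delta> (a k)) \<le> 2 * (A * e k) / \<kappa>" for k
      using a(3)[of k] \<kappa> by (simp add: field_simps)
    then show "(\<lambda>k. measure lebesgue (deficient \<Omega> \<delta> (a k))) \<longlonglongrightarrow> 0"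
      by (intro tendsto_sandwich[OF _ _ tendsto_const lim0] always_eventually allI measure_nonneg)
  qed
qed

lemma L1_limit_AE:
  fixes z :: "'n::finite spacetime \<Rightarrow> 'n state"
  assumes a: "\<And>k. a k \<in> X0 \<Omega>" and \<Omega>: "bounded \<Omega>" and z: "z \<in> Linf \<Omega>"
    and lim: "(\<lambda>k. LINT y|lebesgue. norm (a k y - z y)) \<longlonglongrightarrow> 0"
  obtains r where "strict_mono (r :: nat \<Rightarrow> nat)" "AE y in lebesgue. (\<lambda>k. a (r k) y) \<longlonglongrightarrow> z y"
proof -
  have "integrable lebesgue (\<lambda>y. a k y - z y)" for k
    using Linf_integrable(1)[OF X0_Linf[OF a \<Omega>] \<Omega>] Linf_integrable(1)[OF z \<Omega>] by simp
  from tendsto_L1_AE_subseq[OF this lim] obtain r where r: "strict_mono r" "AE y in lebesgue. (\<lambda>k. a (r k) y - z y) \<longlonglongrightarrow> 0" by blast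
  have "AE y in lebesgue. (\<lambda>k. a (r k) y) \<longlonglongrightarrow> z y"
    using r(2) by eventually_elim (simp add: LIM_zero_iff)
  with r(1) show ?thesis by (rule that)
qed

lemma L1_limit_box:
  fixes z :: "'n::finite spacetime \<Rightarrow> 'n state"
  assumes a: "\<And>k. a k \<in> X0 \<Omega>" and \<Omega>: "bounded \<Omega>" and z: "z \<in> Linf \<Omega>"
    and lim: "(\<lambda>k. LINT y|lebesgue. norm (a k y - z y)) \<longlonglongrightarrow> 0"
  shows "AE y in lebesgue. z y \<in> relaxed_box"
proof -
  obtain r where r: "strict_mono r" "AE y in lebesgue. (\<lambda>k. a (r k) y) \<longlonglongrightarrow> z y"
    by (rule L1_limit_AE[OF a \<Omega> z lim])
  from r(2) show ?thesis
  proof eventually_elim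
    case (elim y)
    show ?case
      by (rule closed_sequentially[OF closed_relaxed_box _ elim]) (use X0_Uset[OF a] Uset_sub_box in blast)
  qed
qed

text \<open>Pass to a subsequence along which both \<open>a k\<close> and the indicators of the deficient sets converge almost
everywhere.\<close>

lemma deficient_limit:
  fixes z :: "'n::finite spacetime \<Rightarrow> 'n state"
  assumes a: "\<And>k. a k \<in> X0 \<Omega>" and \<Omega>: "open \<Omega>" "bounded \<Omega>" and z: "z \<in> Linf \<Omega>"
    and lim: "(\<lambda>k. LINT y|lebesgue. norm (a k y - z y)) \<longlonglongrightarrow> 0"
    and def: "(\<lambda>k. measure lebesgue (deficient \<Omega> \<delta> (a k))) \<longlonglongrightarrow> 0"
  shows "AE y in lebesgue. y \<in> \<Omega> \<longrightarrow> 2 - \<delta> \<le> (norm (fst (z y)))\<^sup>2 + (norm (fst (snd (z y))))\<^sup>2"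
proof -
  obtain r where r: "strict_mono r" "AE y in lebesgue. (\<lambda>k. a (r k) y) \<longlonglongrightarrow> z y"
    by (rule L1_limit_AE[OF a \<Omega>(2) z lim])
  have Dm: "deficient \<Omega> \<delta> (a k) \<in> sets lebesgue" for k
  proof -
    have c: "continuous_on UNIV (a k)" using smooth_continuous[OF X0_smooth[OF a]] .
    have "closed {y. (norm (fst (a k y)))\<^sup>2 + (norm (fst (snd (a k y))))\<^sup>2 \<le> 2 - \<delta>}"
      by (intro closed_Collect_le continuous_intros c)
    moreover have "deficient \<Omega> \<delta> (a k) = \<Omega> \<inter> {y. (norm (fst (a k y)))\<^sup>2 + (norm (fst (snd (a k y))))\<^sup>2 \<le> 2 - \<delta>}"
      unfolding deficient_def by (rule Collect_conj_eq[of "\<lambda>y. y \<in> \<Omega>", unfolded Collect_mem_eq])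
    ultimately have "deficient \<Omega> \<delta> (a k) \<in> sets borel" using \<Omega>(1) by (simp only: sets.Int borel_open borel_closed)
    then show ?thesis by simp
  qed
  let ?i = "\<lambda>k y. indicator (deficient \<Omega> \<delta> (a (r k))) y :: real"
  have ii: "integrable lebesgue (?i k)" for k
    by (rule integrable_bounded_support[of _ \<Omega> 1, OF borel_measurable_indicator[OF Dm] \<Omega>(2)])
      (auto simp: deficient_def indicator_def)
  have "(\<lambda>k. LINT y|lebesgue. norm (?i k y)) \<longlonglongrightarrow> 0"
    using LIMSEQ_subseq_LIMSEQ[OF def r(1)] by (simp add: o_def)
  from tendsto_L1_AE_subseq[OF ii this] obtain s where s: "strict_mono s" "AE y in lebesgue. (\<lambda>k. ?i (s k) y) \<longlonglongrightarrow> 0" by blast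
  show ?thesis using r(2) s(2)
  proof eventually_elim
    case (elim y)
    show ?case
    proof
      assume y: "y \<in> \<Omega>"
      have "eventually (\<lambda>k. ?i (s k) y < 1) sequentially" using order_tendstoD(2)[OF elim(2), of 1] by simp
      then have ev: "eventually (\<lambda>k. 2 - \<delta> \<le> (norm (fst (a (r (s k)) y)))\<^sup>2 + (norm (fst (snd (a (r (s k)) y))))\<^sup>2) sequentially"
      proof eventually_elim
        case (elim k)
        then have "y \<notin> deficient \<Omega> \<delta> (a (r (s k)))" by (auto simp: indicator_def split: if_splits)
        then show ?case using y unfolding deficient_def by simp
      qed
      have "(\<lambda>k. a (r (s k)) y) \<longlonglongrightarrow> z y" using LIMSEQ_subseq_LIMSEQ[OF elim(1) s(1)] by (simp add: o_def)
      then have "(\<lambda>k. (norm (fst (a (r (s k)) y)))\<^sup>2 + (norm (fst (snd (a (r (s k)) y))))\<^sup>2) \<longlonglongrightarrow> (norm (fst (z y)))\<^sup>2 + (norm (fst (snd (z y))))\<^sup>2"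
        by (intro tendsto_intros)
      from tendsto_lowerbound[OF this ev] show "2 - \<delta> \<le> (norm (fst (z y)))\<^sup>2 + (norm (fst (snd (z y))))\<^sup>2" by simp
    qed
  qed
qed

lemma continuity_point_saturated:
  fixes z :: "'n::finite spacetime \<Rightarrow> 'n state"
  assumes n: "CARD('n) \<ge> 4" and \<Omega>: "open \<Omega>" "bounded \<Omega>" and z: "z \<in> X \<Omega>" and m: "m \<ge> 2"
    and cp: "continuity_point \<Omega> m z"
  obtains a where "\<And>k. a k \<in> X0 \<Omega>" "(\<lambda>k. LINT y|lebesgue. norm (a k y - z y)) \<longlonglongrightarrow> 0"
    "AE y in lebesgue. y \<in> \<Omega> \<longrightarrow> norm (fst (z y)) = 1 \<and> norm (fst (snd (z y))) = 1"
proof -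
  note zL = X_Linf[OF z]
  have "AE y in lebesgue. y \<in> \<Omega> \<longrightarrow> 2 - \<delta> \<le> (norm (fst (z y)))\<^sup>2 + (norm (fst (snd (z y))))\<^sup>2" if "\<delta> > 0" for \<delta>
    by (rule continuity_point_approx[OF n \<Omega> z m cp that]) (rule deficient_limit[OF _ \<Omega> zL])
  then have 1: "AE y in lebesgue. \<forall>j::nat. y \<in> \<Omega> \<longrightarrow> 2 - 1 / real (Suc j) \<le> (norm (fst (z y)))\<^sup>2 + (norm (fst (snd (z y))))\<^sup>2"
    by (subst AE_all_countable) simp
  obtain a where a: "\<And>k. a k \<in> X0 \<Omega>" "(\<lambda>k. LINT y|lebesgue. norm (a k y - z y)) \<longlonglongrightarrow> 0"
    using continuity_point_approx[OF n \<Omega> z m cp, of 1] by auto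
  from 1 L1_limit_box[OF a(1) \<Omega>(2) zL a(2)] have "AE y in lebesgue. y \<in> \<Omega> \<longrightarrow> norm (fst (z y)) = 1 \<and> norm (fst (snd (z y))) = 1"
  proof eventually_elim
    case (elim y)
    obtain u b M Q q where zy: "z y = (u, b, M, Q, q)" by (cases "z y")
    have ub: "norm u \<le> 1" "norm b \<le> 1" using elim(2) hull_Kset_bounds by (auto simp: zy relaxed_box_def)
    show ?case
    proof
      assume y: "y \<in> \<Omega>"
      have "(\<lambda>j. 2 - 1 / real (Suc j)) \<longlonglongrightarrow> 2 - 0" by (intro tendsto_intros LIMSEQ_Suc lim_1_over_n)
      then have "2 - 0 \<le> (norm u)\<^sup>2 + (norm b)\<^sup>2"
        by (rule LIMSEQ_le_const2) (use elim(1) y zy in auto)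
      moreover have "(norm u)\<^sup>2 \<le> 1" "(norm b)\<^sup>2 \<le> 1" using ub by (auto simp: power_le_one)
      ultimately have "(norm u)\<^sup>2 = 1" "(norm b)\<^sup>2 = 1" by linarith+
      then show "norm (fst (z y)) = 1 \<and> norm (fst (snd (z y))) = 1"
        using norm_ge_zero[of u] norm_ge_zero[of b] unfolding zy power2_eq_1_iff by auto
    qed
  qed
  with a show ?thesis by (rule that)
qed

section \<open>Mollification\<close>

definition kernel :: "('a::euclidean_space \<Rightarrow> real) \<Rightarrow> real \<Rightarrow> 'a \<Rightarrow> real" where
  "kernel \<rho> r v = \<rho> (v /\<^sub>R r) / r ^ DIM('a)"

lemma mollify_kernel: "mollify \<rho> r f y = (LINT w|lebesgue. kernel \<rho> r (y - w) *\<^sub>R f w)"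
  by (simp add: mollify_def kernel_def)

text \<open>Lebesgue measure on a product is the completion of a product measure, so Tonelli's theorem is applied to
a Borel measurable representative.\<close>

lemma borel_representative:
  fixes f :: "'a::euclidean_space \<Rightarrow> 'b::euclidean_space"
  assumes f: "f \<in> borel_measurable lebesgue"
  obtains g where "g \<in> borel_measurable borel" "AE y in lebesgue. f y = g y"
proof -
  have "\<exists>g. g \<in> borel_measurable lborel \<and> (AE y in lborel. f y \<bullet> e = g y)" for e
    using completion_ex_borel_measurable_real[of "\<lambda>y. f y \<bullet> e" lborel] f by auto
  then obtain g where g: "\<And>e. g e \<in> borel_measurable lborel" "\<And>e. AE y in lborel. f y \<bullet> e = g e y" by metis
  define G where "G y = (\<Sum>e\<in>Basis. g e y *\<^sub>R e)" for y
  have "G \<in> borel_measurable borel" unfolding G_def using g(1) by (intro borel_measurable_sum borel_measurable_scaleR) auto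
  moreover have "AE y in lborel. \<forall>e\<in>Basis. f y \<bullet> e = g e y" using g(2) by (subst AE_finite_all) auto
  then have "AE y in lborel. f y = G y"
  proof eventually_elim
    case (elim y)
    then have "G y = (\<Sum>e\<in>Basis. (f y \<bullet> e) *\<^sub>R e)" unfolding G_def by (intro sum.cong) auto
    then show ?case by (simp only: euclidean_representation)
  qed
  then have "AE y in lebesgue. f y = G y" by (rule AE_completion)
  ultimately show ?thesis by (rule that)
qed

context
  fixes \<rho> :: "'a::euclidean_space \<Rightarrow> real" and r :: real
  assumes \<rho>: "mollifier \<rho>" and r: "r > 0"
begin

lemma mollifier_Cc: "\<rho> \<in> Cc_infty"
proof (rule Cc_inftyI[OF _ compact_cball])
  show "smooth \<rho>" using \<rho> by (simp add: mollifier_def)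
  show "\<rho> y = 0" if "y \<notin> cball 0 1" for y using \<rho> that not_fun_supp[of y \<rho>] unfolding mollifier_def by blast
qed

lemma kernel_nonneg: "0 \<le> kernel \<rho> r v"
  using \<rho> r by (auto simp: kernel_def mollifier_def)

lemma kernel_outside: assumes "norm v > r" shows "kernel \<rho> r v = 0"
proof -
  have "norm (v /\<^sub>R r) > 1" using assms r by (simp add: field_simps)
  then have "v /\<^sub>R r \<notin> fun_supp \<rho>" using \<rho> by (force simp: mollifier_def)
  then show ?thesis by (simp add: kernel_def not_fun_supp)
qed

lemma kernel_continuous: "continuous_on UNIV (kernel \<rho> r)"
proof -
  have "continuous_on UNIV \<rho>" using \<rho> smooth_continuous by (auto simp: mollifier_def)
  then have "continuous_on UNIV (\<lambda>v. \<rho> (v /\<^sub>R r))" by (rule continuous_on_compose2) (auto intro!: continuous_intros)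
  then show ?thesis unfolding kernel_def[abs_def] using r by (intro continuous_intros) auto
qed

lemma kernel_borel [measurable]: "kernel \<rho> r \<in> borel_measurable borel"
  by (rule borel_measurable_continuous_onI[OF kernel_continuous])

lemma kernel_integral: "integrable lebesgue (kernel \<rho> r)" "(LINT v|lebesgue. kernel \<rho> r v) = 1"
proof -
  have i: "integrable lebesgue \<rho>" by (rule Cc_infty_integrable[OF mollifier_Cc])
  have e: "kernel \<rho> r = (\<lambda>v. \<rho> (0 + (1 / r) *\<^sub>R v) / r ^ DIM('a))" by (simp add: kernel_def fun_eq_iff inverse_eq_divide)
  show "integrable lebesgue (kernel \<rho> r)" unfolding e using integrable_affine(1)[OF _ i, of "1 / r" 0] r by simp
  show "(LINT v|lebesgue. kernel \<rho> r v) = 1" unfolding e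
    using integrable_affine(2)[OF _ i, of "1 / r" 0] r \<rho> by (simp add: mollifier_def power_divide)
qed

lemma kernel_reflect: "integrable lebesgue (\<lambda>w. kernel \<rho> r (y - w))" "(LINT w|lebesgue. kernel \<rho> r (y - w)) = 1"
  using integrable_affine[OF _ kernel_integral(1), of "-1" y] kernel_integral(2) by simp_all

lemma kernel_bound: obtains B where "\<And>v. norm (kernel \<rho> r v) \<le> B"
proof -
  obtain B where "\<And>v. norm (\<rho> v) \<le> B" using compact_support_bounded[OF mollifier_Cc] by blast
  then have "norm (kernel \<rho> r v) \<le> B / r ^ DIM('a)" for v
    using r by (simp add: kernel_def divide_right_mono)
  then show ?thesis by (rule that)
qed

lemma mollify_integrable:
  fixes f :: "'a \<Rightarrow> 'b::euclidean_space"
  assumes f: "integrable lebesgue f"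
  shows "integrable lebesgue (\<lambda>w. kernel \<rho> r (y - w) *\<^sub>R f w)"
proof -
  obtain B where B: "\<And>v. norm (kernel \<rho> r v) \<le> B" using kernel_bound by blast
  show ?thesis
  proof (rule Bochner_Integration.integrable_bound)
    show "integrable lebesgue (\<lambda>w. B *\<^sub>R f w)" using f by simp
    show "(\<lambda>w. kernel \<rho> r (y - w) *\<^sub>R f w) \<in> borel_measurable lebesgue"
      using kernel_reflect(1)[of y] f by (intro borel_measurable_scaleR) (simp_all only: borel_measurable_integrable)
    have "norm (kernel \<rho> r (y - w) *\<^sub>R f w) \<le> norm (B *\<^sub>R f w)" for w
      unfolding norm_scaleR using B[of "y - w"] by (intro mult_right_mono) auto
    then show "AE w in lebesgue. norm (kernel \<rho> r (y - w) *\<^sub>R f w) \<le> norm (B *\<^sub>R f w)" by simp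
  qed
qed

lemma mollify_diff:
  fixes f g :: "'a \<Rightarrow> 'b::euclidean_space"
  assumes "integrable lebesgue f" "integrable lebesgue g"
  shows "mollify \<rho> r (\<lambda>y. f y - g y) y = mollify \<rho> r f y - mollify \<rho> r g y"
  using mollify_integrable[OF assms(1)] mollify_integrable[OF assms(2)]
  by (simp add: mollify_kernel scaleR_diff_right)

lemma mollify_bound:
  fixes f :: "'a \<Rightarrow> 'b::euclidean_space"
  assumes f: "integrable lebesgue f" "AE y in lebesgue. norm (f y) \<le> C"
  shows "norm (mollify \<rho> r f y) \<le> C"
proof -
  have "norm (mollify \<rho> r f y) \<le> (LINT w|lebesgue. kernel \<rho> r (y - w) * C)"
    unfolding mollify_kernel
  proof (rule order_trans[OF integral_norm_bound integral_mono_AE])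
    show "AE w in lebesgue. norm (kernel \<rho> r (y - w) *\<^sub>R f w) \<le> kernel \<rho> r (y - w) * C"
      using f(2) by eventually_elim (use kernel_nonneg in \<open>auto intro!: mult_left_mono\<close>)
    show "integrable lebesgue (\<lambda>w. norm (kernel \<rho> r (y - w) *\<^sub>R f w))" by (rule integrable_norm[OF mollify_integrable[OF f(1)]])
    show "integrable lebesgue (\<lambda>w. kernel \<rho> r (y - w) * C)" using kernel_reflect(1) by simp
  qed
  also have "\<dots> = C" using kernel_reflect(2) by simp
  finally show ?thesis .
qed

lemma mollify_borel:
  fixes f :: "'a \<Rightarrow> 'b::euclidean_space"
  assumes f: "f \<in> borel_measurable lebesgue"
  shows "mollify \<rho> r f \<in> borel_measurable borel"
proof -
  obtain g where g[measurable]: "g \<in> borel_measurable borel" "AE y in lebesgue. f y = g y" using borel_representative[OF f] .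
  have km: "(\<lambda>w. kernel \<rho> r (y - w)) \<in> borel_measurable lborel" for y by measurable
  have "mollify \<rho> r f = (\<lambda>y. LINT w|lborel. kernel \<rho> r (y - w) *\<^sub>R g w)"
  proof
    fix y
    have m1: "(\<lambda>w. kernel \<rho> r (y - w) *\<^sub>R g w) \<in> borel_measurable lborel" by measurable
    have "mollify \<rho> r f y = (LINT w|lebesgue. kernel \<rho> r (y - w) *\<^sub>R g w)"
      unfolding mollify_kernel
    proof (rule integral_cong_AE)
      show "(\<lambda>w. kernel \<rho> r (y - w) *\<^sub>R f w) \<in> borel_measurable lebesgue"
        using measurable_completion[OF km] f by (intro borel_measurable_scaleR) auto
      show "(\<lambda>w. kernel \<rho> r (y - w) *\<^sub>R g w) \<in> borel_measurable lebesgue" by (rule measurable_completion[OF m1])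
      show "AE w in lebesgue. kernel \<rho> r (y - w) *\<^sub>R f w = kernel \<rho> r (y - w) *\<^sub>R g w" using g(2) by eventually_elim simp
    qed
    then show "mollify \<rho> r f y = (LINT w|lborel. kernel \<rho> r (y - w) *\<^sub>R g w)" by (simp add: integral_completion[OF m1])
  qed
  moreover have "(\<lambda>y. LINT w|lborel. kernel \<rho> r (y - w) *\<^sub>R g w) \<in> borel_measurable borel" by measurable
  ultimately show ?thesis by simp
qed

text \<open>\<open>f * \<rho>\<^sub>r - f\<close> is an average of differences of \<open>f\<close> with translates by vectors of length at most \<open>r\<close>; exchange
the average and the \<open>L\<^sup>1\<close> norm.\<close>

lemma mollify_L1_error:
  fixes f :: "'a \<Rightarrow> 'b::euclidean_space"
  assumes f: "integrable lebesgue f"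
    and e: "\<And>h. norm h \<le> r \<Longrightarrow> (LINT y|lebesgue. norm (f (y + h) - f y)) \<le> e"
  shows "integrable lebesgue (\<lambda>y. norm (mollify \<rho> r f y - f y))" "(LINT y|lebesgue. norm (mollify \<rho> r f y - f y)) \<le> e"
proof -
  have fm: "f \<in> borel_measurable lebesgue" using f by (simp add: borel_measurable_integrable)
  obtain g where g[measurable]: "g \<in> borel_measurable borel" and ae: "AE y in lebesgue. f y = g y" using borel_representative[OF fm] .
  have gi: "integrable lebesgue g"
    using integrable_cong_AE[OF fm measurable_completion ae] f g by simp
  have e0: "0 \<le> e" using order_trans[OF integral_nonneg_AE e[of 0]] r by auto
  have mf: "mollify \<rho> r f = mollify \<rho> r g"
  proof
    fix y show "mollify \<rho> r f y = mollify \<rho> r g y"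
      unfolding mollify_kernel
      by (rule integral_cong_AE)
        (use mollify_integrable[OF f] mollify_integrable[OF gi] ae in \<open>auto simp: borel_measurable_integrable elim: eventually_mono\<close>)
  qed
  have ge: "(\<integral>\<^sup>+y. ennreal (norm (g (y + h) - g y)) \<partial>lborel) \<le> ennreal e" if h: "norm h \<le> r" for h
  proof -
    have m1: "(\<lambda>y. norm (g (y + h) - g y)) \<in> borel_measurable lborel" by measurable
    have i: "integrable lebesgue (\<lambda>y. norm (g (y + h) - g y))" using gi integrable_shift(1)[OF gi] by simp
    have aeh: "AE y in lebesgue. f (y + h) = g (y + h)"
    proof -
      have "AE y in lborel. f y = g y" using ae by (simp add: AE_completion_iff)
      then have "AE y in distr lborel borel ((+) h). f y = g y" unfolding lborel_distr_plus .
      then have "AE y in lborel. f (h + y) = g (h + y)" by (rule AE_distrD[rotated]) simp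
      then show ?thesis by (simp add: add.commute AE_completion_iff)
    qed
    have "(\<integral>\<^sup>+y. ennreal (norm (g (y + h) - g y)) \<partial>lborel) = (\<integral>\<^sup>+y. ennreal (norm (g (y + h) - g y)) \<partial>lebesgue)"
      by (simp add: nn_integral_completion)
    also have "\<dots> = ennreal (LINT y|lebesgue. norm (g (y + h) - g y))" by (intro nn_integral_eq_integral i) auto
    also have "(LINT y|lebesgue. norm (g (y + h) - g y)) = (LINT y|lebesgue. norm (f (y + h) - f y))"
    proof (rule integral_cong_AE)
      show "AE y in lebesgue. norm (g (y + h) - g y) = norm (f (y + h) - f y)" using ae aeh by eventually_elim simp
    qed (use i f integrable_shift(1)[OF f, of h] in \<open>auto simp: borel_measurable_integrable\<close>)
    also have "ennreal \<dots> \<le> ennreal e" using e[OF h] by (rule ennreal_leI)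
    finally show ?thesis .
  qed
  have pt: "ennreal (norm (mollify \<rho> r g y - g y)) \<le> (\<integral>\<^sup>+v. ennreal (kernel \<rho> r v) * ennreal (norm (g (y - v) - g y)) \<partial>lborel)" for y
  proof -
    have i1: "integrable lebesgue (\<lambda>v. kernel \<rho> r v *\<^sub>R g (y - v))"
      and e1: "mollify \<rho> r g y = (LINT v|lebesgue. kernel \<rho> r v *\<^sub>R g (y - v))"
      using integrable_affine[OF _ mollify_integrable[OF gi, of y], of "- 1" y] by (simp_all add: mollify_kernel)
    have i2: "integrable lebesgue (\<lambda>v. kernel \<rho> r v *\<^sub>R g y)"
      and e2: "g y = (LINT v|lebesgue. kernel \<rho> r v *\<^sub>R g y)"
      using kernel_integral by simp_all
    have "mollify \<rho> r g y - g y = (LINT v|lebesgue. kernel \<rho> r v *\<^sub>R g (y - v)) - (LINT v|lebesgue. kernel \<rho> r v *\<^sub>R g y)"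
      using e1 e2 by simp
    also have "\<dots> = (LINT v|lebesgue. kernel \<rho> r v *\<^sub>R g (y - v) - kernel \<rho> r v *\<^sub>R g y)"
      by (rule Bochner_Integration.integral_diff[OF i1 i2, symmetric])
    finally have "ennreal (norm (mollify \<rho> r g y - g y)) \<le> (\<integral>\<^sup>+v. ennreal (norm (kernel \<rho> r v *\<^sub>R g (y - v) - kernel \<rho> r v *\<^sub>R g y)) \<partial>lebesgue)"
      using integral_norm_bound_ennreal[OF Bochner_Integration.integrable_diff[OF i1 i2]] by simp
    also have "\<dots> = (\<integral>\<^sup>+v. ennreal (kernel \<rho> r v) * ennreal (norm (g (y - v) - g y)) \<partial>lborel)"
      by (subst nn_integral_completion, intro nn_integral_cong)
        (simp add: scaleR_diff_right[symmetric] kernel_nonneg ennreal_mult'[symmetric])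
    finally show ?thesis .
  qed
  have kp: "(\<integral>\<^sup>+v. ennreal (kernel \<rho> r v) \<partial>lborel) = 1"
  proof -
    have "(\<integral>\<^sup>+v. ennreal (kernel \<rho> r v) \<partial>lebesgue) = ennreal (LINT v|lebesgue. kernel \<rho> r v)"
      by (intro nn_integral_eq_integral kernel_integral(1) AE_I2 kernel_nonneg)
    then show ?thesis by (simp add: kernel_integral(2) nn_integral_completion)
  qed
  have mb[measurable]: "mollify \<rho> r g \<in> borel_measurable borel"
    by (rule mollify_borel) (rule measurable_completion, simp)
  have "(\<integral>\<^sup>+y. ennreal (norm (mollify \<rho> r g y - g y)) \<partial>lborel)
      \<le> (\<integral>\<^sup>+y. (\<integral>\<^sup>+v. ennreal (kernel \<rho> r v) * ennreal (norm (g (y - v) - g y)) \<partial>lborel) \<partial>lborel)"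
    by (intro nn_integral_mono pt)
  also have "\<dots> = (\<integral>\<^sup>+v. (\<integral>\<^sup>+y. ennreal (kernel \<rho> r v) * ennreal (norm (g (y - v) - g y)) \<partial>lborel) \<partial>lborel)"
    by (rule lborel_pair.Fubini'[symmetric]) measurable
  also have "\<dots> \<le> (\<integral>\<^sup>+v. ennreal (kernel \<rho> r v) * ennreal e \<partial>lborel)"
  proof (rule nn_integral_mono)
    fix v
    have m1: "(\<lambda>y. ennreal (norm (g (y - v) - g y))) \<in> borel_measurable lborel" by measurable
    show "(\<integral>\<^sup>+y. ennreal (kernel \<rho> r v) * ennreal (norm (g (y - v) - g y)) \<partial>lborel) \<le> ennreal (kernel \<rho> r v) * ennreal e"
    proof (cases "norm v \<le> r")
      case True
      then show ?thesis unfolding nn_integral_cmult[OF m1] using ge[of "- v"] by (intro mult_left_mono) auto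
    next
      case False
      then show ?thesis by (simp add: kernel_outside)
    qed
  qed
  also have "\<dots> = ennreal e"
  proof -
    have m1: "(\<lambda>v. ennreal (kernel \<rho> r v)) \<in> borel_measurable lborel" by measurable
    show ?thesis unfolding nn_integral_multc[OF m1] kp by simp
  qed
  finally have L: "(\<integral>\<^sup>+y. ennreal (norm (mollify \<rho> r g y - g y)) \<partial>lebesgue) \<le> ennreal e"
    by (simp add: nn_integral_completion)
  have mm: "(\<lambda>y. norm (mollify \<rho> r g y - g y)) \<in> borel_measurable lebesgue"
    by (rule measurable_completion) measurable
  have gint: "integrable lebesgue (\<lambda>y. norm (mollify \<rho> r g y - g y))"
    by (rule integrableI_nonneg[OF mm]) (use L in \<open>auto simp: le_less_trans[OF L]\<close>)
  have "ennreal (LINT y|lebesgue. norm (mollify \<rho> r g y - g y)) \<le> ennreal e"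
    using L by (subst nn_integral_eq_integral[OF gint, symmetric]) auto
  then have gle: "(LINT y|lebesgue. norm (mollify \<rho> r g y - g y)) \<le> e" using e0 by (simp add: ennreal_le_iff)
  have fgm: "(\<lambda>y. norm (mollify \<rho> r f y - f y)) \<in> borel_measurable lebesgue"
  proof -
    have "mollify \<rho> r g \<in> borel_measurable lebesgue" by (rule measurable_completion) (simp add: mb)
    then show ?thesis using fm unfolding mf by simp
  qed
  have aefg: "AE y in lebesgue. norm (mollify \<rho> r f y - f y) = norm (mollify \<rho> r g y - g y)"
    using ae by eventually_elim (simp add: mf)
  show "integrable lebesgue (\<lambda>y. norm (mollify \<rho> r f y - f y))"
    using integrable_cong_AE[OF fgm mm aefg] gint by simp
  show "(LINT y|lebesgue. norm (mollify \<rho> r f y - f y)) \<le> e"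
    using integral_cong_AE[OF fgm mm aefg] gle by simp
qed

end

lemma mollify_L1_limit:
  fixes f :: "'a::euclidean_space \<Rightarrow> 'b::euclidean_space"
  assumes \<rho>: "mollifier \<rho>" and f: "integrable lebesgue f" and r: "\<And>j. r j > 0" "r \<longlonglongrightarrow> 0"
  shows "(\<lambda>j. LINT y|lebesgue. norm (mollify \<rho> (r j) f y - f y)) \<longlonglongrightarrow> 0"
proof (rule LIMSEQ_I)
  fix e :: real assume e: "e > 0"
  obtain d where d: "d > 0" "\<And>h. norm h < d \<Longrightarrow> (LINT x|lebesgue. norm (f (x + h) - f x)) < e / 2"
    using L1_shift_continuous[OF f, of "e / 2"] e by auto
  obtain J where J: "\<And>j. j \<ge> J \<Longrightarrow> r j < d"
    using order_tendstoD(2)[OF r(2) d(1)] unfolding eventually_sequentially by blast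
  show "\<exists>J. \<forall>j\<ge>J. norm ((LINT y|lebesgue. norm (mollify \<rho> (r j) f y - f y)) - 0) < e"
  proof (intro exI allI impI)
    fix j assume "j \<ge> J"
    then have "(LINT y|lebesgue. norm (f (y + h) - f y)) \<le> e / 2" if "norm h \<le> r j" for h
      using d(2)[of h] that J[of j] by linarith
    from mollify_L1_error(2)[OF \<rho> r(1) f this]
    have "(LINT y|lebesgue. norm (mollify \<rho> (r j) f y - f y)) \<le> e / 2" .
    moreover have "(LINT y|lebesgue. norm (mollify \<rho> (r j) f y - f y)) \<ge> 0" by simp
    ultimately show "norm ((LINT y|lebesgue. norm (mollify \<rho> (r j) f y - f y)) - 0) < e" using e by simp
  qed
qed

section \<open>Limits of the iteration are saturated\<close>

text \<open>The sequence decreases to some \<open>L \<ge> 0\<close>. If \<open>L\<close> were positive, every step would decrease it by at least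
\<open>c * L powr m\<close>.\<close>

lemma gap_iteration_tendsto_0:
  fixes a :: "nat \<Rightarrow> real"
  assumes a: "\<And>j. 0 \<le> a j" "\<And>j. a (Suc j) \<le> a j - c * a j powr m" and c: "c > 0" and m: "m > 0"
  shows "a \<longlonglongrightarrow> 0"
proof -
  have "decseq a" using a c by (intro decseq_SucI) (smt (verit) mult_nonneg_nonneg powr_ge_zero)
  then obtain L where L: "a \<longlonglongrightarrow> L" "\<And>j. L \<le> a j"
    using decseq_convergent[of a 0] a(1) by blast
  have L0: "L \<ge> 0" using LIMSEQ_le_const[OF L(1)] a(1) by blast
  have "c * L powr m \<le> a j - a (Suc j)" for j
  proof -
    have "c * L powr m \<le> c * a j powr m" using c m L(2) L0 by (intro mult_left_mono powr_mono2) auto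
    then show ?thesis using a(2)[of j] by linarith
  qed
  moreover have "(\<lambda>j. a j - a (Suc j)) \<longlonglongrightarrow> L - L" by (intro tendsto_intros L(1) LIMSEQ_Suc)
  ultimately have "c * L powr m \<le> 0" using LIMSEQ_le_const[of _ "L - L"] by auto
  then have "L powr m \<le> 0" using c by (simp add: mult_le_0_iff)
  then have "L = 0" using powr_ge_zero[of L m] by (simp add: powr_eq_0_iff order_antisym_conv)
  then show ?thesis using L(1) by simp
qed

lemma weak_star_limit_integral:
  assumes lim: "limitin (weak_star \<Omega>) zs z sequentially" and zs: "\<And>k. zs k \<in> Linf \<Omega>" and g: "integrable lebesgue g"
  shows "(\<lambda>k. LINT y|lebesgue. zs k y \<bullet> g y) \<longlonglongrightarrow> (LINT y|lebesgue. z y \<bullet> g y)"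
proof (rule topological_tendstoI)
  fix A :: "real set" assume A: "open A" "(LINT y|lebesgue. z y \<bullet> g y) \<in> A"
  let ?S = "{z \<in> Linf \<Omega>. (LINT y|lebesgue. z y \<bullet> g y) \<in> A}"
  have zL: "z \<in> Linf \<Omega>" using lim unfolding limitin_def topspace_weak_star by blast
  have "openin (weak_star \<Omega>) ?S" unfolding weak_star_def
    by (rule topology_generated_by_Basis) (use A g in blast)
  then have "eventually (\<lambda>k. zs k \<in> ?S) sequentially"
    using lim zL A(2) unfolding limitin_def by blast
  then show "eventually (\<lambda>k. (LINT y|lebesgue. zs k y \<bullet> g y) \<in> A) sequentially" by eventually_elim simp
qed

text \<open>The value of a mollification at a point is an integral against a fixed integrable function.\<close>

lemma weak_star_mollify:
  fixes zs :: "nat \<Rightarrow> 'n::finite spacetime \<Rightarrow> 'n state"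
  assumes \<rho>: "mollifier \<rho>" and r: "r > 0" and lim: "limitin (weak_star \<Omega>) zs z sequentially" and zs: "\<And>k. zs k \<in> Linf \<Omega>"
    and \<Omega>: "bounded \<Omega>"
  shows "(\<lambda>k. mollify \<rho> r (zs k) y) \<longlonglongrightarrow> mollify \<rho> r z y"
proof -
  have zL: "z \<in> Linf \<Omega>" using lim unfolding limitin_def topspace_weak_star by blast
  have comp: "mollify \<rho> r f y \<bullet> e = (LINT w|lebesgue. f w \<bullet> (kernel \<rho> r (y - w) *\<^sub>R e))" if "f \<in> Linf \<Omega>" for f :: "'n spacetime \<Rightarrow> 'n state" and e
    unfolding mollify_kernel
    using integral_inner_left[OF mollify_integrable[OF \<rho> r Linf_integrable(1)[OF that \<Omega>], of y], of e] by simp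
  have "(\<lambda>k. mollify \<rho> r (zs k) y \<bullet> e) \<longlonglongrightarrow> mollify \<rho> r z y \<bullet> e" for e
    unfolding comp[OF zs] comp[OF zL]
    by (rule weak_star_limit_integral[OF lim zs]) (intro integrable_scaleR_left kernel_reflect(1)[OF \<rho> r] impI)
  then show ?thesis by (rule tendsto_componentwise_iff[THEN iffD2, rule_format])
qed

definition ess_bounded :: "('a::euclidean_space \<Rightarrow> 'b::euclidean_space) \<Rightarrow> bool" where
  "ess_bounded f \<longleftrightarrow> f \<in> borel_measurable lebesgue \<and> (\<exists>C. AE y in lebesgue. norm (f y) \<le> C)"

lemma ess_bounded_diff: assumes "ess_bounded f" "ess_bounded g" shows "ess_bounded (\<lambda>y. f y - g y)"
proof -
  obtain C where C: "AE y in lebesgue. norm (f y) \<le> C" using assms by (auto simp: ess_bounded_def)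
  obtain D where D: "AE y in lebesgue. norm (g y) \<le> D" using assms by (auto simp: ess_bounded_def)
  have "AE y in lebesgue. norm (f y - g y) \<le> C + D"
    using C D by eventually_elim (rule order_trans[OF norm_triangle_ineq4], rule add_mono)
  then show ?thesis using assms by (auto simp: ess_bounded_def)
qed

lemma ess_bounded_set_integrable:
  assumes f: "ess_bounded f" and \<Omega>: "open \<Omega>" "bounded \<Omega>"
  shows "integrable lebesgue (\<lambda>y. indicator \<Omega> y *\<^sub>R norm (f y))"
proof -
  obtain C where C: "AE y in lebesgue. norm (f y) \<le> C" using f by (auto simp: ess_bounded_def)
  show ?thesis
  proof (rule integrable_bounded_support[of _ \<Omega> "\<bar>C\<bar>"])
    show "AE y in lebesgue. norm (indicator \<Omega> y *\<^sub>R norm (f y)) \<le> \<bar>C\<bar>"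
      using C by eventually_elim (auto simp: indicator_def)
    have "\<Omega> \<in> sets lebesgue" using \<Omega>(1) by simp
    then show "(\<lambda>y. indicator \<Omega> y *\<^sub>R norm (f y)) \<in> borel_measurable lebesgue"
      using f by (intro borel_measurable_scaleR borel_measurable_indicator) (auto simp: ess_bounded_def)
  qed (auto simp: \<Omega>)
qed

lemma set_L1_triangle:
  assumes "ess_bounded f" "ess_bounded g" "ess_bounded h" and \<Omega>: "open \<Omega>" "bounded \<Omega>"
  shows "(LINT y:\<Omega>|lebesgue. norm (f y - h y)) \<le> (LINT y:\<Omega>|lebesgue. norm (f y - g y)) + (LINT y:\<Omega>|lebesgue. norm (g y - h y))"
proof -
  note i = ess_bounded_set_integrable[OF ess_bounded_diff \<Omega>]
  have "(LINT y|lebesgue. indicator \<Omega> y *\<^sub>R norm (f y - h y)) \<le> 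
      (LINT y|lebesgue. indicator \<Omega> y *\<^sub>R norm (f y - g y) + indicator \<Omega> y *\<^sub>R norm (g y - h y))"
  proof (rule integral_mono)
    show "indicator \<Omega> y *\<^sub>R norm (f y - h y) \<le> indicator \<Omega> y *\<^sub>R norm (f y - g y) + indicator \<Omega> y *\<^sub>R norm (g y - h y)" for y
      using norm_triangle_ineq[of "f y - g y" "g y - h y"] by (auto simp: indicator_def)
  qed (intro Bochner_Integration.integrable_add i assms)+
  also have "\<dots> = (LINT y|lebesgue. indicator \<Omega> y *\<^sub>R norm (f y - g y)) + (LINT y|lebesgue. indicator \<Omega> y *\<^sub>R norm (g y - h y))"
    by (intro Bochner_Integration.integral_add i assms)
  finally show ?thesis by (simp add: set_lebesgue_integral_def)
qed

lemma ess_bounded_L1_le_Lnorm: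
  assumes "ess_bounded f" "open \<Omega>" "bounded \<Omega>" "m > 1" "Lnorm m \<Omega> f < e"
  shows "(LINT y:\<Omega>|lebesgue. norm (f y)) \<le> measure lebesgue \<Omega> powr (1 - 1 / m) * e"
proof -
  obtain C where C: "AE y in lebesgue. norm (f y) \<le> C" using assms by (auto simp: ess_bounded_def)
  have "(LINT y:\<Omega>|lebesgue. norm (f y)) \<le> measure lebesgue \<Omega> powr (1 - 1 / m) * Lnorm m \<Omega> f"
    using L1_le_Lnorm[OF _ C assms(2,3,4)] assms(1) by (simp add: ess_bounded_def)
  also have "\<dots> \<le> measure lebesgue \<Omega> powr (1 - 1 / m) * e" using assms(5) by (intro mult_left_mono) auto
  finally show ?thesis .
qed

lemma Lnorm_powr: assumes "m > 0" shows "Lnorm m \<Omega> f powr m = (LINT y:\<Omega>|lebesgue. norm (f y) powr m)"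
proof -
  have "0 \<le> (LINT y:\<Omega>|lebesgue. norm (f y) powr m)" by (simp add: set_lebesgue_integral_def)
  then show ?thesis using assms by (simp add: Lnorm_def powr_powr)
qed

text \<open>For \<open>i \<le> j < k\<close> the conditions on the mollified increments sum up to a bound of order \<open>2\<^sup>-\<^sup>j\<close> for the distance
of \<open>z\<^sub>j * \<rho>\<^sub>i\<close> and \<open>z\<^sub>k * \<rho>\<^sub>i\<close>; letting \<open>k\<close> tend to infinity along the weak* convergent subsequence compares
\<open>z\<^sub>j * \<rho>\<^sub>j\<close> with \<open>z * \<rho>\<^sub>j\<close>. Everything is estimated in \<open>L\<^sup>1(\<Omega>)\<close>, which suffices since all functions are bounded.
The whole sequence \<open>z\<^sub>j\<close> then converges strongly to \<open>z\<close>, and the energies tend to their maximum.\<close>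

lemma iteration_limit_saturated:
  fixes z :: "'n::finite spacetime \<Rightarrow> 'n state"
  assumes \<Omega>: "open \<Omega>" "bounded \<Omega>" and m: "m \<ge> 2" and it: "iteration_limit \<Omega> m z"
  obtains a where "\<And>k. a k \<in> X0 \<Omega>" "(\<lambda>k. LINT y|lebesgue. norm (a k y - z y)) \<longlonglongrightarrow> 0"
    "AE y in lebesgue. y \<in> \<Omega> \<longrightarrow> norm (fst (z y)) = 1 \<and> norm (fst (snd (z y))) = 1"
proof -
  obtain zs :: "nat \<Rightarrow> 'n spacetime \<Rightarrow> 'n state" and r \<beta> \<rho> \<sigma> where
    zs: "\<And>j. zs j \<in> X0 \<Omega>" and \<beta>: "\<beta> > 0" and \<rho>: "mollifier \<rho>" and r: "\<And>j. 0 < r j" "\<And>j. r j < (1 / 2) ^ j"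
    and en: "\<And>j. j \<ge> 1 \<Longrightarrow> energy \<Omega> m (zs j) \<ge> energy \<Omega> m (zs (j - 1)) + \<beta> / 2 * (2 * measure lebesgue \<Omega> - energy \<Omega> m (zs (j - 1))) powr m"
    and m1: "\<And>j. j \<ge> 1 \<Longrightarrow> Lnorm m \<Omega> (\<lambda>y. zs j y - mollify \<rho> (r j) (zs j) y) < (1 / 2) ^ j"
    and m2: "\<And>i j. j \<ge> 1 \<Longrightarrow> i \<le> j - 1 \<Longrightarrow> Lnorm m \<Omega> (mollify \<rho> (r i) (\<lambda>y. zs j y - zs (j - 1) y)) < (1 / 2) ^ j"
    and \<sigma>: "strict_mono \<sigma>" "limitin (weak_star \<Omega>) (zs \<circ> \<sigma>) z sequentially"
    using it unfolding iteration_limit_def by blast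
  note zsL = X0_Linf[OF zs \<Omega>(2)]
  have zL: "z \<in> Linf \<Omega>" using \<sigma>(2) unfolding limitin_def topspace_weak_star by blast
  note zsi = Linf_integrable(1)[OF zsL \<Omega>(2)] and zi = Linf_integrable(1)[OF zL \<Omega>(2)]
  obtain C where C: "C > 0" "\<And>z. z \<in> (Uset :: 'n state set) \<Longrightarrow> norm z \<le> C" using Uset_bounded by blast
  have zsC: "norm (zs j y) \<le> C" for j y by (rule C(2)[OF X0_Uset[OF zs]])
  have m1': "m > 1" "m > 0" using m by auto
  define A where "A = measure lebesgue \<Omega> powr (1 - 1 / m)"
  define P where "P f = (LINT y:\<Omega>|lebesgue. norm (f y))" for f :: "'n spacetime \<Rightarrow> 'n state"
  define mo where "mo j f = mollify \<rho> (r j) f" for j and f :: "'n spacetime \<Rightarrow> 'n state"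
  have ebL: "ess_bounded f" if "f \<in> Linf \<Omega>" for f
    using that unfolding Linf_def ess_bounded_def by blast
  have ebm: "ess_bounded (mo j f)" if f: "f \<in> Linf \<Omega>" for j f
  proof -
    obtain D where D: "AE y in lebesgue. norm (f y) \<le> D" using ebL[OF f] by (auto simp: ess_bounded_def)
    have "norm (mo j f y) \<le> D" for y
      unfolding mo_def by (rule mollify_bound[OF \<rho> r(1) Linf_integrable(1)[OF f \<Omega>(2)] D])
    moreover have "mo j f \<in> borel_measurable lebesgue"
      unfolding mo_def using mollify_borel[OF \<rho> r(1) Linf_integrable(2)[OF f \<Omega>(2)]]
      by (intro measurable_completion) simp
    ultimately show ?thesis unfolding ess_bounded_def by blast
  qed
  have tri: "P (\<lambda>y. f y - h y) \<le> P (\<lambda>y. f y - g y) + P (\<lambda>y. g y - h y)"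
    if "ess_bounded f" "ess_bounded g" "ess_bounded h" for f g h
    unfolding P_def by (rule set_L1_triangle[OF that \<Omega>])
  have 1: "P (\<lambda>y. zs j y - mo j (zs j) y) \<le> A * (1 / 2) ^ j" if "j \<ge> 1" for j
    unfolding P_def A_def mo_def
    using ess_bounded_L1_le_Lnorm[OF ess_bounded_diff[OF ebL[OF zsL] ebm[OF zsL, unfolded mo_def]] \<Omega> m1'(1) m1[OF that]] .
  have modiff: "mollify \<rho> (r i) (\<lambda>y. zs j y - zs k y) = (\<lambda>y. mo i (zs j) y - mo i (zs k) y)" for i j k
    unfolding mo_def by (rule ext, rule mollify_diff[OF \<rho> r(1) zsi zsi])
  have step: "P (\<lambda>y. mo i (zs (Suc j)) y - mo i (zs j) y) \<le> A * (1 / 2) ^ Suc j" if "i \<le> j" for i j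
  proof -
    have "Lnorm m \<Omega> (\<lambda>y. mo i (zs (Suc j)) y - mo i (zs j) y) < (1 / 2) ^ Suc j"
      using m2[of "Suc j" i] that unfolding modiff[symmetric] by simp
    from ess_bounded_L1_le_Lnorm[OF ess_bounded_diff[OF ebm[OF zsL] ebm[OF zsL]] \<Omega> m1'(1) this]
    show ?thesis unfolding P_def A_def .
  qed
  have 2: "P (\<lambda>y. mo j (zs (j + k)) y - mo j (zs j) y) \<le> A * ((1 / 2) ^ j - (1 / 2) ^ (j + k))" for j k
  proof (induction k)
    case 0
    show ?case by (simp add: P_def set_lebesgue_integral_def)
  next
    case (Suc k)
    have "P (\<lambda>y. mo j (zs (j + Suc k)) y - mo j (zs j) y) \<le> 
       P (\<lambda>y. mo j (zs (Suc (j + k))) y - mo j (zs (j + k)) y) + P (\<lambda>y. mo j (zs (j + k)) y - mo j (zs j) y)"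
      unfolding add_Suc_right by (intro tri ebm zsL)
    also have "\<dots> \<le> A * (1 / 2) ^ Suc (j + k) + A * ((1 / 2) ^ j - (1 / 2) ^ (j + k))"
      by (intro add_mono step Suc) simp
    also have "\<dots> = A * ((1 / 2) ^ j - (1 / 2) ^ (j + Suc k))" by (simp add: algebra_simps)
    finally show ?case .
  qed
  have A0: "A \<ge> 0" by (simp add: A_def)
  have 3: "P (\<lambda>y. mo j z y - mo j (zs j) y) \<le> A * (1 / 2) ^ j" for j
  proof -
    have pt: "(\<lambda>k. mo j (zs (\<sigma> k)) y) \<longlonglongrightarrow> mo j z y" for y
      using weak_star_mollify[OF \<rho> r(1) \<sigma>(2) _ \<Omega>(2)] zsL unfolding mo_def by (simp add: o_def)
    have bd: "norm (mo j (zs k) y - mo j (zs j) y) \<le> C + C" for k y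
    proof -
      have "norm (mo j (zs i) y) \<le> C" for i
        unfolding mo_def by (rule mollify_bound[OF \<rho> r(1) zsi]) (simp add: zsC)
      then show ?thesis by (intro order_trans[OF norm_triangle_ineq4] add_mono)
    qed
    have meas: "(\<lambda>y. indicator \<Omega> y *\<^sub>R norm (mo j f y - mo j (zs j) y)) \<in> borel_measurable lebesgue" if "f \<in> Linf \<Omega>" for f
      using ess_bounded_set_integrable[OF ess_bounded_diff[OF ebm[OF that] ebm[OF zsL]] \<Omega>]
      by (rule borel_measurable_integrable)
    have lim: "(\<lambda>k. P (\<lambda>y. mo j (zs (\<sigma> k)) y - mo j (zs j) y)) \<longlonglongrightarrow> P (\<lambda>y. mo j z y - mo j (zs j) y)"
      unfolding P_def set_lebesgue_integral_def
    proof (rule dominated_convergence_bounded_support[of _ _ \<Omega> "C + C"])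
      show "AE y in lebesgue. norm (indicator \<Omega> y *\<^sub>R norm (mo j (zs (\<sigma> k)) y - mo j (zs j) y)) \<le> C + C" for k
        using bd C(1) by (auto simp: indicator_def)
      show "AE y in lebesgue. (\<lambda>k. indicator \<Omega> y *\<^sub>R norm (mo j (zs (\<sigma> k)) y - mo j (zs j) y)) \<longlonglongrightarrow> indicator \<Omega> y *\<^sub>R norm (mo j z y - mo j (zs j) y)"
        by (rule AE_I2) (intro tendsto_intros pt)
    qed (rule meas[OF zsL] meas[OF zL] \<Omega>(2) | simp)+
    have "eventually (\<lambda>k. P (\<lambda>y. mo j (zs (\<sigma> k)) y - mo j (zs j) y) \<le> A * (1 / 2) ^ j) sequentially"
      using eventually_ge_at_top[of j]
    proof eventually_elim
      case (elim k)
      then have le: "j \<le> \<sigma> k" using seq_suble[OF \<sigma>(1), of k] by linarith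
      then have "P (\<lambda>y. mo j (zs (\<sigma> k)) y - mo j (zs j) y) \<le> A * ((1 / 2) ^ j - (1 / 2) ^ \<sigma> k)" using 2[of j "\<sigma> k - j"] by simp
      also have "\<dots> \<le> A * (1 / 2) ^ j" using A0 by (intro mult_left_mono) auto
      finally show ?case .
    qed
    from tendsto_upperbound[OF lim this] show ?thesis by simp
  qed
  have r0: "r \<longlonglongrightarrow> 0"
    by (rule tendsto_sandwich[OF _ _ tendsto_const LIMSEQ_power_zero[of "1/2::real"]])
      (use r in \<open>auto intro!: always_eventually less_imp_le\<close>)
  define T where "T j = (LINT y|lebesgue. norm (mo j z y - z y))" for j
  have T0: "T \<longlonglongrightarrow> 0" unfolding T_def mo_def by (rule mollify_L1_limit[OF \<rho> zi r(1) r0])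
  have PT: "P (\<lambda>y. mo j z y - z y) \<le> T j" for j
  proof -
    obtain e where e: "\<And>h. norm h \<le> r j \<Longrightarrow> (LINT y|lebesgue. norm (z (y + h) - z y)) \<le> e"
    proof
      fix h :: "'n spacetime" assume "norm h \<le> r j"
      have "(LINT y|lebesgue. norm (z (y + h) - z y)) \<le> (LINT y|lebesgue. norm (z (y + h)) + norm (z y))"
        using zi integrable_shift(1)[OF zi, of h] by (intro integral_mono) (auto intro: norm_triangle_ineq4)
      also have "\<dots> = (LINT y|lebesgue. norm (z (y + h))) + (LINT y|lebesgue. norm (z y))"
        using zi integrable_shift(1)[OF zi, of h] by (intro Bochner_Integration.integral_add) auto
      also have "\<dots> = 2 * (LINT y|lebesgue. norm (z y))"
        using integrable_shift(2)[of "\<lambda>y. norm (z y)" h] zi by simp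
      finally show "(LINT y|lebesgue. norm (z (y + h) - z y)) \<le> 2 * (LINT y|lebesgue. norm (z y))" .
    qed
    have i: "integrable lebesgue (\<lambda>y. norm (mo j z y - z y))"
      unfolding mo_def by (rule mollify_L1_error(1)[OF \<rho> r(1) zi e])
    show ?thesis unfolding P_def T_def set_lebesgue_integral_def
    proof (rule integral_mono[OF _ i])
      show "integrable lebesgue (\<lambda>y. indicator \<Omega> y *\<^sub>R norm (mo j z y - z y))"
        by (rule ess_bounded_set_integrable[OF ess_bounded_diff[OF ebm[OF zL] ebL[OF zL]] \<Omega>])
      show "indicator \<Omega> y *\<^sub>R norm (mo j z y - z y) \<le> norm (mo j z y - z y)" for y by (auto simp: indicator_def)
    qed
  qed
  have sym: "P (\<lambda>y. f y - g y) = P (\<lambda>y. g y - f y)" for f g by (simp add: P_def norm_minus_commute)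
  have Pz: "P (\<lambda>y. zs j y - z y) \<le> 2 * (A * (1 / 2) ^ j) + T j" if "j \<ge> 1" for j
  proof -
    have "P (\<lambda>y. zs j y - z y) \<le> P (\<lambda>y. zs j y - mo j (zs j) y) + P (\<lambda>y. mo j (zs j) y - z y)"
      by (intro tri ebL ebm zsL zL)
    moreover have "P (\<lambda>y. mo j (zs j) y - z y) \<le> P (\<lambda>y. mo j (zs j) y - mo j z y) + P (\<lambda>y. mo j z y - z y)"
      by (intro tri ebL ebm zsL zL)
    ultimately show ?thesis using 1[OF that] 3[of j] PT[of j] sym[of "mo j (zs j)" "mo j z"] by linarith
  qed
  have Peq: "P (\<lambda>y. zs j y - z y) = (LINT y|lebesgue. norm (zs j y - z y))" for j
  proof -
    have "AE y in lebesgue. y \<notin> \<Omega> \<longrightarrow> z y = 0" using zL by (auto simp: Linf_def)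
    then have "AE y in lebesgue. y \<notin> \<Omega> \<longrightarrow> zs j y - z y = 0"
      by eventually_elim (simp add: X0_outside[OF zs])
    moreover have "(\<lambda>y. zs j y - z y) \<in> borel_measurable lebesgue"
      using Linf_integrable(2)[OF zsL \<Omega>(2)] Linf_integrable(2)[OF zL \<Omega>(2)] by simp
    ultimately show ?thesis unfolding P_def by (intro Lnorm_support(2) \<Omega>)
  qed
  have L1: "(\<lambda>j. LINT y|lebesgue. norm (zs j y - z y)) \<longlonglongrightarrow> 0"
  proof (rule tendsto_sandwich[OF _ _ tendsto_const])
    have "(\<lambda>j. 2 * (A * (1 / 2) ^ j) + T j) \<longlonglongrightarrow> 2 * (A * 0) + 0"
      by (intro tendsto_intros LIMSEQ_power_zero T0) auto
    then show "(\<lambda>j. 2 * (A * (1 / 2) ^ j) + T j) \<longlonglongrightarrow> 0" by simp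
    show "eventually (\<lambda>j. (LINT y|lebesgue. norm (zs j y - z y)) \<le> 2 * (A * (1 / 2) ^ j) + T j) sequentially"
      using eventually_ge_at_top[of 1] by eventually_elim (use Pz Peq in simp)
  qed simp
  define q where "q w = norm (fst w) powr m + norm (fst (snd w)) powr m" for w :: "'n state"
  have q2: "0 \<le> q w \<and> q w \<le> 2" if "w \<in> relaxed_box" for w
  proof -
    obtain u b M Q p where w: "w = (u, b, M, Q, p)" by (cases w)
    have ub: "norm u \<le> 1" "norm b \<le> 1" using that hull_Kset_bounds by (auto simp: w relaxed_box_def)
    have "norm u powr m \<le> 1 powr m" "norm b powr m \<le> 1 powr m" using ub m1' by (intro powr_mono2; simp)+
    then show ?thesis by (simp add: q_def w)
  qed
  have \<Omega>s: "\<Omega> \<in> sets lebesgue" using \<Omega>(1) by simp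
  have qm: "(\<lambda>y. indicator \<Omega> y *\<^sub>R q (f y)) \<in> borel_measurable lebesgue" if "f \<in> borel_measurable lebesgue" for f
  proof -
    have b1: "bounded_linear (fst :: 'n state \<Rightarrow> _)" "bounded_linear (\<lambda>w :: 'n state. fst (snd w))"
      by (intro bounded_linear_fst bounded_linear_compose[OF bounded_linear_fst bounded_linear_snd])+
    have "(\<lambda>y. fst (f y)) \<in> borel_measurable lebesgue" "(\<lambda>y. fst (snd (f y))) \<in> borel_measurable lebesgue"
      using borel_measurable_continuous_on[OF linear_continuous_on[OF b1(1)] that] borel_measurable_continuous_on[OF linear_continuous_on[OF b1(2)] that] .
    then show ?thesis unfolding q_def using \<Omega>s
      by (intro borel_measurable_scaleR borel_measurable_indicator borel_measurable_add powr_real_measurable borel_measurable_norm) auto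
  qed
  have box: "zs j y \<in> relaxed_box" for j y using X0_Uset[OF zs] Uset_sub_box by blast
  have qi: "integrable lebesgue (\<lambda>y. indicator \<Omega> y *\<^sub>R q (f y))" if "f \<in> borel_measurable lebesgue" "AE y in lebesgue. f y \<in> relaxed_box" for f
  proof (rule integrable_bounded_support[OF qm[OF that(1)] \<Omega>(2)])
    show "AE y in lebesgue. norm (indicator \<Omega> y *\<^sub>R q (f y)) \<le> 2"
      using that(2) by eventually_elim (use q2 in \<open>auto simp: indicator_def\<close>)
  qed auto
  define E where "E j = (LINT y|lebesgue. indicator \<Omega> y *\<^sub>R q (zs j y))" for j
  have vol: "(LINT y|lebesgue. indicator \<Omega> y *\<^sub>R (2::real)) = 2 * measure lebesgue \<Omega>" by simp
  have iO: "integrable lebesgue (\<lambda>y. indicator \<Omega> y *\<^sub>R (2::real))"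
    by (rule integrable_bounded_support[OF _ \<Omega>(2), of _ 2]) (use \<Omega>s in \<open>auto intro!: borel_measurable_scaleR borel_measurable_indicator\<close>)
  have energy: "energy \<Omega> m (zs j) = E j" for j
  proof -
    have c: "(\<lambda>y. fst (zs j y)) \<in> Cc_infty" "(\<lambda>y. fst (snd (zs j y))) \<in> Cc_infty"
      by (intro Cc_infty_fst Cc_infty_snd X0_Cc[OF zs \<Omega>(2)])+
    have i: "integrable lebesgue (\<lambda>y. indicator \<Omega> y *\<^sub>R norm (f y) powr m)" if f: "f \<in> Cc_infty" "\<And>y. norm (f y) \<le> 1" for f :: "'n spacetime \<Rightarrow> real^'n"
    proof (rule integrable_bounded_support[OF _ \<Omega>(2), of _ 1])
      show "(\<lambda>y. indicator \<Omega> y *\<^sub>R norm (f y) powr m) \<in> borel_measurable lebesgue"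
        using Cc_infty_integrable(2)[OF f(1)] \<Omega>s
        by (intro borel_measurable_scaleR borel_measurable_indicator powr_real_measurable borel_measurable_norm) auto
      have "norm (f y) powr m \<le> 1" for y using powr_mono2[of m "norm (f y)" 1] f(2)[of y] m1' by simp
      then show "AE y in lebesgue. norm (indicator \<Omega> y *\<^sub>R norm (f y) powr m) \<le> 1" by (auto simp: indicator_def)
    qed auto
    have ub: "norm (fst (zs j y)) \<le> 1" "norm (fst (snd (zs j y))) \<le> 1" for y
    proof -
      obtain u b M Q p where w: "zs j y = (u, b, M, Q, p)" by (cases "zs j y")
      show "norm (fst (zs j y)) \<le> 1" "norm (fst (snd (zs j y))) \<le> 1" using box[of j y] hull_Kset_bounds by (auto simp: w relaxed_box_def)
    qed
    show ?thesis
      unfolding energy_def Lnorm_powr[OF m1'(2)] E_def q_def set_lebesgue_integral_def scaleR_add_right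
      by (rule Bochner_Integration.integral_add[OF i[OF c(1) ub(1)] i[OF c(2) ub(2)], symmetric])
  qed
  have E2: "E j \<le> 2 * measure lebesgue \<Omega>" for j
    unfolding E_def vol[symmetric]
  proof (rule integral_mono[OF _ iO])
    show "integrable lebesgue (\<lambda>y. indicator \<Omega> y *\<^sub>R q (zs j y))" by (rule qi[OF Linf_integrable(2)[OF zsL \<Omega>(2)]]) (simp add: box)
    show "indicator \<Omega> y *\<^sub>R q (zs j y) \<le> indicator \<Omega> y *\<^sub>R 2" for y using q2[OF box, of j y] by (auto simp: indicator_def)
  qed
  \<comment> \<open>the energy never exceeds \<open>2|\<Omega>|\<close>, so the gap satisfies the recursive inequality with nonnegative terms\<close>
  have "(\<lambda>j. 2 * measure lebesgue \<Omega> - E j) \<longlonglongrightarrow> 0"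
  proof (rule gap_iteration_tendsto_0[of _ "\<beta> / 2" m])
    show "2 * measure lebesgue \<Omega> - E (Suc j) \<le> 2 * measure lebesgue \<Omega> - E j - \<beta> / 2 * (2 * measure lebesgue \<Omega> - E j) powr m" for j
      using en[of "Suc j"] unfolding energy by simp
  qed (use E2 \<beta> m1' in auto)
  from tendsto_diff[OF tendsto_const[of "2 * measure lebesgue \<Omega>"] this]
  have Elim: "E \<longlonglongrightarrow> 2 * measure lebesgue \<Omega>" by simp
  obtain s where s: "strict_mono s" "AE y in lebesgue. (\<lambda>k. zs (s k) y) \<longlonglongrightarrow> z y"
    by (rule L1_limit_AE[OF zs \<Omega>(2) zL L1])
  have zbox: "AE y in lebesgue. z y \<in> relaxed_box" by (rule L1_limit_box[OF zs \<Omega>(2) zL L1])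
  note zm = Linf_integrable(2)[OF zL \<Omega>(2)]
  have "(\<lambda>k. E (s k)) \<longlonglongrightarrow> (LINT y|lebesgue. indicator \<Omega> y *\<^sub>R q (z y))"
    unfolding E_def
  proof (rule dominated_convergence_bounded_support[of _ _ \<Omega> 2])
    show "AE y in lebesgue. norm (indicator \<Omega> y *\<^sub>R q (zs (s k) y)) \<le> 2" for k
      using q2[OF box] by (auto simp: indicator_def)
    show "AE y in lebesgue. (\<lambda>k. indicator \<Omega> y *\<^sub>R q (zs (s k) y)) \<longlonglongrightarrow> indicator \<Omega> y *\<^sub>R q (z y)"
      using s(2)
    proof eventually_elim
      case (elim y)
      have p: "(\<lambda>k. norm (f k) powr m) \<longlonglongrightarrow> norm l powr m" if "f \<longlonglongrightarrow> l" for f and l :: "real^'n"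
      proof (rule tendsto_powr'[OF tendsto_norm[OF that] tendsto_const])
        show "norm l \<noteq> 0 \<or> 0 < m \<and> (\<forall>\<^sub>F k in sequentially. 0 \<le> norm (f k))" using m1' by simp
      qed
      show ?case unfolding q_def by (intro tendsto_intros p elim)
    qed
  qed (rule qm[OF Linf_integrable(2)[OF zsL \<Omega>(2)]] qm[OF zm] \<Omega>(2) | simp)+
  moreover have "(\<lambda>k. E (s k)) \<longlonglongrightarrow> 2 * measure lebesgue \<Omega>" using LIMSEQ_subseq_LIMSEQ[OF Elim s(1)] by (simp add: o_def)
  ultimately have qz: "(LINT y|lebesgue. indicator \<Omega> y *\<^sub>R q (z y)) = 2 * measure lebesgue \<Omega>" by (rule LIMSEQ_unique)
  have "(LINT y|lebesgue. indicator \<Omega> y *\<^sub>R 2 - indicator \<Omega> y *\<^sub>R q (z y)) = 0"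
    using Bochner_Integration.integral_diff[OF iO qi[OF zm zbox]] unfolding qz vol by simp
  moreover have "integrable lebesgue (\<lambda>y. indicator \<Omega> y *\<^sub>R 2 - indicator \<Omega> y *\<^sub>R q (z y))"
    by (rule Bochner_Integration.integrable_diff[OF iO qi[OF zm zbox]])
  moreover have "AE y in lebesgue. 0 \<le> indicator \<Omega> y *\<^sub>R 2 - indicator \<Omega> y *\<^sub>R q (z y)"
    using zbox by eventually_elim (use q2 in \<open>auto simp: indicator_def\<close>)
  ultimately have "AE y in lebesgue. indicator \<Omega> y *\<^sub>R 2 - indicator \<Omega> y *\<^sub>R q (z y) = 0"
    using integral_nonneg_eq_0_iff_AE by blast
  with zbox have good: "AE y in lebesgue. y \<in> \<Omega> \<longrightarrow> norm (fst (z y)) = 1 \<and> norm (fst (snd (z y))) = 1"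
  proof eventually_elim
    case (elim y)
    obtain u b M Q p where w: "z y = (u, b, M, Q, p)" by (cases "z y")
    have ub: "norm u \<le> 1" "norm b \<le> 1" using elim hull_Kset_bounds by (auto simp: w relaxed_box_def)
    have lt: "norm v powr m < 1" if "norm v < 1" for v :: "real^'n"
      using powr_less_mono2[of m "norm v" 1] that m1' by simp
    have le: "norm u powr m \<le> 1" "norm b powr m \<le> 1" using ub m1' powr_mono2[of m _ 1] by force+
    show ?case
    proof
      assume "y \<in> \<Omega>"
      then have "norm u powr m + norm b powr m = 2" using elim(2) by (simp add: q_def w)
      then have "\<not> norm u < 1" "\<not> norm b < 1" using lt[of u] lt[of b] le by auto
      then show "norm (fst (z y)) = 1 \<and> norm (fst (snd (z y))) = 1" using ub by (simp add: w)
    qed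
  qed
  show ?thesis by (rule that[OF zs L1 good])
qed

section \<open>Residuals and forces\<close>

text \<open>If the unit vector \<open>u\<close> is a convex combination of unit vectors, then \<open>1 = u \<bullet> u\<close> is the same convex
combination of their inner products with \<open>u\<close>, all at most \<open>1\<close>; so every vector with positive weight is
\<open>u\<close>. The same holds for \<open>b\<close>, and a point of \<open>Kset\<close> is determined by its \<open>(u, b)\<close>-part.\<close>

lemma hull_Kset_extreme:
  assumes k: "(u, b, M, Q) \<in> convex hull Kset" and n: "norm u = 1" "norm b = 1"
  shows "M = outer u u - outer b b" "Q = outer b u - outer u (b :: real^'n::finite)"
proof -
  define k where "k = (u, b, M, Q)"
  obtain S where S: "finite S" "S \<subseteq> Kset" "k \<in> convex hull S"
    using k unfolding caratheodory[of Kset] k_def by blast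
  then obtain w where w: "\<And>x. x \<in> S \<Longrightarrow> 0 \<le> w x" "sum w S = 1" "(\<Sum>x\<in>S. w x *\<^sub>R x) = k"
    unfolding convex_hull_finite[OF S(1)] by blast
  have unit: "norm (fst x) = 1 \<and> norm (fst (snd x)) = 1 \<and> x = K_point (fst x) (fst (snd x))" if "x \<in> S" for x
    using that S(2) by (auto simp: Kset_eq K_point_def)
  have fs: "fst (\<Sum>x\<in>S. h x) = (\<Sum>x\<in>S. fst (h x))" "snd (\<Sum>x\<in>S. h x) = (\<Sum>x\<in>S. snd (h x))" for h :: "_ \<Rightarrow> 'x::real_vector \<times> 'y::real_vector"
    using S(1) by (induction S rule: finite_induct) auto
  have eq: "w x = 0 \<or> f x = v" if x: "x \<in> S" and f: "\<And>x. x \<in> S \<Longrightarrow> norm (f x) = 1" and v: "norm v = 1"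
    and sum: "(\<Sum>x\<in>S. w x *\<^sub>R f x) = v" for f and v :: "real^'n" and x
  proof -
    have "(\<Sum>x\<in>S. w x * (1 - v \<bullet> f x)) = (\<Sum>x\<in>S. w x) - v \<bullet> (\<Sum>x\<in>S. w x *\<^sub>R f x)"
      by (simp add: right_diff_distrib sum_subtractf inner_sum_right)
    also have "\<dots> = 0" using v by (simp add: sum w(2) norm_eq_1)
    finally have "(\<Sum>x\<in>S. w x * (1 - v \<bullet> f x)) = 0" .
    moreover have nn: "0 \<le> w x * (1 - v \<bullet> f x)" if "x \<in> S" for x
      using w(1)[OF that] norm_cauchy_schwarz[of v "f x"] f[OF that] v by (intro mult_nonneg_nonneg) auto
    ultimately have "\<forall>x\<in>S. w x * (1 - v \<bullet> f x) = 0"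
      using sum_nonneg_eq_0_iff[OF S(1) nn] by simp
    then have "w x * (1 - v \<bullet> f x) = 0" using x by (rule bspec)
    then have "w x = 0 \<or> v \<bullet> f x = 1" by auto
    moreover have "f x = v" if "v \<bullet> f x = 1"
    proof -
      have "(f x - v) \<bullet> (f x - v) = 0"
        using that v f[OF x] by (simp add: inner_diff_left inner_diff_right inner_commute norm_eq_1)
      then show ?thesis by simp
    qed
    ultimately show ?thesis by blast
  qed
  have u: "(\<Sum>x\<in>S. w x *\<^sub>R fst x) = u" using arg_cong[OF w(3), of fst] by (simp add: fs k_def)
  have b: "(\<Sum>x\<in>S. w x *\<^sub>R fst (snd x)) = b" using arg_cong[OF w(3), of "\<lambda>x. fst (snd x)"] by (simp add: fs k_def)
  have same: "w x *\<^sub>R x = w x *\<^sub>R K_point u b" if x: "x \<in> S" for x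
  proof (cases "w x = 0")
    case False
    have "fst x = u" using eq[of x fst, OF x _ n(1) u] unit False by blast
    moreover have "fst (snd x) = b" using eq[of x "\<lambda>x. fst (snd x)", OF x _ n(2) b] unit False by blast
    ultimately have "x = K_point u b" using unit[OF x] by simp
    then show ?thesis by simp
  qed simp
  have "k = (\<Sum>x\<in>S. w x *\<^sub>R x)" by (rule w(3)[symmetric])
  also have "\<dots> = (\<Sum>x\<in>S. w x *\<^sub>R K_point u b)" by (rule sum.cong[OF refl same])
  also have "\<dots> = K_point u b" by (simp only: scaleR_sum_left[symmetric] w(2) scaleR_one)
  finally show "M = outer u u - outer b b" "Q = outer b u - outer u b" by (auto simp: k_def K_point_def)
qed

lemma Lnorm_tendsto_0:
  fixes F :: "nat \<Rightarrow> 'a::euclidean_space \<Rightarrow> 'b::euclidean_space"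
  assumes F: "\<And>k. F k \<in> borel_measurable lebesgue" "\<And>k. AE y in lebesgue. norm (F k y) \<le> C"
    "\<And>k. AE y in lebesgue. y \<notin> \<Omega> \<longrightarrow> F k y = 0" "AE y in lebesgue. (\<lambda>k. F k y) \<longlonglongrightarrow> 0"
    and \<Omega>: "bounded \<Omega>" and m: "m > 0"
  shows "(\<lambda>k. Lnorm m UNIV (F k)) \<longlonglongrightarrow> 0"
proof -
  have z: "(\<lambda>k. f k powr p) \<longlonglongrightarrow> 0" if "f \<longlonglongrightarrow> 0" "p > 0" "\<And>k. f k \<ge> 0" for f and p :: real
    using tendsto_powr'[OF that(1) tendsto_const, of p] that by simp
  have "(\<lambda>k. LINT y|lebesgue. norm (F k y) powr m) \<longlonglongrightarrow> (LINT y|(lebesgue :: 'a measure). 0)"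
  proof (rule dominated_convergence_bounded_support[of _ _ \<Omega> "\<bar>C\<bar> powr m"])
    show "(\<lambda>y. norm (F k y) powr m) \<in> borel_measurable lebesgue" for k
      using F(1) by (intro powr_real_measurable borel_measurable_norm) auto
    show "AE y in lebesgue. norm (norm (F k y) powr m) \<le> \<bar>C\<bar> powr m" for k
      using F(2)[of k] by eventually_elim (use m in \<open>auto intro!: powr_mono2\<close>)
    show "AE y in lebesgue. y \<notin> \<Omega> \<longrightarrow> norm (F k y) powr m = 0" for k
      using F(3)[of k] by eventually_elim auto
    show "AE y in lebesgue. (\<lambda>k. norm (F k y) powr m) \<longlonglongrightarrow> 0"
      using F(4) by eventually_elim (intro z m tendsto_norm_zero norm_ge_zero)
  qed (auto simp: \<Omega>)
  then have "(\<lambda>k. (LINT y|lebesgue. norm (F k y) powr m) powr (1 / m)) \<longlonglongrightarrow> 0"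
    using m by (intro z) auto
  then show ?thesis by (simp add: Lnorm_def set_lebesgue_integral_def)
qed

lemma Lspace_bounded_support:
  fixes f :: "'a::euclidean_space \<Rightarrow> 'b::euclidean_space"
  assumes f: "f \<in> borel_measurable lebesgue" "AE y in lebesgue. norm (f y) \<le> C" "AE y in lebesgue. y \<notin> \<Omega> \<longrightarrow> f y = 0"
    and \<Omega>: "bounded \<Omega>" and m: "m > 0"
  shows "f \<in> Lspace m"
  unfolding Lspace_def
proof (intro CollectI conjI f(1) integrable_bounded_support[OF _ \<Omega>, of _ "\<bar>C\<bar> powr m"])
  show "(\<lambda>y. norm (f y) powr m) \<in> borel_measurable lebesgue"
    using f(1) by (intro powr_real_measurable borel_measurable_norm) auto
  show "AE y in lebesgue. norm (norm (f y) powr m) \<le> \<bar>C\<bar> powr m"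
    using f(2) by eventually_elim (use m in \<open>auto intro!: powr_mono2\<close>)
  show "AE y in lebesgue. y \<notin> \<Omega> \<longrightarrow> norm (f y) powr m = 0"
    using f(3) by eventually_elim auto
qed

text \<open>The definition of the weak derivative moves the derivative from \<open>T\<close> to \<open>\<phi>\<close>, and Hoelder's inequality applies.\<close>

lemma weak_pairing_bound:
  fixes \<phi> :: "'a::euclidean_space \<Rightarrow> 'b::euclidean_space" and T :: "'a \<Rightarrow> real"
  assumes T: "T \<in> Cc_infty" and m: "m > 1" and s: "s = m / (m - 1)" and \<phi>: "sobolev1 s \<phi> G" "sobolev1_norm s \<phi> G \<le> 1"
    and e: "e \<in> Basis" and c: "norm c \<le> 1"
  shows "integrable lebesgue (\<lambda>y. dd e T y * (\<phi> y \<bullet> c))"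
    and "\<bar>LINT y|lebesgue. dd e T y * (\<phi> y \<bullet> c)\<bar> \<le> Lnorm m UNIV T"
proof -
  have ms: "s > 1" "1 / m + 1 / s = 1" using m by (auto simp: s field_simps)
  have TL: "integrable lebesgue (\<lambda>y. \<bar>f y\<bar> powr m)" if f: "f \<in> Cc_infty" for f :: "'a \<Rightarrow> real"
  proof -
    obtain B where "\<And>y. norm (f y) \<le> B" using compact_support_bounded[OF f] by blast
    moreover have "bounded (fun_supp f)" using f by (auto simp: Cc_infty_def compact_imp_bounded)
    ultimately have "f \<in> Lspace m"
      using Cc_infty_integrable(2)[OF f] m by (intro Lspace_bounded_support[of _ B "fun_supp f"]) (auto simp: not_fun_supp)
    then show ?thesis by (simp add: Lspace_def)
  qed
  have comp: "(\<lambda>y. g y \<bullet> d) \<in> borel_measurable lebesgue" "integrable lebesgue (\<lambda>y. \<bar>g y \<bullet> d\<bar> powr s)"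
    "(LINT y|lebesgue. \<bar>g y \<bullet> d\<bar> powr s) \<le> (LINT y|lebesgue. norm (g y) powr s)"
    if g: "g \<in> Lspace s" and d: "norm d \<le> 1" for g :: "'a \<Rightarrow> 'b" and d
  proof -
    show gm: "(\<lambda>y. g y \<bullet> d) \<in> borel_measurable lebesgue" using g by (auto simp: Lspace_def)
    have le: "\<bar>g y \<bullet> d\<bar> powr s \<le> norm (g y) powr s" for y
    proof (rule powr_mono2)
      have "\<bar>g y \<bullet> d\<bar> \<le> norm (g y) * norm d" by (rule Cauchy_Schwarz_ineq2)
      also have "\<dots> \<le> norm (g y)" using d by (simp add: mult_left_le)
      finally show "\<bar>g y \<bullet> d\<bar> \<le> norm (g y)" .
    qed (use ms in auto)
    have gi: "integrable lebesgue (\<lambda>y. norm (g y) powr s)" using g by (simp add: Lspace_def)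
    show i: "integrable lebesgue (\<lambda>y. \<bar>g y \<bullet> d\<bar> powr s)"
      by (rule Bochner_Integration.integrable_bound[OF gi])
        (use le gm in \<open>auto intro!: powr_real_measurable borel_measurable_abs\<close>)
    show "(LINT y|lebesgue. \<bar>g y \<bullet> d\<bar> powr s) \<le> (LINT y|lebesgue. norm (g y) powr s)"
      by (rule integral_mono[OF i gi le])
  qed
  have \<phi>L: "\<phi> \<in> Lspace s" and GL: "G e \<in> Lspace s" and wp: "weak_partial e \<phi> (G e)"
    using \<phi>(1) e by (auto simp: sobolev1_def)
  have int: "integrable lebesgue (\<lambda>y. f y * (g y \<bullet> d))" if "f \<in> Cc_infty" "g \<in> Lspace s" "norm d \<le> 1" for f and g :: "'a \<Rightarrow> 'b" and d
    by (rule Holder_integral(1)[OF m ms Cc_infty_integrable(2)[OF that(1)] TL[OF that(1)] comp(1,2)[OF that(2,3)]])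
  show "integrable lebesgue (\<lambda>y. dd e T y * (\<phi> y \<bullet> c))" by (rule int[OF Cc_infty_dd[OF T] \<phi>L c])
  have vint: "integrable lebesgue (\<lambda>y. f y *\<^sub>R g y)" if "f \<in> Cc_infty" "g \<in> Lspace s" for f and g :: "'a \<Rightarrow> 'b"
  proof -
    have "integrable lebesgue (\<lambda>y. \<Sum>d\<in>Basis. (f y * (g y \<bullet> d)) *\<^sub>R d)"
      by (intro Bochner_Integration.integrable_sum integrable_scaleR_left impI int[OF that]) auto
    moreover have "(\<lambda>y. \<Sum>d\<in>Basis. (f y * (g y \<bullet> d)) *\<^sub>R d) = (\<lambda>y. f y *\<^sub>R g y)"
      by (simp add: euclidean_representation flip: scaleR_scaleR scaleR_sum_right)
    ultimately show ?thesis by simp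
  qed
  have "(LINT y|lebesgue. dd e T y * (\<phi> y \<bullet> c)) = (LINT y|lebesgue. dd e T y *\<^sub>R \<phi> y) \<bullet> c"
    using integral_inner_left[where c = c, OF vint[OF Cc_infty_dd[OF T] \<phi>L]] by simp
  also have "\<dots> = - (LINT y|lebesgue. T y *\<^sub>R G e y) \<bullet> c"
    using wp T unfolding weak_partial_def by simp
  also have "\<dots> = - (LINT y|lebesgue. T y * (G e y \<bullet> c))"
    using integral_inner_left[where c = c, OF vint[OF T GL]] by simp
  finally have "\<bar>LINT y|lebesgue. dd e T y * (\<phi> y \<bullet> c)\<bar> = \<bar>LINT y|lebesgue. T y * (G e y \<bullet> c)\<bar>" by simp
  also have "\<dots> \<le> (LINT y|lebesgue. \<bar>T y * (G e y \<bullet> c)\<bar>)" by (rule integral_abs_bound)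
  also have "\<dots> \<le> (LINT y|lebesgue. \<bar>T y\<bar> powr m) powr (1 / m) * (LINT y|lebesgue. \<bar>G e y \<bullet> c\<bar> powr s) powr (1 / s)"
    by (rule Holder_integral(2)[OF m ms Cc_infty_integrable(2)[OF T] TL[OF T] comp(1,2)[OF GL c]])
  also have "\<dots> \<le> (LINT y|lebesgue. \<bar>T y\<bar> powr m) powr (1 / m) * 1"
  proof (rule mult_left_mono)
    have Ls: "Lnorm s UNIV g powr s = (LINT y|lebesgue. norm (g y) powr s)" for g :: "'a \<Rightarrow> 'b"
      using Lnorm_powr[of s UNIV g] ms by (simp add: set_lebesgue_integral_def)
    define N where "N = Lnorm s UNIV \<phi> powr s + (\<Sum>e\<in>Basis. Lnorm s UNIV (G e) powr s)"
    have N1: "N \<le> 1"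
    proof (rule ccontr)
      assume "\<not> N \<le> 1"
      then have "1 powr (1 / s) < N powr (1 / s)" using ms by (intro powr_less_mono2) auto
      then show False using \<phi>(2) by (simp add: sobolev1_norm_def N_def)
    qed
    have "Lnorm s UNIV (G e) powr s \<le> (\<Sum>e\<in>Basis. Lnorm s UNIV (G e) powr s)"
      by (rule member_le_sum[OF e]) auto
    also have "\<dots> \<le> N" unfolding N_def by simp
    finally have "(LINT y|lebesgue. \<bar>G e y \<bullet> c\<bar> powr s) \<le> 1"
      using comp(3)[OF GL c] N1 unfolding Ls by linarith
    then show "(LINT y|lebesgue. \<bar>G e y \<bullet> c\<bar> powr s) powr (1 / s) \<le> 1"
      using powr_mono2[of "1 / s" "LINT y|lebesgue. \<bar>G e y \<bullet> c\<bar> powr s" 1] ms by simp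
  qed simp
  finally show "\<bar>LINT y|lebesgue. dd e T y * (\<phi> y \<bullet> c)\<bar> \<le> Lnorm m UNIV T"
    by (simp add: Lnorm_def set_lebesgue_integral_def)
qed

lemma Div_x_nth: "Div_x A y $ i = (\<Sum>j\<in>UNIV. dd (axis j 1, 0) (\<lambda>y. A y $ i $ j) y)"
  by (simp add: Div_x_def div_x_def dx_def)

lemma Div_x_diff:
  assumes "smooth A" "smooth B"
  shows "Div_x (\<lambda>y. A y - B y) y = Div_x A y - Div_x B y"
  unfolding vec_eq_iff Div_x_nth vector_minus_component
  by (auto simp: dd_diff smooth_nth assms sum_subtractf)

lemma Cc_infty_Div_x: assumes A: "A \<in> Cc_infty" shows "Div_x A \<in> Cc_infty"
proof (rule Cc_inftyI[of _ "fun_supp A"])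
  have Ac: "(\<lambda>y. A y $ i $ j) \<in> Cc_infty" for i j
    by (intro Cc_infty_linear[OF bounded_linear_vec_nth] A)
  have "smooth (\<lambda>y. \<chi> i. Div_x A y $ i)"
    unfolding Div_x_nth using Ac by (intro smooth_vec smooth_sum smooth_dd) (auto simp: Cc_infty_def)
  then show "smooth (Div_x A)" by simp
  show "compact (fun_supp A)" using A by (simp add: Cc_infty_def)
  fix y assume y: "y \<notin> fun_supp A"
  have "dd v (\<lambda>y. A y $ i $ j) y = 0" for v i j
  proof -
    have "smooth A" using A by (simp add: Cc_infty_def)
    then have "dd v (\<lambda>y. A y $ i $ j) y = dd v A y $ i $ j" by (simp add: dd_nth smooth_nth)
    also have "dd v A y = 0" using not_fun_supp[of y "dd v A"] fun_supp_dd[of A v] y by blast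
    finally show ?thesis by simp
  qed
  then show "Div_x A y = 0" by (simp add: vec_eq_iff Div_x_nth)
qed

lemma dual_norm_Div_x:
  fixes T S :: "'n::finite spacetime \<Rightarrow> real^'n^'n"
  assumes T: "T \<in> Cc_infty" and S: "S \<in> Cc_infty" and m: "m > 1"
  shows "dual_norm m (\<lambda>y. (Div_x T y, Div_x S y)) \<le>
    ennreal ((\<Sum>i\<in>UNIV. \<Sum>j\<in>UNIV. Lnorm m UNIV (\<lambda>y. T y $ i $ j)) + (\<Sum>i\<in>UNIV. \<Sum>j\<in>UNIV. Lnorm m UNIV (\<lambda>y. S y $ i $ j)))"
  unfolding dual_norm_def
proof (rule SUP_least, clarify)
  fix \<phi> :: "'n spacetime \<Rightarrow> (real^'n) \<times> (real^'n)" and G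
  assume "sobolev1_0 (m / (m - 1)) \<phi> G" and n: "sobolev1_norm (m / (m - 1)) \<phi> G \<le> 1"
  then have \<phi>: "sobolev1 (m / (m - 1)) \<phi> G" by (simp add: sobolev1_0_def)
  have Tc: "(\<lambda>y. A y $ i $ j) \<in> Cc_infty" if "A \<in> Cc_infty" for A :: "'n spacetime \<Rightarrow> real^'n^'n" and i j
    by (intro Cc_infty_linear[OF bounded_linear_vec_nth] that)
  have e: "(axis j 1, 0) \<in> (Basis :: 'n spacetime set)" for j :: 'n
    by (auto simp: Basis_prod_def axis_in_Basis_iff)
  note W = weak_pairing_bound[OF Tc m refl \<phi> n e]
  have nc: "norm (axis i 1 :: real^'n, 0 :: real^'n) \<le> 1" "norm (0 :: real^'n, axis i 1 :: real^'n) \<le> 1" for i :: 'n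
    by (simp_all add: norm_Pair)
  let ?A = "\<lambda>i j y. dd (axis j 1, 0) (\<lambda>y. T y $ i $ j) y * (\<phi> y \<bullet> (axis i 1, 0))"
  let ?B = "\<lambda>i j y. dd (axis j 1, 0) (\<lambda>y. S y $ i $ j) y * (\<phi> y \<bullet> (0, axis i 1))"
  have iA: "integrable lebesgue (?A i j)" and iB: "integrable lebesgue (?B i j)" for i j
    by (rule W(1)[OF T nc(1)], rule W(1)[OF S nc(2)])
  have "(Div_x T y, Div_x S y) \<bullet> \<phi> y = (\<Sum>i\<in>UNIV. \<Sum>j\<in>UNIV. ?A i j y) + (\<Sum>i\<in>UNIV. \<Sum>j\<in>UNIV. ?B i j y)" for y
    by (cases "\<phi> y") (simp add: inner_vec_def[of "Div_x _ _"] Div_x_nth inner_axis sum_distrib_right)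
  then have "(LINT y|lebesgue. (Div_x T y, Div_x S y) \<bullet> \<phi> y) = 
      (\<Sum>i\<in>UNIV. \<Sum>j\<in>UNIV. LINT y|lebesgue. ?A i j y) + (\<Sum>i\<in>UNIV. \<Sum>j\<in>UNIV. LINT y|lebesgue. ?B i j y)"
    using iA iB by (simp add: Bochner_Integration.integral_add Bochner_Integration.integral_sum Bochner_Integration.integrable_sum)
  also have "\<bar>\<dots>\<bar> \<le> (\<Sum>i\<in>UNIV. \<Sum>j\<in>UNIV. \<bar>LINT y|lebesgue. ?A i j y\<bar>) + (\<Sum>i\<in>UNIV. \<Sum>j\<in>UNIV. \<bar>LINT y|lebesgue. ?B i j y\<bar>)"
    by (intro order_trans[OF abs_triangle_ineq] add_mono order_trans[OF sum_abs] sum_mono order_refl)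
  also have "\<dots> \<le> (\<Sum>i\<in>UNIV. \<Sum>j\<in>UNIV. Lnorm m UNIV (\<lambda>y. T y $ i $ j)) + (\<Sum>i\<in>UNIV. \<Sum>j\<in>UNIV. Lnorm m UNIV (\<lambda>y. S y $ i $ j))"
    by (intro add_mono sum_mono W(2)[OF T nc(1)] W(2)[OF S nc(2)])
  finally show "ennreal \<bar>LINT y|lebesgue. (Div_x T y, Div_x S y) \<bullet> \<phi> y\<bar> \<le> 
    ennreal ((\<Sum>i\<in>UNIV. \<Sum>j\<in>UNIV. Lnorm m UNIV (\<lambda>y. T y $ i $ j)) + (\<Sum>i\<in>UNIV. \<Sum>j\<in>UNIV. Lnorm m UNIV (\<lambda>y. S y $ i $ j)))"
    by (rule ennreal_leI)
qed

text \<open>The solutions are the components of \<open>zs k\<close> and the forces are the divergences of the residuals \<open>T\<close> and \<open>S\<close>,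
which vanish on \<open>z\<close> by saturation in \<open>\<Omega>\<close> and trivially outside.\<close>

lemma forced_solutions_of_strong_approximation:
  fixes z :: "'n::finite spacetime \<Rightarrow> 'n state"
  assumes \<Omega>: "open \<Omega>" "bounded \<Omega>" and zL: "z \<in> Linf \<Omega>" and zs: "\<And>k. zs k \<in> X0 \<Omega>"
    and lim: "AE y in lebesgue. (\<lambda>k. zs k y) \<longlonglongrightarrow> z y"
    and zbox: "AE y in lebesgue. z y \<in> relaxed_box"
    and unit: "AE y in lebesgue. y \<in> \<Omega> \<longrightarrow> norm (fst (z y)) = 1 \<and> norm (fst (snd (z y))) = 1"
  shows "\<exists>(uk :: nat \<Rightarrow> 'n spacetime \<Rightarrow> real^'n) (bk :: nat \<Rightarrow> 'n spacetime \<Rightarrow> real^'n)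
           (pk :: nat \<Rightarrow> 'n spacetime \<Rightarrow> real)
           (fk :: nat \<Rightarrow> 'n spacetime \<Rightarrow> real^'n) (gk :: nat \<Rightarrow> 'n spacetime \<Rightarrow> real^'n).
      (\<forall>k. uk k \<in> Cc_infty \<and> bk k \<in> Cc_infty \<and> pk k \<in> Cc_infty \<and> fk k \<in> Cc_infty \<and>
           gk k \<in> Cc_infty \<and> forced_mhd (uk k) (bk k) (pk k) (fk k) (gk k)) \<and>
      (\<exists>C. \<forall>k. AE y in lebesgue. norm (uk k y, bk k y, pk k y) \<le> C) \<and>
      (\<forall>m\<ge>2.
         tendsto_Lm m (\<lambda>k y. (uk k y, bk k y, pk k y)) (\<lambda>y. (fst (z y), fst (snd (z y)), snd (snd (snd (snd (z y)))))) \<and>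
         (\<lambda>k. dual_norm m (\<lambda>y. (fk k y, gk k y))) \<longlonglongrightarrow> 0)"
proof -
  define u where "u w = fst w" for w :: "'n state"
  define b where "b w = fst (snd w)" for w :: "'n state"
  define M where "M w = fst (snd (snd w))" for w :: "'n state"
  define Q where "Q w = fst (snd (snd (snd w)))" for w :: "'n state"
  define q where "q w = snd (snd (snd (snd w)))" for w :: "'n state"
  define T where "T w = outer (u w) (u w) - outer (b w) (b w) - M w" for w
  define S where "S w = outer (b w) (u w) - outer (u w) (b w) - Q w" for w
  define v where "v w = (u w, b w, q w)" for w
  define f where "f k = Div_x (\<lambda>y. T (zs k y))" for k
  define g where "g k = Div_x (\<lambda>y. S (zs k y))" for k
  have zC: "zs k \<in> Cc_infty" for k by (rule X0_Cc[OF zs \<Omega>(2)])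
  have zsm: "smooth (zs k)" for k by (rule X0_smooth[OF zs])
  have uC: "(\<lambda>y. u (zs k y)) \<in> Cc_infty" and bC: "(\<lambda>y. b (zs k y)) \<in> Cc_infty" and qC: "(\<lambda>y. q (zs k y)) \<in> Cc_infty"
    and MC: "(\<lambda>y. M (zs k y)) \<in> Cc_infty" and QC: "(\<lambda>y. Q (zs k y)) \<in> Cc_infty" for k
    unfolding u_def b_def q_def M_def Q_def by (intro Cc_infty_fst Cc_infty_snd zC)+
  have us: "smooth (\<lambda>y. u (zs k y))" and bs: "smooth (\<lambda>y. b (zs k y))" and Ms: "smooth (\<lambda>y. M (zs k y))" and Qs: "smooth (\<lambda>y. Q (zs k y))" for k
    using uC bC MC QC by (auto simp: Cc_infty_def)
  note os = smooth_bilinear[OF bounded_bilinear_outer]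
  have As: "smooth (\<lambda>y. outer (u (zs k y)) (u (zs k y)) - outer (b (zs k y)) (b (zs k y)))"
    and Bs: "smooth (\<lambda>y. outer (b (zs k y)) (u (zs k y)) - outer (u (zs k y)) (b (zs k y)))" for k
    by (intro smooth_diff os us bs)+
  have out0: "outer 0 (x :: real^'n) = 0" "outer x 0 = 0" for x :: "real^'n" by (simp_all add: vec_eq_iff)
  have T0: "T 0 = 0" and S0: "S 0 = 0" by (simp_all add: T_def S_def u_def b_def M_def Q_def out0)
  have TC: "(\<lambda>y. T (zs k y)) \<in> Cc_infty" and SC: "(\<lambda>y. S (zs k y)) \<in> Cc_infty" for k
  proof -
    have K: "compact (fun_supp (zs k))" using zC[of k] by (simp add: Cc_infty_def)
    show "(\<lambda>y. T (zs k y)) \<in> Cc_infty"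
      by (rule Cc_inftyI[OF _ K]) (simp add: T_def smooth_diff As Ms, simp add: not_fun_supp T0)
    show "(\<lambda>y. S (zs k y)) \<in> Cc_infty"
      by (rule Cc_inftyI[OF _ K]) (simp add: S_def smooth_diff Bs Qs, simp add: not_fun_supp S0)
  qed
  have forced: "forced_mhd (\<lambda>y. u (zs k y)) (\<lambda>y. b (zs k y)) (\<lambda>y. q (zs k y)) (f k) (g k)" for k
  proof -
    obtain u' b' M' Q' q' where e: "zs k = (\<lambda>y. (u' y, b' y, M' y, Q' y, q' y))"
      "\<And>y. dt u' y + Div_x M' y + grad_x q' y = 0 \<and> dt b' y + Div_x Q' y = 0 \<and> div_x u' y = 0 \<and> div_x b' y = 0"
      using X0_relaxed[OF zs, of k] unfolding relaxed_mhd_def by (elim exE conjE) (erule that, erule spec)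
    have c: "(\<lambda>y. u (zs k y)) = u'" "(\<lambda>y. b (zs k y)) = b'" "(\<lambda>y. M (zs k y)) = M'" "(\<lambda>y. Q (zs k y)) = Q'" "(\<lambda>y. q (zs k y)) = q'"
      by (simp_all add: e(1) u_def b_def M_def Q_def q_def)
    have F: "f k y = Div_x (\<lambda>y. outer (u' y) (u' y) - outer (b' y) (b' y)) y - Div_x M' y" for y
      unfolding f_def T_def using Div_x_diff[OF As Ms, of k k y] unfolding c c[THEN fun_cong] .
    have G: "g k y = Div_x (\<lambda>y. outer (b' y) (u' y) - outer (u' y) (b' y)) y - Div_x Q' y" for y
      unfolding g_def S_def using Div_x_diff[OF Bs Qs, of k k y] unfolding c c[THEN fun_cong] .
    show ?thesis unfolding forced_mhd_def c c[THEN fun_cong] F G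
    proof (intro allI conjI)
      fix y
      show "dt u' y + Div_x (\<lambda>y. outer (u' y) (u' y) - outer (b' y) (b' y)) y + grad_x q' y =
          Div_x (\<lambda>y. outer (u' y) (u' y) - outer (b' y) (b' y)) y - Div_x M' y"
        using e(2)[of y] by (simp add: algebra_simps eq_neg_iff_add_eq_0)
      show "dt b' y + Div_x (\<lambda>y. outer (b' y) (u' y) - outer (u' y) (b' y)) y =
          Div_x (\<lambda>y. outer (b' y) (u' y) - outer (u' y) (b' y)) y - Div_x Q' y"
        using e(2)[of y] by (simp add: algebra_simps eq_neg_iff_add_eq_0)
    qed (use e(2) in auto)
  qed
  obtain C where C: "C > 0" "\<And>w. w \<in> (relaxed_box :: 'n state set) \<Longrightarrow> norm w \<le> C" using relaxed_box_bounded by blast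
  have nrm: "norm (u w) \<le> norm w" "norm (b w) \<le> norm w" "norm (M w) \<le> norm w" "norm (Q w) \<le> norm w" "norm (q w) \<le> norm w" for w
  proof -
    have 1: "norm (fst p) \<le> norm p" "norm (snd p) \<le> norm p" for p :: "'x::real_normed_vector \<times> 'y::real_normed_vector"
      using norm_fst_le[of "fst p" "snd p"] norm_snd_le[of "snd p" "fst p"] by auto
    show "norm (u w) \<le> norm w" "norm (b w) \<le> norm w" "norm (M w) \<le> norm w" "norm (Q w) \<le> norm w" "norm (q w) \<le> norm w"
      unfolding u_def b_def M_def Q_def q_def
      by (rule 1(1), rule order_trans[OF 1(1) 1(2)], rule order_trans[OF 1(1) order_trans[OF 1(2) 1(2)]],
        rule order_trans[OF 1(1) order_trans[OF 1(2) order_trans[OF 1(2) 1(2)]]],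
        rule order_trans[OF 1(2) order_trans[OF 1(2) order_trans[OF 1(2) 1(2)]]])
  qed
  have vb: "norm (v w) \<le> 3 * C" if "w \<in> relaxed_box" for w
  proof -
    have "norm (v w) \<le> norm (u w) + (norm (b w) + norm (q w))"
      unfolding v_def by (intro order_trans[OF norm_Pair_le] add_left_mono norm_Pair_le)
    then show ?thesis using nrm[of w] C(2)[OF that] by linarith
  qed
  have box: "zs k y \<in> relaxed_box" for k y using X0_Uset[OF zs] Uset_sub_box by blast
  have comp: "\<bar>outer x y $ i $ j\<bar> \<le> C * C" if "norm x \<le> C" "norm y \<le> C" for x y :: "real^'n" and i j
    using that component_le_norm_cart[of x i] component_le_norm_cart[of y j] C(1)
    by (simp add: abs_mult) (intro mult_mono; linarith)
  have mcomp: "\<bar>A $ i $ j\<bar> \<le> norm A" for A :: "real^'n^'n" and i j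
    using component_le_norm_cart[of "A $ i" j] Finite_Cartesian_Product.norm_nth_le[of A i] by linarith
  have Tb: "norm (T w $ i $ j) \<le> 2 * (C * C) + C" and Sb: "norm (S w $ i $ j) \<le> 2 * (C * C) + C" if w: "w \<in> relaxed_box" for w i j
  proof -
    have n: "norm (u w) \<le> C" "norm (b w) \<le> C" "norm (M w) \<le> C" "norm (Q w) \<le> C"
      using nrm[of w] C(2)[OF w] by linarith+
    show "norm (T w $ i $ j) \<le> 2 * (C * C) + C"
      unfolding T_def vector_minus_component real_norm_def
      using comp[OF n(1) n(1), of i j] comp[OF n(2) n(2), of i j] mcomp[of "M w" i j] n(3) by linarith
    show "norm (S w $ i $ j) \<le> 2 * (C * C) + C"
      unfolding S_def vector_minus_component real_norm_def
      using comp[OF n(2) n(1), of i j] comp[OF n(1) n(2), of i j] mcomp[of "Q w" i j] n(4) by linarith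
  qed
  have z0: "AE y in lebesgue. y \<notin> \<Omega> \<longrightarrow> z y = 0" using zL by (auto simp: Linf_def)
  have v0: "v 0 = 0" by (simp add: v_def u_def b_def q_def zero_prod_def)
  have cont: "continuous_on UNIV u" "continuous_on UNIV b" "continuous_on UNIV M" "continuous_on UNIV Q" "continuous_on UNIV q"
    unfolding u_def[abs_def] b_def[abs_def] M_def[abs_def] Q_def[abs_def] q_def[abs_def] by (intro continuous_intros)+
  have contv: "continuous_on UNIV v" unfolding v_def[abs_def] by (intro continuous_intros cont)
  note co = bounded_bilinear.continuous_on[OF bounded_bilinear_outer]
  have contT: "continuous_on UNIV T" unfolding T_def[abs_def] by (intro continuous_on_diff co cont)
  have contS: "continuous_on UNIV S" unfolding S_def[abs_def] by (intro continuous_on_diff co cont)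
  have TS: "AE y in lebesgue. T (z y) = 0 \<and> S (z y) = 0"
    using zbox unit z0
  proof eventually_elim
    case (elim y)
    show ?case
    proof (cases "y \<in> \<Omega>")
      case True
      obtain u' b' M' Q' q' where w: "z y = (u', b', M', Q', q')" by (cases "z y")
      have "(u', b', M', Q') \<in> convex hull Kset" "norm u' = 1" "norm b' = 1"
        using elim True by (auto simp: w relaxed_box_def)
      from hull_Kset_extreme[OF this] show ?thesis
        by (simp add: T_def S_def u_def b_def M_def Q_def w)
    next
      case False
      then show ?thesis using elim T0 S0 by simp
    qed
  qed
  have seq: "(\<lambda>k. h (zs k y)) \<longlonglongrightarrow> h (z y)" if "(\<lambda>k. zs k y) \<longlonglongrightarrow> z y" "continuous_on UNIV h" for y and h :: "'n state \<Rightarrow> 'x::topological_space"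
    using continuous_on_tendsto_compose[OF that(2) that(1)] by simp
  have Tlim: "(\<lambda>k. Lnorm m UNIV (\<lambda>y. T (zs k y) $ i $ j)) \<longlonglongrightarrow> 0"
    and Slim: "(\<lambda>k. Lnorm m UNIV (\<lambda>y. S (zs k y) $ i $ j)) \<longlonglongrightarrow> 0" if m: "m > 0" for m i j
  proof -
    have meas: "(\<lambda>y. T (zs k y) $ i $ j) \<in> borel_measurable lebesgue" "(\<lambda>y. S (zs k y) $ i $ j) \<in> borel_measurable lebesgue" for k
      by (intro Cc_infty_integrable(2) Cc_infty_linear[OF bounded_linear_vec_nth] TC SC)+
    have "AE y in lebesgue. (\<lambda>k. T (zs k y) $ i $ j) \<longlonglongrightarrow> 0" 
      using lim TS by eventually_elim (use seq[OF _ contT] in \<open>fastforce intro: tendsto_eq_intros\<close>)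
    then show "(\<lambda>k. Lnorm m UNIV (\<lambda>y. T (zs k y) $ i $ j)) \<longlonglongrightarrow> 0"
      by (intro Lnorm_tendsto_0[OF meas(1) _ _ _ \<Omega>(2) m])
        (auto intro!: AE_I2 Tb[OF box, simplified] simp: X0_outside[OF zs] T0)
    have "AE y in lebesgue. (\<lambda>k. S (zs k y) $ i $ j) \<longlonglongrightarrow> 0" 
      using lim TS by eventually_elim (use seq[OF _ contS] in \<open>fastforce intro: tendsto_eq_intros\<close>)
    then show "(\<lambda>k. Lnorm m UNIV (\<lambda>y. S (zs k y) $ i $ j)) \<longlonglongrightarrow> 0"
      by (intro Lnorm_tendsto_0[OF meas(2) _ _ _ \<Omega>(2) m])
        (auto intro!: AE_I2 Sb[OF box, simplified] simp: X0_outside[OF zs] S0)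
  qed
  have dual: "(\<lambda>k. dual_norm m (\<lambda>y. (f k y, g k y))) \<longlonglongrightarrow> 0" if m: "m \<ge> 2" for m
  proof -
    define B where "B k = (\<Sum>i\<in>UNIV. \<Sum>j\<in>UNIV. Lnorm m UNIV (\<lambda>y. T (zs k y) $ i $ j)) + (\<Sum>i\<in>UNIV. \<Sum>j\<in>UNIV. Lnorm m UNIV (\<lambda>y. S (zs k y) $ i $ j))" for k
    have "B \<longlonglongrightarrow> (\<Sum>i\<in>(UNIV::'n set). \<Sum>j\<in>(UNIV::'n set). 0) + (\<Sum>i\<in>(UNIV::'n set). \<Sum>j\<in>(UNIV::'n set). 0)"
      unfolding B_def using m by (intro tendsto_add tendsto_sum Tlim Slim) auto
    then have "(\<lambda>k. ennreal (B k)) \<longlonglongrightarrow> ennreal 0" by (intro tendsto_ennrealI) simp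
    then have Blim: "(\<lambda>k. ennreal (B k)) \<longlonglongrightarrow> 0" by simp
    have le: "dual_norm m (\<lambda>y. (f k y, g k y)) \<le> ennreal (B k)" for k
      unfolding f_def g_def B_def using m by (intro dual_norm_Div_x TC SC) auto
    show ?thesis by (rule tendsto_sandwich[OF _ _ tendsto_const Blim]) (simp_all add: le)
  qed
  have zm: "z \<in> borel_measurable lebesgue" by (rule Linf_integrable(2)[OF zL \<Omega>(2)])
  have vmeas: "(\<lambda>y. v (h y)) \<in> borel_measurable lebesgue" if "h \<in> borel_measurable lebesgue" for h
    by (rule borel_measurable_continuous_on[OF contv that])
  have vz: "AE y in lebesgue. norm (v (z y)) \<le> 3 * C" "AE y in lebesgue. y \<notin> \<Omega> \<longrightarrow> v (z y) = 0"
  proof -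
    show "AE y in lebesgue. norm (v (z y)) \<le> 3 * C" using zbox by eventually_elim (rule vb)
    show "AE y in lebesgue. y \<notin> \<Omega> \<longrightarrow> v (z y) = 0" using z0 by eventually_elim (simp add: v0)
  qed
  have vzs: "AE y in lebesgue. norm (v (zs k y)) \<le> 3 * C" "AE y in lebesgue. y \<notin> \<Omega> \<longrightarrow> v (zs k y) = 0" for k
    using vb[OF box] by (auto simp: X0_outside[OF zs] v0)
  have Lm: "tendsto_Lm m (\<lambda>k y. v (zs k y)) (\<lambda>y. v (z y))" if m: "m \<ge> 2" for m
    unfolding tendsto_Lm_def
  proof (intro conjI allI)
    have m0: "m > 0" using m by simp
    show "(\<lambda>y. v (z y)) \<in> Lspace m" by (rule Lspace_bounded_support[OF vmeas[OF zm] vz \<Omega>(2) m0])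
    have zsm: "zs k \<in> borel_measurable lebesgue" for k by (rule Cc_infty_integrable(2)[OF zC])
    show "(\<lambda>y. v (zs k y)) \<in> Lspace m" for k by (rule Lspace_bounded_support[OF vmeas[OF zsm] vzs \<Omega>(2) m0])
    show "(\<lambda>k. Lnorm m UNIV (\<lambda>y. v (zs k y) - v (z y))) \<longlonglongrightarrow> 0"
    proof (rule Lnorm_tendsto_0[OF _ _ _ _ \<Omega>(2) m0])
      show "(\<lambda>y. v (zs k y) - v (z y)) \<in> borel_measurable lebesgue" for k
        using vmeas[OF zsm] vmeas[OF zm] by (rule borel_measurable_diff)
      show "AE y in lebesgue. norm (v (zs k y) - v (z y)) \<le> 3 * C + 3 * C" for k
        using vzs(1)[of k] vz(1) by eventually_elim (rule order_trans[OF norm_triangle_ineq4], rule add_mono)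
      show "AE y in lebesgue. y \<notin> \<Omega> \<longrightarrow> v (zs k y) - v (z y) = 0" for k
        using vzs(2)[of k] vz(2) by eventually_elim simp
      show "AE y in lebesgue. (\<lambda>k. v (zs k y) - v (z y)) \<longlonglongrightarrow> 0"
        using lim by eventually_elim (simp add: LIM_zero seq contv)
    qed
  qed
  show ?thesis
  proof (rule exI[of _ "\<lambda>k y. u (zs k y)"], rule exI[of _ "\<lambda>k y. b (zs k y)"], rule exI[of _ "\<lambda>k y. q (zs k y)"],
      rule exI[of _ f], rule exI[of _ g], intro conjI)
    show "\<forall>k. (\<lambda>y. u (zs k y)) \<in> Cc_infty \<and> (\<lambda>y. b (zs k y)) \<in> Cc_infty \<and> (\<lambda>y. q (zs k y)) \<in> Cc_infty \<and> f k \<in> Cc_infty \<and>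
      g k \<in> Cc_infty \<and> forced_mhd (\<lambda>y. u (zs k y)) (\<lambda>y. b (zs k y)) (\<lambda>y. q (zs k y)) (f k) (g k)"
      using uC bC qC forced Cc_infty_Div_x[OF TC] Cc_infty_Div_x[OF SC] unfolding f_def g_def by blast
    show "\<exists>C. \<forall>k. AE y in lebesgue. norm (u (zs k y), b (zs k y), q (zs k y)) \<le> C"
      using vzs(1) unfolding v_def by blast
    show "\<forall>m\<ge>2. tendsto_Lm m (\<lambda>k y. (u (zs k y), b (zs k y), q (zs k y))) (\<lambda>y. (fst (z y), fst (snd (z y)), snd (snd (snd (snd (z y)))))) \<and>
         (\<lambda>k. dual_norm m (\<lambda>y. (f k y, g k y))) \<longlonglongrightarrow> 0"
      using Lm dual unfolding v_def u_def b_def q_def by blast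
  qed
qed

theorem theorem1p4:
  fixes u b :: "'n::finite spacetime \<Rightarrow> real^'n" and p :: "'n spacetime \<Rightarrow> real"
  assumes "CARD('n) \<ge> 4"
    and "constructed u b p"
  shows "\<exists>(uk :: nat \<Rightarrow> 'n spacetime \<Rightarrow> real^'n) (bk :: nat \<Rightarrow> 'n spacetime \<Rightarrow> real^'n)
           (pk :: nat \<Rightarrow> 'n spacetime \<Rightarrow> real)
           (fk :: nat \<Rightarrow> 'n spacetime \<Rightarrow> real^'n) (gk :: nat \<Rightarrow> 'n spacetime \<Rightarrow> real^'n).
      (\<forall>k. uk k \<in> Cc_infty \<and> bk k \<in> Cc_infty \<and> pk k \<in> Cc_infty \<and> fk k \<in> Cc_infty \<and>
           gk k \<in> Cc_infty \<and> forced_mhd (uk k) (bk k) (pk k) (fk k) (gk k)) \<and>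
      (\<exists>C. \<forall>k. AE y in lebesgue. norm (uk k y, bk k y, pk k y) \<le> C) \<and>
      (\<forall>m\<ge>2.
         tendsto_Lm m (\<lambda>k y. (uk k y, bk k y, pk k y)) (\<lambda>y. (u y, b y, p y)) \<and>
         (\<lambda>k. dual_norm m (\<lambda>y. (fk k y, gk k y))) \<longlonglongrightarrow> 0)"
proof -
  obtain \<Omega> M Q q m where \<Omega>: "bounded_domain \<Omega>" and p: "p = q" and m: "m \<ge> 2"
    and z: "(\<lambda>y. (u y, b y, M y, Q y, q y)) \<in> X \<Omega>"
    and cases: "continuity_point \<Omega> m (\<lambda>y. (u y, b y, M y, Q y, q y)) \<or> iteration_limit \<Omega> m (\<lambda>y. (u y, b y, M y, Q y, q y))"
    using assms(2) unfolding constructed_def Let_def by blast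
  define z where "z = (\<lambda>y. (u y, b y, M y, Q y, q y))"
  have O: "open \<Omega>" "bounded \<Omega>" using \<Omega> by (auto simp: bounded_domain_def)
  have zX: "z \<in> X \<Omega>" using z by (simp add: z_def)
  note zL = X_Linf[OF zX]
  obtain a where a: "\<And>k. a k \<in> X0 \<Omega>" "(\<lambda>k. LINT y|lebesgue. norm (a k y - z y)) \<longlonglongrightarrow> 0"
    and unit: "AE y in lebesgue. y \<in> \<Omega> \<longrightarrow> norm (fst (z y)) = 1 \<and> norm (fst (snd (z y))) = 1"
  proof (cases "continuity_point \<Omega> m z")
    case True
    show ?thesis by (rule continuity_point_saturated[OF assms(1) O zX m True]) (rule that; assumption)
  next
    case False
    then have "iteration_limit \<Omega> m z" using cases by (simp add: z_def)
    then show ?thesis by (rule iteration_limit_saturated[OF O m]) (rule that; assumption)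
  qed
  obtain r where r: "AE y in lebesgue. (\<lambda>k. a (r k) y) \<longlonglongrightarrow> z y"
    by (rule L1_limit_AE[OF a(1) O(2) zL a(2)])
  from forced_solutions_of_strong_approximation[OF O zL a(1) r L1_limit_box[OF a(1) O(2) zL a(2)] unit]
  show ?thesis by (simp add: z_def p)
qed

end
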